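(* Let $q>2$ and consider the $q$-state Potts model with Hamiltonian $H$ on the $K\times L$ torus $\Lambda$. Given $\mathbf r\in\mathcal X^s$, the union $\mathcal G(\mathbf r,\mathcal X^s\setminus\{\mathbf r\})$ of all minimal gates for the transition $\mathbf r\to\mathcal X^s\setminus\{\mathbf r\}$ is $$\mathcal G(\mathbf r,\mathcal X^s\setminus\{\mathbf r\})=\bigcup_{\mathbf t\in\mathcal X^s\setminus\{\mathbf r\}}\mathcal F(\mathbf r,\mathbf t),$$ where $$\mathcal F(\mathbf r,\mathbf t)=\bigcup_{j=2}^{L-3}\mathcal W_j(\mathbf r,\mathbf t)\cup\overline{\mathcal H}(\mathbf r,\mathbf t)\cup\widetilde{\mathcal H}(\mathbf r,\mathbf t)\cup\overline{\mathcal Q}(\mathbf r,\mathbf t)\cup\widetilde{\mathcal Q}(\mathbf r,\mathbf t)\cup\overline{\mathcal P}(\mathbf r,\mathbf t)\cup\widetilde{\mathcal P}(\mathbf r,\mathbf t).$$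
   Context: Model. Fix integers $q$, $K<L$, $L\ge 3$. $\Lambda=(V,E)$ is the two-dimensional torus with $V=\{0,\dots,K-1\}\times\{0,\dots,L-1\}$ (vertex $(i,j)$ lies in row $i$ and column $j$; there are $K$ rows and $L$ columns) and $E$ the set of nearest-neighbour pairs with periodic boundary conditions. $S=\{1,\dots,q\}$, $\mathcal X=S^V$, $H(\sigma)=-\sum_{(v,w)\in E}1_{\{\sigma(v)=\sigma(w)\}}$. $Q(\sigma,\sigma')=1/(q|V|)$ if $\sigma,\sigma'$ differ at exactly one vertex, and $Q(\sigma,\sigma')=0$ if they differ at more than one vertex. For $s\in S$, bold $\mathbf s\in\mathcal X$ is the configuration constantly equal to $s$; $\mathcal X^s=\{\mathbf 1,\dots,\mathbf q\}$ is the set of global minima of $H$ (stable configurations). Paths, saddles, gates. A path $\omega:\sigma\to\sigma'$ is a finite sequence $\omega_0=\sigma,\dots,\omega_n=\sigma'$ in $\mathcal X$ with $Q(\omega_i,\omega_{i+1})>0$; $\Phi_\omega=\max_i H(\omega_i)$; $\Phi(\sigma,\sigma')=\min_{\omega:\sigma\to\sigma'}\Phi_\omega$; for a nonempty set $\mathcal A\not\ni\sigma$, $\Phi(\sigma,\mathcal A)=\min_{\sigma'\in\mathcal A}\Phi(\sigma,\sigma')$. $\Omega^{opt}_{\sigma,\mathcal A}$ is the set of paths $\omega$ from $\sigma$ to an element of $\mathcal A$ with $\Phi_\omega=\Phi(\sigma,\mathcal A)$ (optimal paths). $\mathcal S(\sigma,\mathcal A)$ is the set of $\xi\in\mathcal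 X$ such that there is $\omega\in\Omega^{opt}_{\sigma,\mathcal A}$ with $\xi\in\omega$ and $H(\xi)=\max_{\eta\in\omega}H(\eta)$ (minimal saddles). A gate for $\sigma\to\mathcal A$ is a subset $\mathcal W\subseteq\mathcal S(\sigma,\mathcal A)$ such that $\omega\cap\mathcal W\ne\varnothing$ for all $\omega\in\Omega^{opt}_{\sigma,\mathcal A}$. A gate $\mathcal W$ is a minimal gate if for every proper subset $\mathcal W'\subset\mathcal W$ there is $\omega'\in\Omega^{opt}_{\sigma,\mathcal A}$ with $\omega'\cap\mathcal W'=\varnothing$. Sets of configurations. For distinct spins $r,s$: $\bar R_{a,b}(r,s)$ is the set of configurations in which all spins are $r$ except those, equal to $s$, in a rectangle $a\times b$ of $\Lambda$ ($a$ = horizontal length, i.e. number of columns; $b$ = vertical length, i.e. number of rows). $\bar B^h_{a,b}(r,s)$, $1\le h\le b-1$, is the set of configurations in which all spins are $r$ except those, equal to $s$, in a rectangle $a\times b$ together with a bar $1\times h$ (one column wide, $h$ consecutive rows) adjacent to one of the sides of length $b$. $\tilde R_{a,b}(r,s)$, $\tilde B^h_{a,b}(r,s)$ are the same with the roles of $r$ and $s$ interchanged. Put $\overline{\mathcal P}(\mathbf r,\mathbf s)=\bar B^{K-1}_{1,K}(r,s)$; $\overline{\mathcal Q}(\mathbf r,\mathbf s)=\bar R_{2,K-1}(r,s)\cup\bar B^{K-2}_{1,K}(r,s)$; $\overline{\mathcal H}_i(\mathbf r,\mathbf s)=\bar B^i_{1,K}(r,s)\cup\bigcup_{h=i+1}^{K-2}\bar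 B^h_{1,K-1}(r,s)$ for $i=1,\dots,K-3$; $\overline{\mathcal H}(\mathbf r,\mathbf s)=\bigcup_{i=1}^{K-3}\overline{\mathcal H}_i(\mathbf r,\mathbf s)$; and $\widetilde{\mathcal P},\widetilde{\mathcal Q},\widetilde{\mathcal H}_i,\widetilde{\mathcal H}$ by the same formulas with $\tilde R,\tilde B$ in place of $\bar R,\bar B$. Finally $\mathcal W_j^{(h)}(\mathbf r,\mathbf s)=\bar B^h_{j,K}(r,s)=\tilde B^{K-h}_{L-j-1,K}(r,s)$ for $j=2,\dots,L-3$, $h=1,\dots,K-1$, and $\mathcal W_j(\mathbf r,\mathbf s)=\bigcup_{h=1}^{K-1}\mathcal W_j^{(h)}(\mathbf r,\mathbf s)$.
   Formalization: The formal theorem assumes K ≥ 4. For K = 3 the 3-vertex corner configurations in B^1_{1,2} lie in minimal gates but not in F; for K = 2, F mixes energies (R_{2,1} and B^1_{1,2}); for K = 1, F contains no saddle. *)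

theory Defs
  imports Complex_Main "HOL-Library.FuncSet"
begin

section \<open>The Potts model on a torus\<close>

text \<open>
  The parameters \<open>K\<close> (number of rows), \<open>L\<close> (number of columns) and \<open>q\<close> (number of spins) are
  explicit arguments.  A vertex \<open>(i, j)\<close> lies in row \<open>i\<close> and column \<open>j\<close>.
\<close>

definition vertices :: "nat \<Rightarrow> nat \<Rightarrow> (nat \<times> nat) set" where
  "vertices K L = {0..<K} \<times> {0..<L}"

definition edges :: "nat \<Rightarrow> nat \<Rightarrow> (nat \<times> nat) set set" where
  "edges K L =
     {{(i, j), ((i + 1) mod K, j)} | i j. i < K \<and> j < L} \<union>
     {{(i, j), (i, (j + 1) mod L)} | i j. i < K \<and> j < L}"

definition spins :: "nat \<Rightarrow> nat set" where
  "spins q = {1..q}"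

type_synonym config = "nat \<times> nat \<Rightarrow> nat"

text \<open>Configurations take the value \<^term>\<open>undefined\<close> outside the torus, so that equality of
  configurations is equality on the torus.\<close>

definition configs :: "nat \<Rightarrow> nat \<Rightarrow> nat \<Rightarrow> config set" where
  "configs q K L = vertices K L \<rightarrow>\<^sub>E spins q"

definition energy :: "nat \<Rightarrow> nat \<Rightarrow> config \<Rightarrow> int" where
  "energy K L \<sigma> = - (\<Sum>e\<in>edges K L. if (\<forall>v\<in>e. \<forall>w\<in>e. \<sigma> v = \<sigma> w) then 1 else 0)"

text \<open>
  The diagonal value \<open>1/q\<close> is what makes the rows of the connectivity matrix sum to one: a
  configuration differs at exactly one vertex from \<open>(q - 1) |V|\<close> others.  It plays no
  role for gates, since a path may be freed of repeated steps without changing its set of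
  configurations.
\<close>

definition connectivity :: "nat \<Rightarrow> nat \<Rightarrow> nat \<Rightarrow> config \<Rightarrow> config \<Rightarrow> real" where
  "connectivity q K L \<sigma> \<sigma>' =
     (let d = card {v \<in> vertices K L. \<sigma> v \<noteq> \<sigma>' v} in
      if d = 0 then 1 / real q
      else if d = 1 then 1 / (real q * real (card (vertices K L)))
      else 0)"

definition constant_config :: "nat \<Rightarrow> nat \<Rightarrow> nat \<Rightarrow> config" where
  "constant_config K L s = (\<lambda>v\<in>vertices K L. s)"

text \<open>The stable configurations; \<open>stable_configs_eq_global_minima\<close> below shows that they are
  the global minima of the Hamiltonian.\<close>

definition stable_configs :: "nat \<Rightarrow> nat \<Rightarrow> nat \<Rightarrow> config set" where
  "stable_configs q K L = constant_config K L ` spins q"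


section \<open>Paths, saddles and gates\<close>

definition paths :: "nat \<Rightarrow> nat \<Rightarrow> nat \<Rightarrow> config \<Rightarrow> config \<Rightarrow> config list set" where
  "paths q K L \<sigma> \<sigma>' =
     {\<omega>. \<omega> \<noteq> [] \<and> set \<omega> \<subseteq> configs q K L \<and> hd \<omega> = \<sigma> \<and> last \<omega> = \<sigma>' \<and>
         (\<forall>i. Suc i < length \<omega> \<longrightarrow> connectivity q K L (\<omega> ! i) (\<omega> ! Suc i) > 0)}"

definition path_height :: "nat \<Rightarrow> nat \<Rightarrow> config list \<Rightarrow> int" where
  "path_height K L \<omega> = Max (energy K L ` set \<omega>)"

text \<open>Although there are infinitely many paths, the minimum below is over a finite set of
  integers, as there are only finitely many energy values.\<close>

definition comm_height :: "nat \<Rightarrow> nat \<Rightarrow> nat \<Rightarrow> config \<Rightarrow> config \<Rightarrow> int" where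
  "comm_height q K L \<sigma> \<sigma>' = Min (path_height K L ` paths q K L \<sigma> \<sigma>')"

definition comm_height_set :: "nat \<Rightarrow> nat \<Rightarrow> nat \<Rightarrow> config \<Rightarrow> config set \<Rightarrow> int" where
  "comm_height_set q K L \<sigma> A = Min (comm_height q K L \<sigma> ` A)"

definition optimal_paths :: "nat \<Rightarrow> nat \<Rightarrow> nat \<Rightarrow> config \<Rightarrow> config set \<Rightarrow> config list set" where
  "optimal_paths q K L \<sigma> A =
     {\<omega> \<in> (\<Union>\<eta>\<in>A. paths q K L \<sigma> \<eta>). path_height K L \<omega> = comm_height_set q K L \<sigma> A}"

definition minimal_saddles :: "nat \<Rightarrow> nat \<Rightarrow> nat \<Rightarrow> config \<Rightarrow> config set \<Rightarrow> config set" where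
  "minimal_saddles q K L \<sigma> A =
     {\<xi> \<in> configs q K L. \<exists>\<omega>\<in>optimal_paths q K L \<sigma> A.
        \<xi> \<in> set \<omega> \<and> energy K L \<xi> = Max (energy K L ` set \<omega>)}"

definition gate :: "nat \<Rightarrow> nat \<Rightarrow> nat \<Rightarrow> config \<Rightarrow> config set \<Rightarrow> config set \<Rightarrow> bool" where
  "gate q K L \<sigma> A W \<longleftrightarrow>
     W \<subseteq> minimal_saddles q K L \<sigma> A \<and> (\<forall>\<omega>\<in>optimal_paths q K L \<sigma> A. set \<omega> \<inter> W \<noteq> {})"

definition minimal_gate :: "nat \<Rightarrow> nat \<Rightarrow> nat \<Rightarrow> config \<Rightarrow> config set \<Rightarrow> config set \<Rightarrow> bool" where
  "minimal_gate q K L \<sigma> A W \<longleftrightarrow>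
     gate q K L \<sigma> A W \<and>
     (\<forall>W'. W' \<subset> W \<longrightarrow> (\<exists>\<omega>\<in>optimal_paths q K L \<sigma> A. set \<omega> \<inter> W' = {}))"

definition union_minimal_gates ::
    "nat \<Rightarrow> nat \<Rightarrow> nat \<Rightarrow> config \<Rightarrow> config set \<Rightarrow> config set" where
  "union_minimal_gates q K L \<sigma> A = \<Union>{W. minimal_gate q K L \<sigma> A W}"


section \<open>Rectangles and bars\<close>

text \<open>
  The \<open>a \<times> b\<close> rectangle (\<open>a\<close> columns, \<open>b\<close> rows) of the torus whose first row is \<open>i\<close> and whose
  first column is \<open>j\<close>; it may cross the periodic boundary.
\<close>

definition rectangle :: "nat \<Rightarrow> nat \<Rightarrow> nat \<Rightarrow> nat \<Rightarrow> nat \<Rightarrow> nat \<Rightarrow> (nat \<times> nat) set" where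
  "rectangle K L a b i j = {((i + x) mod K, (j + y) mod L) | x y. x < b \<and> y < a}"

definition two_spin_config ::
    "nat \<Rightarrow> nat \<Rightarrow> nat \<Rightarrow> nat \<Rightarrow> (nat \<times> nat) set \<Rightarrow> config" where
  "two_spin_config K L r s D = (\<lambda>v\<in>vertices K L. if v \<in> D then s else r)"

definition R_bar :: "nat \<Rightarrow> nat \<Rightarrow> nat \<Rightarrow> nat \<Rightarrow> nat \<Rightarrow> nat \<Rightarrow> config set" where
  "R_bar K L a b r s =
     {two_spin_config K L r s (rectangle K L a b i j) | i j. i < K \<and> j < L}"

text \<open>
  The bar occupies the rows \<open>i + m, \<dots>, i + m + h - 1\<close> of the column just to the right
  (\<open>j + a\<close>) or just to the left (\<open>j - 1\<close>, written \<open>j + L - 1\<close> modulo \<open>L\<close>) of the rectangle;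
  \<open>m + h \<le> b\<close> says that the whole bar lies along the side of length \<open>b\<close>.  If \<open>b = K\<close> this
  side is a closed cycle, and letting \<open>i\<close> vary yields the bars in every cyclic position.
\<close>

definition B_bar :: "nat \<Rightarrow> nat \<Rightarrow> nat \<Rightarrow> nat \<Rightarrow> nat \<Rightarrow> nat \<Rightarrow> nat \<Rightarrow> config set" where
  "B_bar K L a b h r s =
     {two_spin_config K L r s (rectangle K L a b i j \<union> rectangle K L 1 h (i + m) c)
      | i j m c. i < K \<and> j < L \<and> 1 \<le> h \<and> h \<le> b - 1 \<and> m + h \<le> b \<and>
                 (c = j + a \<or> c = j + L - 1)}"

definition R_tilde :: "nat \<Rightarrow> nat \<Rightarrow> nat \<Rightarrow> nat \<Rightarrow> nat \<Rightarrow> nat \<Rightarrow> config set" where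
  "R_tilde K L a b r s = R_bar K L a b s r"

definition B_tilde :: "nat \<Rightarrow> nat \<Rightarrow> nat \<Rightarrow> nat \<Rightarrow> nat \<Rightarrow> nat \<Rightarrow> nat \<Rightarrow> config set" where
  "B_tilde K L a b h r s = B_bar K L a b h s r"


section \<open>The sets making up the union of minimal gates\<close>

definition P_bar :: "nat \<Rightarrow> nat \<Rightarrow> nat \<Rightarrow> nat \<Rightarrow> config set" where
  "P_bar K L r s = B_bar K L 1 K (K - 1) r s"

definition Q_bar :: "nat \<Rightarrow> nat \<Rightarrow> nat \<Rightarrow> nat \<Rightarrow> config set" where
  "Q_bar K L r s = R_bar K L 2 (K - 1) r s \<union> B_bar K L 1 K (K - 2) r s"

definition Hi_bar :: "nat \<Rightarrow> nat \<Rightarrow> nat \<Rightarrow> nat \<Rightarrow> nat \<Rightarrow> config set" where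
  "Hi_bar K L i r s =
     B_bar K L 1 K i r s \<union> (\<Union>h\<in>{i + 1..K - 2}. B_bar K L 1 (K - 1) h r s)"

definition H_bar :: "nat \<Rightarrow> nat \<Rightarrow> nat \<Rightarrow> nat \<Rightarrow> config set" where
  "H_bar K L r s = (\<Union>i\<in>{1..K - 3}. Hi_bar K L i r s)"

definition P_tilde :: "nat \<Rightarrow> nat \<Rightarrow> nat \<Rightarrow> nat \<Rightarrow> config set" where
  "P_tilde K L r s = B_tilde K L 1 K (K - 1) r s"

definition Q_tilde :: "nat \<Rightarrow> nat \<Rightarrow> nat \<Rightarrow> nat \<Rightarrow> config set" where
  "Q_tilde K L r s = R_tilde K L 2 (K - 1) r s \<union> B_tilde K L 1 K (K - 2) r s"

definition Hi_tilde :: "nat \<Rightarrow> nat \<Rightarrow> nat \<Rightarrow> nat \<Rightarrow> nat \<Rightarrow> config set" where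
  "Hi_tilde K L i r s =
     B_tilde K L 1 K i r s \<union> (\<Union>h\<in>{i + 1..K - 2}. B_tilde K L 1 (K - 1) h r s)"

definition H_tilde :: "nat \<Rightarrow> nat \<Rightarrow> nat \<Rightarrow> nat \<Rightarrow> config set" where
  "H_tilde K L r s = (\<Union>i\<in>{1..K - 3}. Hi_tilde K L i r s)"

text \<open>For \<open>2 \<le> j \<le> L - 3\<close> and \<open>1 \<le> h \<le> K - 1\<close> the following set is also
  \<open>B_tilde K L (L - j - 1) K (K - h) r s\<close>: the complement of a strip with a bar is again a
  strip with a bar.\<close>

definition W_bar :: "nat \<Rightarrow> nat \<Rightarrow> nat \<Rightarrow> nat \<Rightarrow> nat \<Rightarrow> nat \<Rightarrow> config set" where
  "W_bar K L j h r s = B_bar K L j K h r s"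

definition W_union :: "nat \<Rightarrow> nat \<Rightarrow> nat \<Rightarrow> nat \<Rightarrow> nat \<Rightarrow> config set" where
  "W_union K L j r s = (\<Union>h\<in>{1..K - 1}. W_bar K L j h r s)"

definition F_union :: "nat \<Rightarrow> nat \<Rightarrow> nat \<Rightarrow> nat \<Rightarrow> config set" where
  "F_union K L r t =
     (\<Union>j\<in>{2..L - 3}. W_union K L j r t) \<union> H_bar K L r t \<union> H_tilde K L r t \<union>
     Q_bar K L r t \<union> Q_tilde K L r t \<union> P_bar K L r t \<union> P_tilde K L r t"


section \<open>The stable configurations are the global minima\<close>

lemma finite_edges: "finite (edges K L)"
proof -
  have "edges K L = (\<lambda>(i, j). {(i, j), ((i + 1) mod K, j)}) ` ({..<K} \<times> {..<L}) \<union>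
     (\<lambda>(i, j). {(i, j), (i, (j + 1) mod L)}) ` ({..<K} \<times> {..<L})"
    unfolding edges_def by (auto simp: image_iff)
  then show ?thesis by simp
qed

lemma edges_subset:
  assumes "e \<in> edges K L" "v \<in> e"
  shows "v \<in> vertices K L"
  using assms unfolding edges_def vertices_def by auto

lemma energy_ge: "energy K L \<sigma> \<ge> - int (card (edges K L))"
proof -
  have "(\<Sum>e\<in>edges K L. if (\<forall>v\<in>e. \<forall>w\<in>e. \<sigma> v = \<sigma> w) then 1 else 0 :: int)
      \<le> (\<Sum>e\<in>edges K L. 1)"
    by (rule sum_mono) auto
  then show ?thesis unfolding energy_def by simp
qed

lemma energy_constant_config:
  "energy K L (constant_config K L s) = - int (card (edges K L))"
proof -
  have "(\<Sum>e\<in>edges K L. if (\<forall>v\<in>e. \<forall>w\<in>e. constant_config K L s v = constant_config K L s w)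
           then 1 else 0 :: int) = (\<Sum>e\<in>edges K L. 1)"
    by (rule sum.cong) (auto simp: constant_config_def edges_subset)
  then show ?thesis unfolding energy_def by simp
qed

lemma energy_minimal_imp_constant:
  assumes "energy K L \<sigma> \<le> - int (card (edges K L))" and v: "(i, j) \<in> vertices K L"
  shows "\<sigma> (i, j) = \<sigma> (0, 0)"
proof -
  have mono: "\<sigma> a = \<sigma> b" if "{a, b} \<in> edges K L" for a b
  proof (rule ccontr)
    assume neq: "\<sigma> a \<noteq> \<sigma> b"
    have "(\<Sum>e\<in>edges K L. if (\<forall>v\<in>e. \<forall>w\<in>e. \<sigma> v = \<sigma> w) then 1 else 0 :: int)
        < (\<Sum>e\<in>edges K L. 1)"
    proof (rule sum_strict_mono_ex1[OF finite_edges])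
      show "\<exists>e\<in>edges K L.
          (if \<forall>v\<in>e. \<forall>w\<in>e. \<sigma> v = \<sigma> w then 1 else 0 :: int) < 1"
        using that neq by (intro bexI[of _ "{a, b}"]) auto
    qed auto
    then show False using assms(1) unfolding energy_def by simp
  qed
  have row: "\<sigma> (0, j') = \<sigma> (0, 0)" if "j' < L" "0 < K" for j'
    using that
  proof (induction j')
    case (Suc j')
    have "{(0, j'), (0, (j' + 1) mod L)} \<in> edges K L"
      unfolding edges_def using Suc.prems
      by (intro UnI2 CollectI exI[of _ 0] exI[of _ j'] conjI refl) auto
    then have "\<sigma> (0, j') = \<sigma> (0, Suc j')"
      using mono[of "(0, j')"] Suc.prems by simp
    then show ?case using Suc by simp
  qed simp
  have col: "\<sigma> (i', j) = \<sigma> (0, j)" if "i' < K" "j < L" for i'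
    using that
  proof (induction i')
    case (Suc i')
    have "{(i', j), ((i' + 1) mod K, j)} \<in> edges K L"
      unfolding edges_def using Suc.prems
      by (intro UnI1 CollectI exI[of _ i'] exI[of _ j] conjI refl) auto
    then have "\<sigma> (i', j) = \<sigma> (Suc i', j)"
      using mono[of "(i', j)"] Suc.prems by simp
    then show ?case using Suc by simp
  qed simp
  show ?thesis using row[of j] col[of i] v by (auto simp: vertices_def)
qed

lemma stable_configs_eq_global_minima:
  assumes "K \<ge> 1" "L \<ge> 1"
  shows "stable_configs q K L =
    {\<sigma> \<in> configs q K L. \<forall>\<eta>\<in>configs q K L. energy K L \<sigma> \<le> energy K L \<eta>}"
proof (intro subset_antisym subsetI)
  fix \<sigma> assume "\<sigma> \<in> stable_configs q K L"
  then obtain s where s: "s \<in> spins q" "\<sigma> = constant_config K L s"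
    unfolding stable_configs_def by auto
  have "\<sigma> \<in> configs q K L"
    using s by (auto simp: configs_def constant_config_def)
  then show "\<sigma> \<in> {\<sigma> \<in> configs q K L. \<forall>\<eta>\<in>configs q K L. energy K L \<sigma> \<le> energy K L \<eta>}"
    using s(2) energy_constant_config energy_ge by auto
next
  fix \<sigma> assume "\<sigma> \<in> {\<sigma> \<in> configs q K L. \<forall>\<eta>\<in>configs q K L. energy K L \<sigma> \<le> energy K L \<eta>}"
  then have \<sigma>: "\<sigma> \<in> configs q K L"
    and min: "\<And>\<eta>. \<eta> \<in> configs q K L \<Longrightarrow> energy K L \<sigma> \<le> energy K L \<eta>" by auto
  have "(0, 0) \<in> vertices K L" using assms by (auto simp: vertices_def)
  then have s: "\<sigma> (0, 0) \<in> spins q" using \<sigma> by (auto simp: configs_def)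
  then have "constant_config K L (\<sigma> (0, 0)) \<in> configs q K L"
    by (auto simp: configs_def constant_config_def)
  from min[OF this] have le: "energy K L \<sigma> \<le> - int (card (edges K L))"
    by (simp add: energy_constant_config)
  have "\<sigma> = constant_config K L (\<sigma> (0, 0))"
  proof
    fix v show "\<sigma> v = constant_config K L (\<sigma> (0, 0)) v"
    proof (cases "v \<in> vertices K L")
      case True
      then show ?thesis
        using energy_minimal_imp_constant[OF le, of "fst v" "snd v"]
        by (simp add: constant_config_def)
    next
      case False
      then show ?thesis using \<sigma> by (auto simp: configs_def constant_config_def)
    qed
  qed
  then show "\<sigma> \<in> stable_configs q K L" using s by (auto simp: stable_configs_def)
qed

end

theory Submission
  imports Defs
begin


text \<open>
  The union of all minimal gates consists of the essential saddles: a saddle \<open>x\<close> lies in a minimal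
  gate if and only if some optimal path through \<open>x\<close> cannot be replaced by an optimal path all of whose
  saddles are among those of the former, without \<open>x\<close>. Hence it has to be found out which saddles an
  optimal path cannot dispense with.

  Up to a constant, the energy is the perimeter, the number of bonds between different spins. Every
  row and every column is a cycle, on which the number of changes of spin is zero or at least two,
  and exactly two changes cut the cycle into two monochromatic arcs (\<open>nonconstant_changes\<close>). The level
  of the saddles is \<open>2 * K + 2\<close>. If no row is monochromatic, the rows use up \<open>2 * K\<close> of it, and the
  rest suffices for a single bar (\<open>profile\<close>). This rigidity makes the landscape near the level of the
  saddles one-dimensional:

  \<^item> A path from \<open>r\<close> starts among configurations that have a row and a column with at most one vertex of
    another spin. At the level of the saddles or below, it can leave them only by completing a second
    column with some spin \<open>t\<close> (\<open>leaving_mostly\<close>).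
  \<^item> The corridor from \<open>r\<close> to \<open>t\<close> consists of the vertical strips with or without a bar and of the
    configurations where the column at one end still has a gap. A path can leave it only at its ends
    (\<open>corridor_neighbours\<close>), and from each end there is a descent below the level of the saddles to the
    corresponding stable configuration (\<open>entrance_reach\<close>). The saddles in the corridor are exactly
    the set \<open>F_union K L r t\<close> (\<open>F_union_eq_saddles\<close>).

  Consequently an optimal path can be modified, without adding saddles, so that all its saddles lie in
  corridors (\<open>optimal_path_within_corridors\<close>); this excludes all other saddles from minimal gates.
  Conversely, every saddle \<open>x\<close> in a corridor lies on a path that flips the vertices from \<open>r\<close> to \<open>t\<close> one
  by one. On such a path a saddle is determined by the number of flipped vertices. An optimal path
  whose saddles all lie on it has to run through the corridor from one end to the other, and so
  passes through all numbers of flipped vertices in between, in particular through the one of \<open>x\<close>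
  (\<open>saddle_essential\<close>). Therefore \<open>x\<close> cannot be dispensed with.
\<close>

section \<open>Functions on a cycle\<close>

definition cyc_changes :: "nat \<Rightarrow> (nat \<Rightarrow> nat) \<Rightarrow> nat" where
  "cyc_changes n f = card {j. j < n \<and> f j \<noteq> f ((j + 1) mod n)}"

text \<open>The arc of \<open>l\<close> consecutive points starting at \<open>c\<close>; the start need not be reduced modulo
  \<open>n\<close>, which spares case distinctions when bars are shifted around the torus.\<close>

definition arc :: "nat \<Rightarrow> nat \<Rightarrow> nat \<Rightarrow> nat set" where
  "arc n c l = (\<lambda>k. (c + k) mod n) ` {..<l}"

lemma bij_betw_rotation:
  fixes n :: nat
  assumes "0 < n"
  shows "bij_betw (\<lambda>k. (c + k) mod n) {..<n} {..<n}"
proof -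
  have le: "x = y" if "x \<le> y" "y < n" "(c + x) mod n = (c + y) mod n" for x y :: nat
  proof -
    have "n dvd (c + y) - (c + x)"
      by (rule mod_eq_dvd_iff_nat[THEN iffD1]) (use that(1,3) in auto)
    then have "n dvd y - x" unfolding diff_cancel2 by (metis diff_cancel2 add.commute)
    then have "y - x = 0" using that(2) nat_dvd_not_less[of "y - x" n] by linarith
    then show ?thesis using that(1) by simp
  qed
  have inj: "inj_on (\<lambda>k. (c + k) mod n) {..<n}"
  proof (rule inj_onI)
    fix x y assume "x \<in> {..<n}" "y \<in> {..<n}" "(c + x) mod n = (c + y) mod n"
    then show "x = y" using le[of x y] le[of y x] by (cases "x \<le> y") auto
  qed
  moreover have "(\<lambda>k. (c + k) mod n) ` {..<n} \<subseteq> {..<n}" using assms by auto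
  ultimately show ?thesis
    by (simp add: bij_betw_def endo_inj_surj)
qed

lemma rotation_eq_iff:
  fixes n :: nat
  assumes "x < n" "y < n"
  shows "(c + x) mod n = (c + y) mod n \<longleftrightarrow> x = y"
  by (rule inj_on_eq_iff[OF bij_betw_imp_inj_on[OF bij_betw_rotation]]) (use assms in auto)

lemma obtain_rotation:
  fixes n :: nat
  assumes "j < n"
  obtains k where "k < n" "j = (c + k) mod n"
proof -
  have "j \<in> (\<lambda>k. (c + k) mod n) ` {..<n}"
    using bij_betw_rotation[of n c] assms by (auto simp: bij_betw_def)
  then show ?thesis using that by auto
qed

lemma mem_arc_iff:
  assumes "k < n" "l \<le> n"
  shows "(c + k) mod n \<in> arc n c l \<longleftrightarrow> k < l"
proof
  assume "(c + k) mod n \<in> arc n c l"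
  then obtain k' where k': "k' < l" "(c + k) mod n = (c + k') mod n" by (auto simp: arc_def)
  have "k = k'"
    by (rule rotation_eq_iff[THEN iffD1, OF _ _ k'(2)]) (use assms k'(1) in linarith)+
  then show "k < l" using k'(1) by simp
next
  assume "k < l"
  then show "(c + k) mod n \<in> arc n c l"
    unfolding arc_def by (intro imageI) simp
qed

lemma arc_subset: "0 < n \<Longrightarrow> arc n c l \<subseteq> {..<n}"
  by (auto simp: arc_def)

lemma card_arc:
  assumes "l \<le> n"
  shows "card (arc n c l) = l"
proof (cases "n = 0")
  case False
  then have "inj_on (\<lambda>k. (c + k) mod n) {..<n}"
    using bij_betw_rotation by (blast intro: bij_betw_imp_inj_on)
  then have "inj_on (\<lambda>k. (c + k) mod n) {..<l}"
    by (rule inj_on_subset) (use assms in auto)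
  from card_image[OF this] show ?thesis by (simp add: arc_def)
qed (use assms in \<open>simp add: arc_def\<close>)

lemma arc_0 [simp]: "arc n c 0 = {}"
  by (simp add: arc_def)

lemma arc_1 [simp]: "arc n c (Suc 0) = {c mod n}"
  by (simp add: arc_def lessThan_Suc)

lemma arc_Suc: "arc n c (Suc l) = insert ((c + l) mod n) (arc n c l)"
  by (simp add: arc_def lessThan_Suc)

lemma arc_full: "0 < n \<Longrightarrow> arc n c n = {..<n}"
  using bij_betw_rotation[of n c] by (simp add: arc_def bij_betw_def)

lemma arc_mod: "arc n (c mod n) l = arc n c l"
  by (simp add: arc_def mod_add_left_eq)

lemma arc_cong: "a mod n = b mod n \<Longrightarrow> arc n a l = arc n b l"
  by (metis arc_mod)

lemma arc_complement:
  assumes "0 < n" "l \<le> n"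
  shows "{..<n} - arc n c l = arc n (c + l) (n - l)"
proof (rule card_subset_eq[symmetric])
  show "arc n (c + l) (n - l) \<subseteq> {..<n} - arc n c l"
  proof
    fix j assume "j \<in> arc n (c + l) (n - l)"
    then obtain k where k: "k < n - l" "j = (c + (l + k)) mod n"
      by (auto simp: arc_def add.assoc)
    have "j \<notin> arc n c l"
      unfolding k(2) using k(1) assms by (subst mem_arc_iff) auto
    moreover have "j < n" unfolding k(2) using assms(1) by (rule mod_less_divisor)
    ultimately show "j \<in> {..<n} - arc n c l" by blast
  qed
qed (use assms card_Diff_subset[of "arc n c l" "{..<n}"] arc_subset[of n c l] in
    \<open>auto simp: card_arc finite_subset\<close>)

lemma cyc_changes_rotate:
  assumes "0 < n"
  shows "cyc_changes n f = card {k. k < n \<and> f ((c + k) mod n) \<noteq> f ((c + k + 1) mod n)}"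
proof -
  let ?g = "\<lambda>k. (c + k) mod n"
  have "{j. j < n \<and> f j \<noteq> f ((j + 1) mod n)} =
      ?g ` {k. k < n \<and> f ((c + k) mod n) \<noteq> f ((c + k + 1) mod n)}"
  proof (intro subset_antisym subsetI)
    fix j assume "j \<in> {j. j < n \<and> f j \<noteq> f ((j + 1) mod n)}"
    then have j: "j < n" "f j \<noteq> f ((j + 1) mod n)" by auto
    obtain k where "k < n" "j = (c + k) mod n" using obtain_rotation[OF j(1)] .
    then show "j \<in> ?g ` {k. k < n \<and> f ((c + k) mod n) \<noteq> f ((c + k + 1) mod n)}"
      using j by (auto simp: mod_Suc_eq)
  qed (use assms in \<open>auto simp: mod_Suc_eq\<close>)
  then show ?thesis unfolding cyc_changes_def
    by (simp only:) (intro card_image inj_onI, simp add: rotation_eq_iff)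
qed

lemma cyc_changes_cong:
  assumes "\<And>j. j < n \<Longrightarrow> f j = g j"
  shows "cyc_changes n f = cyc_changes n g"
proof -
  have "f j \<noteq> f ((j + 1) mod n) \<longleftrightarrow> g j \<noteq> g ((j + 1) mod n)" if "j < n" for j
  proof -
    have "(j + 1) mod n < n" using that by (intro mod_less_divisor) simp
    then show ?thesis using assms that by metis
  qed
  then show ?thesis unfolding cyc_changes_def by (intro arg_cong[where f = card]) blast
qed

lemma cyc_changes_const:
  assumes "\<And>j. j < n \<Longrightarrow> f j = a"
  shows "cyc_changes n f = 0"
proof -
  have "cyc_changes n f = cyc_changes n (\<lambda>_. a)"
    by (rule cyc_changes_cong) (rule assms)
  also have "\<dots> = 0" by (simp add: cyc_changes_def)
  finally show ?thesis .
qed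

text \<open>Between two successive changes the function is constant, so that one change cannot be
  the only one; if there are exactly two, they cut the cycle into two monochromatic arcs.\<close>

lemma nonconstant_changes:
  assumes "i < n" "j < n" "f i \<noteq> f j"
  shows "2 \<le> cyc_changes n f"
    and "cyc_changes n f \<le> 2 \<Longrightarrow>
      \<exists>c l a b. c < n \<and> 0 < l \<and> l < n \<and> a \<noteq> b \<and>
        (\<forall>k<n. f ((c + k) mod n) = (if k < l then b else a))"
proof -
  have n: "0 < n" using assms by simp
  have walk: "f ((c + k0 + m) mod n) = f ((c + k0) mod n)"
    if "\<And>k. k0 \<le> k \<Longrightarrow> k < k0 + m \<Longrightarrow> f ((c + k) mod n) = f ((c + k + 1) mod n)" for c k0 m
    using that
  proof (induction m)
    case (Suc m)
    have "f ((c + (k0 + m)) mod n) = f ((c + (k0 + m) + 1) mod n)"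
      by (rule Suc.prems) auto
    moreover have "f ((c + k0 + m) mod n) = f ((c + k0) mod n)"
      by (rule Suc.IH) (rule Suc.prems, auto)
    ultimately show ?case by (metis add.assoc add_Suc_right Suc_eq_plus1)
  qed simp
  have "\<exists>p<n. f p \<noteq> f ((p + 1) mod n)"
  proof (rule ccontr)
    assume "\<not> ?thesis"
    then have all: "f p = f ((p + 1) mod n)" if "p < n" for p using that by blast
    have "f ((0 + 0 + k) mod n) = f ((0 + 0) mod n)" for k
    proof (rule walk)
      fix k show "f ((0 + k) mod n) = f ((0 + k + 1) mod n)"
        using all[OF mod_less_divisor[OF n], of k] by (metis add_0 mod_add_left_eq)
    qed
    from this[of i] this[of j] show False using assms by (metis add_0 mod_less)
  qed
  then obtain p where p: "p < n" "f p \<noteq> f ((p + 1) mod n)" by auto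
  \<comment> \<open>Start right after a change, so that the first arc begins at \<open>c\<close> and the change at \<open>p\<close> is the last
    one.\<close>
  define c where "c = (p + 1) mod n"
  have c: "c < n" using n by (simp add: c_def)
  have cp: "(c + (n - 1)) mod n = p"
  proof -
    have "(c + (n - 1)) mod n = (p + 1 + (n - 1)) mod n"
      unfolding c_def by (rule mod_add_left_eq)
    also have "p + 1 + (n - 1) = p + n" using n by simp
    finally show ?thesis using p(1) by simp
  qed
  define A where "A = {k. k < n \<and> f ((c + k) mod n) \<noteq> f ((c + k + 1) mod n)}"
  have cyc: "cyc_changes n f = card A"
    unfolding A_def by (rule cyc_changes_rotate[OF n])
  have lastA: "n - 1 \<in> A"
  proof -
    have "(c + (n - 1) + 1) mod n = c" using c n by simp
    then show ?thesis using p n cp by (simp add: A_def c_def)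
  qed
  define k1 where "k1 = (LEAST k. k \<in> A)"
  have k1: "k1 \<in> A" unfolding k1_def using lastA by (rule LeastI)
  have least: "k \<notin> A" if "k < k1" for k using that unfolding k1_def by (rule not_less_Least)
  have k1n: "k1 < n" using k1 by (simp add: A_def)
  have first: "f ((c + k) mod n) = f c" if "k \<le> k1" for k
  proof -
    have "f ((c + 0 + k) mod n) = f ((c + 0) mod n)"
    proof (rule walk)
      fix m assume "m < 0 + k"
      then have "m \<notin> A" "m < n" using least that k1n by auto
      then show "f ((c + m) mod n) = f ((c + m + 1) mod n)" unfolding A_def by blast
    qed
    then show ?thesis using c by (metis add_0_right mod_less)
  qed
  have "k1 \<noteq> n - 1"
  proof
    assume "k1 = n - 1"
    then have "f p = f c" using first[of "n - 1"] cp by simp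
    then show False using p c by (simp add: c_def)
  qed
  then have sub: "{k1, n - 1} \<subseteq> A" and two: "card {k1, n - 1} = 2" using k1 lastA by auto
  have fin: "finite A" by (simp add: A_def)
  show "2 \<le> cyc_changes n f" using card_mono[OF fin sub] two cyc by simp
  assume "cyc_changes n f \<le> 2"
  then have Aeq: "A = {k1, n - 1}"
    using card_subset_eq[OF fin sub] two card_mono[OF fin sub] cyc by simp
  define a where "a = f ((c + Suc k1) mod n)"
  have second: "f ((c + k) mod n) = a" if "Suc k1 \<le> k" "k < n" for k
  proof -
    have "f ((c + k') mod n) = f ((c + k' + 1) mod n)"
      if "Suc k1 \<le> k'" "k' < Suc k1 + (k - Suc k1)" for k'
    proof -
      have "k' \<notin> A" unfolding Aeq using that \<open>k < n\<close> by auto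
      moreover have "k' < n" using that \<open>k < n\<close> by auto
      ultimately show ?thesis unfolding A_def by blast
    qed
    then have "f ((c + Suc k1 + (k - Suc k1)) mod n) = f ((c + Suc k1) mod n)" by (rule walk)
    then show ?thesis using that by (simp add: a_def)
  qed
  have "a \<noteq> f c"
    using k1 first[of k1] by (simp add: A_def a_def)
  moreover have "f ((c + k) mod n) = (if k < Suc k1 then f c else a)" if "k < n" for k
  proof (cases "k < Suc k1")
    case True
    then show ?thesis using first[of k] by simp
  next
    case False
    then show ?thesis using second[of k] that by simp
  qed
  moreover have "0 < Suc k1" "Suc k1 < n" using k1n \<open>k1 \<noteq> n - 1\<close> by linarith+
  ultimately show "\<exists>c l a b. c < n \<and> 0 < l \<and> l < n \<and> a \<noteq> b \<and>
      (\<forall>k<n. f ((c + k) mod n) = (if k < l then b else a))"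
    using c by blast
qed

lemma two_changes_two_values:
  assumes "cyc_changes n f \<le> 2" "i < n" "j < n" "k < n" "f i \<noteq> f j"
  shows "f k = f i \<or> f k = f j"
proof -
  obtain c l a b where cl: "\<forall>k<n. f ((c + k) mod n) = (if k < l then b else a)"
    using nonconstant_changes(2)[OF assms(2,3,5) assms(1)] by blast
  have *: "f m \<in> {a, b}" if m: "m < n" for m
  proof -
    obtain m' where "m' < n" "m = (c + m') mod n" using obtain_rotation[OF m] .
    then show ?thesis using cl by (metis insertCI)
  qed
  show ?thesis using *[OF assms(2)] *[OF assms(3)] *[OF assms(4)] assms(5) by auto
qed

text \<open>Of the two monochromatic arcs, the one with spin \<open>t\<close> is either the first one or the
  complement of it; both are arcs.\<close>

lemma two_changes_arc:
  assumes "cyc_changes n f \<le> 2" "i < n" "j < n" "f i = t" "f j \<noteq> t"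
  obtains c l where "c < n" "0 < l" "l < n" "{k. k < n \<and> f k = t} = arc n c l"
proof -
  have n: "0 < n" using assms by simp
  obtain c l a b where cl: "c < n" "0 < l" "l < n" "a \<noteq> b"
      "\<forall>k<n. f ((c + k) mod n) = (if k < l then b else a)"
    using nonconstant_changes(2)[OF assms(2,3) _ assms(1)] assms(4,5) by metis
  have b: "{k. k < n \<and> f k = b} = arc n c l"
  proof (intro set_eqI)
    fix k
    show "k \<in> {k. k < n \<and> f k = b} \<longleftrightarrow> k \<in> arc n c l"
    proof (cases "k < n")
      case True
      obtain m where m: "m < n" "k = (c + m) mod n" using obtain_rotation[OF True] .
      have "f k = (if m < l then b else a)"
        unfolding m(2) using cl(5) m(1) by blast
      moreover have "k \<in> arc n c l \<longleftrightarrow> m < l"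
        unfolding m(2) by (rule mem_arc_iff) (use m cl in auto)
      ultimately show ?thesis using True cl(4) by (auto split: if_splits)
    qed (use arc_subset[OF n, of c l] in auto)
  qed
  obtain m where m: "m < n" "i = (c + m) mod n" using obtain_rotation[OF assms(2)] .
  have "t = a \<or> t = b" using m cl(5) assms(4) by metis
  then show ?thesis
  proof
    assume "t = b" then show ?thesis using b cl that by auto
  next
    assume t: "t = a"
    have "{k. k < n \<and> f k = a} = {..<n} - {k. k < n \<and> f k = b}"
    proof -
      have "f k = a \<longleftrightarrow> f k \<noteq> b" if k: "k < n" for k
      proof -
        obtain m where "m < n" "k = (c + m) mod n" using obtain_rotation[OF k] .
        then show ?thesis using cl(4,5) by metis
      qed
      then show ?thesis by auto
    qed
    also have "\<dots> = arc n (c + l) (n - l)"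
      unfolding b by (rule arc_complement) (use cl in auto)
    finally have "{k. k < n \<and> f k = t} = arc n ((c + l) mod n) (n - l)"
      using t by (simp add: arc_mod)
    then show ?thesis using that[of "(c + l) mod n" "n - l"] cl n by auto
  qed
qed

lemma cyc_changes_arc:
  assumes "t \<noteq> r" "0 < l" "l < n" "\<And>k. k < n \<Longrightarrow> f k = (if k \<in> arc n c l then t else r)"
  shows "cyc_changes n f = 2"
proof -
  have n: "0 < n" using assms by simp
  have f: "f ((c + k) mod n) = (if k < l then t else r)" if "k < n" for k
    using assms(3) that n by (simp add: assms(4) mem_arc_iff)
  have "{k. k < n \<and> f ((c + k) mod n) \<noteq> f ((c + k + 1) mod n)} = {l - 1, n - 1}"
  proof (intro set_eqI)
    fix k
    consider "k = n - 1" | "k < n - 1" | "n \<le> k" by linarith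
    then show "k \<in> {k. k < n \<and> f ((c + k) mod n) \<noteq> f ((c + k + 1) mod n)} \<longleftrightarrow>
        k \<in> {l - 1, n - 1}"
    proof cases
      case 1
      then have "(c + k + 1) mod n = (c + 0) mod n" using n by simp
      then show ?thesis using 1 f[of k] f[of 0] assms n by simp
    next
      case 2
      then have "f ((c + k + 1) mod n) = (if k + 1 < l then t else r)"
        using f[of "k + 1"] by (simp add: add.assoc)
      then show ?thesis using 2 f[of k] assms by auto
    next
      case 3
      then show ?thesis using assms by auto
    qed
  qed
  moreover have "l - 1 \<noteq> n - 1" using assms by linarith
  ultimately show ?thesis using cyc_changes_rotate[OF n, of f c] by simp
qed

section \<open>The energy as a perimeter\<close>

definition row_changes :: "nat \<Rightarrow> config \<Rightarrow> nat \<Rightarrow> nat" where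
  "row_changes L \<sigma> i = cyc_changes L (\<lambda>j. \<sigma> (i, j))"

definition col_changes :: "nat \<Rightarrow> config \<Rightarrow> nat \<Rightarrow> nat" where
  "col_changes K \<sigma> j = cyc_changes K (\<lambda>i. \<sigma> (i, j))"

definition perimeter :: "nat \<Rightarrow> nat \<Rightarrow> config \<Rightarrow> nat" where
  "perimeter K L \<sigma> = (\<Sum>i<K. row_changes L \<sigma> i) + (\<Sum>j<L. col_changes K \<sigma> j)"

lemma succ_mod_neq:
  fixes n :: nat
  assumes "3 \<le> n" "i < n"
  shows "(i + 1) mod n \<noteq> i" and "((i + 1) mod n + 1) mod n \<noteq> i"
proof -
  consider "i + 2 < n" | "i + 2 = n" | "i + 1 = n" using assms by linarith
  then have "(i + 1) mod n \<noteq> i \<and> ((i + 1) mod n + 1) mod n \<noteq> i"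
  proof cases
    case 1
    then have "(i + 1) mod n = i + 1" "(i + 1 + 1) mod n = i + 1 + 1" by (auto intro: mod_less)
    then show ?thesis by simp
  next
    case 2
    then have "(i + 1) mod n = i + 1" "(i + 1 + 1) mod n = 0" by (auto intro: mod_less)
    then show ?thesis using 2 assms by simp
  next
    case 3
    then have "(i + 1) mod n = 0" "(0 + 1) mod n = 1" using assms by auto
    then show ?thesis using 3 assms by simp
  qed
  then show "(i + 1) mod n \<noteq> i" and "((i + 1) mod n + 1) mod n \<noteq> i" by blast+
qed

text \<open>On tori with sides at least three the bonds are pairwise distinct, so that the sum over the set
  of edges can be split into the sums over the rows and the columns.\<close>

lemma energy_eq_perimeter:
  assumes K: "3 \<le> K" and L: "3 \<le> L"
  shows "energy K L \<sigma> = int (perimeter K L \<sigma>) - int (card (edges K L))"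
proof -
  define U where "U = {..<K} \<times> {..<L}"
  define ev where "ev = (\<lambda>(i, j). {(i, j), ((i + 1) mod K, j)} :: (nat \<times> nat) set)"
  define eh where "eh = (\<lambda>(i, j). {(i, j), (i, (j + 1) mod L)} :: (nat \<times> nat) set)"
  define P where "P e \<longleftrightarrow> (\<forall>v\<in>e. \<forall>w\<in>e. \<sigma> v = \<sigma> w)" for e
  define a where "a e = (if P e then 0 else 1 :: nat)" for e
  have P_pair: "P {v, w} \<longleftrightarrow> \<sigma> v = \<sigma> w" for v w unfolding P_def by auto
  have finU: "finite U" by (simp add: U_def)
  have E: "edges K L = ev ` U \<union> eh ` U"
    unfolding edges_def ev_def eh_def U_def by (auto simp: image_iff)
  have iv: "inj_on ev U"
  proof (rule inj_onI, clarify)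
    fix i j i' j'
    assume *: "(i, j) \<in> U" "(i', j') \<in> U" "ev (i, j) = ev (i', j')"
    then have "(i = i' \<and> j = j') \<or> ((i' + 1) mod K = i \<and> (i + 1) mod K = i')"
      unfolding ev_def doubleton_eq_iff prod.case prod.inject by metis
    moreover have "((i + 1) mod K + 1) mod K \<noteq> i"
      by (rule succ_mod_neq(2)[OF K]) (use *(1) in \<open>simp add: U_def\<close>)
    ultimately show "i = i' \<and> j = j'" by metis
  qed
  have ih: "inj_on eh U"
  proof (rule inj_onI, clarify)
    fix i j i' j'
    assume *: "(i, j) \<in> U" "(i', j') \<in> U" "eh (i, j) = eh (i', j')"
    then have "(i = i' \<and> j = j') \<or> ((j' + 1) mod L = j \<and> (j + 1) mod L = j')"
      unfolding eh_def doubleton_eq_iff prod.case prod.inject by metis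
    moreover have "((j + 1) mod L + 1) mod L \<noteq> j"
      by (rule succ_mod_neq(2)[OF L]) (use *(1) in \<open>simp add: U_def\<close>)
    ultimately show "i = i' \<and> j = j'" by metis
  qed
  have disj: "ev ` U \<inter> eh ` U = {}"
  proof (rule ccontr)
    assume "\<not> ?thesis"
    then obtain i j i' j' where *: "(i, j) \<in> U" "ev (i, j) = eh (i', j')" by auto
    then have "(i + 1) mod K = i"
      unfolding ev_def eh_def doubleton_eq_iff prod.case prod.inject by metis
    moreover have "(i + 1) mod K \<noteq> i"
      by (rule succ_mod_neq(1)[OF K]) (use *(1) in \<open>simp add: U_def\<close>)
    ultimately show False by blast
  qed
  have "energy K L \<sigma> = (\<Sum>e\<in>edges K L. int (a e) - 1)"
    unfolding energy_def P_def[symmetric] a_def sum_negf[symmetric] by (rule sum.cong) auto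
  also have "\<dots> = int (\<Sum>e\<in>edges K L. a e) - int (card (edges K L))"
    by (simp add: sum_subtractf)
  also have "(\<Sum>e\<in>edges K L. a e) = (\<Sum>e\<in>ev ` U. a e) + (\<Sum>e\<in>eh ` U. a e)"
    unfolding E using finU disj by (intro sum.union_disjoint) auto
  also have "(\<Sum>e\<in>ev ` U. a e) = (\<Sum>p\<in>U. a (ev p))"
    using sum.reindex[OF iv, of a] by simp
  also have "\<dots> = (\<Sum>i<K. \<Sum>j<L. if \<sigma> (i, j) \<noteq> \<sigma> ((i + 1) mod K, j) then 1 else 0)"
    unfolding U_def sum.cartesian_product by (rule sum.cong) (auto simp: a_def ev_def P_pair)
  also have "\<dots> = (\<Sum>j<L. \<Sum>i<K. if \<sigma> (i, j) \<noteq> \<sigma> ((i + 1) mod K, j) then 1 else 0)"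
    by (rule sum.swap)
  also have "\<dots> = (\<Sum>j<L. col_changes K \<sigma> j)"
    unfolding col_changes_def cyc_changes_def
    by (intro sum.cong refl) (simp add: sum.If_cases lessThan_def Int_def)
  also have "(\<Sum>e\<in>eh ` U. a e) = (\<Sum>p\<in>U. a (eh p))"
    using sum.reindex[OF ih, of a] by simp
  also have "\<dots> = (\<Sum>i<K. \<Sum>j<L. if \<sigma> (i, j) \<noteq> \<sigma> (i, (j + 1) mod L) then 1 else 0)"
    unfolding U_def sum.cartesian_product by (rule sum.cong) (auto simp: a_def eh_def P_pair)
  also have "\<dots> = (\<Sum>i<K. row_changes L \<sigma> i)"
    unfolding row_changes_def cyc_changes_def
    by (intro sum.cong refl) (simp add: sum.If_cases lessThan_def Int_def)
  finally show ?thesis by (simp add: perimeter_def)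
qed

text \<open>Staying put is an allowed step, so that \<open>c\<close> may be the spin that \<open>v\<close> already has.\<close>

lemma connectivity_pos_iff:
  assumes "0 < q" "0 < K" "0 < L" "\<sigma> \<in> configs q K L" "\<sigma>' \<in> configs q K L"
  shows "0 < connectivity q K L \<sigma> \<sigma>' \<longleftrightarrow> (\<exists>v\<in>vertices K L. \<exists>c\<in>spins q. \<sigma>' = \<sigma>(v := c))"
proof -
  define D where "D = {v \<in> vertices K L. \<sigma> v \<noteq> \<sigma>' v}"
  have fin: "finite D" by (simp add: D_def vertices_def)
  have V: "(0, 0) \<in> vertices K L" using assms by (simp add: vertices_def)
  have "0 < card (vertices K L)" using assms by (simp add: vertices_def)
  then have "0 < connectivity q K L \<sigma> \<sigma>' \<longleftrightarrow> card D \<le> 1"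
    unfolding connectivity_def D_def[symmetric] using assms(1) by (auto simp: Let_def)
  also have "\<dots> \<longleftrightarrow> (\<exists>v\<in>vertices K L. D \<subseteq> {v})"
  proof
    assume "card D \<le> 1"
    then consider "D = {}" | v where "D = {v}"
      using fin by (metis card_0_eq card_1_singletonE le_eq_less_or_eq less_one)
    then show "\<exists>v\<in>vertices K L. D \<subseteq> {v}" using V by cases (auto simp: D_def)
  next
    assume "\<exists>v\<in>vertices K L. D \<subseteq> {v}"
    then show "card D \<le> 1" using card_mono[of "{v}" D for v] by fastforce
  qed
  also have "\<dots> \<longleftrightarrow> (\<exists>v\<in>vertices K L. \<exists>c\<in>spins q. \<sigma>' = \<sigma>(v := c))"
  proof (intro bex_cong refl iffI)
    fix v assume v: "v \<in> vertices K L"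
    { assume D: "D \<subseteq> {v}"
      have "\<sigma>' = \<sigma>(v := \<sigma>' v)"
      proof
        fix w show "\<sigma>' w = (\<sigma>(v := \<sigma>' v)) w"
        proof (cases "w \<in> vertices K L")
          case True
          then show ?thesis using D by (auto simp: D_def)
        next
          case False
          then have "\<sigma> w = undefined" "\<sigma>' w = undefined" "w \<noteq> v"
            using assms(4,5) v by (auto simp: configs_def elim: PiE_arb)
          then show ?thesis by simp
        qed
      qed
      moreover have "\<sigma>' v \<in> spins q" using assms(5) v by (auto simp: configs_def)
      ultimately show "\<exists>c\<in>spins q. \<sigma>' = \<sigma>(v := c)" by blast }
    assume "\<exists>c\<in>spins q. \<sigma>' = \<sigma>(v := c)"
    then show "D \<subseteq> {v}" by (auto simp: D_def split: if_splits)
  qed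
  finally show ?thesis .
qed

lemma row_changes_ge_2:
  assumes "j < L" "j' < L" "\<sigma> (i, j) \<noteq> \<sigma> (i, j')"
  shows "2 \<le> row_changes L \<sigma> i"
  unfolding row_changes_def by (rule nonconstant_changes(1)[OF assms(1,2)]) (use assms(3) in simp)

lemma col_changes_ge_2:
  assumes "i < K" "i' < K" "\<sigma> (i, j) \<noteq> \<sigma> (i', j)"
  shows "2 \<le> col_changes K \<sigma> j"
  unfolding col_changes_def by (rule nonconstant_changes(1)[OF assms(1,2)]) (use assms(3) in simp)

lemma row_changes_eq_0D:
  assumes "row_changes L \<sigma> i = 0" "j < L" "j' < L"
  shows "\<sigma> (i, j) = \<sigma> (i, j')"
  using row_changes_ge_2[OF assms(2,3), of \<sigma> i] assms(1) by linarith

lemma col_changes_eq_0D: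
  assumes "col_changes K \<sigma> j = 0" "i < K" "i' < K"
  shows "\<sigma> (i, j) = \<sigma> (i', j)"
  using col_changes_ge_2[OF assms(2,3), of \<sigma> j] assms(1) by linarith

lemma row_changes_nonzero_ge_2:
  assumes "row_changes L \<sigma> i \<noteq> 0"
  shows "2 \<le> row_changes L \<sigma> i"
proof (rule ccontr)
  assume "\<not> ?thesis"
  then have "\<sigma> (i, j) = \<sigma> (i, 0)" if "j < L" for j
    using row_changes_ge_2[of j L 0 \<sigma> i] that by fastforce
  then have "row_changes L \<sigma> i = 0"
    unfolding row_changes_def by (rule cyc_changes_const)
  then show False using assms by simp
qed

lemma col_changes_nonzero_ge_2:
  assumes "col_changes K \<sigma> j \<noteq> 0"
  shows "2 \<le> col_changes K \<sigma> j"
proof (rule ccontr)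
  assume "\<not> ?thesis"
  then have "\<sigma> (i, j) = \<sigma> (0, j)" if "i < K" for i
    using col_changes_ge_2[of i K 0 \<sigma> j] that by fastforce
  then have "col_changes K \<sigma> j = 0"
    unfolding col_changes_def by (rule cyc_changes_const)
  then show False using assms by simp
qed

lemma perimeter_ge:
  assumes "A \<subseteq> {..<K}" "B \<subseteq> {..<L}"
    and "\<And>i. i \<in> A \<Longrightarrow> a \<le> row_changes L \<sigma> i" "\<And>j. j \<in> B \<Longrightarrow> b \<le> col_changes K \<sigma> j"
  shows "a * card A + b * card B \<le> perimeter K L \<sigma>"
proof -
  have "a * card A = (\<Sum>i\<in>A. a)" by simp
  also have "\<dots> \<le> (\<Sum>i\<in>A. row_changes L \<sigma> i)" by (rule sum_mono) (rule assms(3))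
  also have "\<dots> \<le> (\<Sum>i<K. row_changes L \<sigma> i)" by (rule sum_mono2) (use assms(1) in auto)
  finally have 1: "a * card A \<le> (\<Sum>i<K. row_changes L \<sigma> i)" .
  have "b * card B = (\<Sum>j\<in>B. b)" by simp
  also have "\<dots> \<le> (\<Sum>j\<in>B. col_changes K \<sigma> j)" by (rule sum_mono) (rule assms(4))
  also have "\<dots> \<le> (\<Sum>j<L. col_changes K \<sigma> j)" by (rule sum_mono2) (use assms(2) in auto)
  finally show ?thesis using 1 by (simp add: perimeter_def)
qed

section \<open>Leaving the neighbourhood of a stable configuration\<close>

locale torus =
  fixes q K L :: nat
  assumes K4: "4 \<le> K" and KL: "K < L" and q2: "2 < q"
begin

abbreviation "V \<equiv> vertices K L"
abbreviation "X \<equiv> configs q K L"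
abbreviation "per \<equiv> perimeter K L"
abbreviation "rowc \<equiv> row_changes L"
abbreviation "colc \<equiv> col_changes K"
abbreviation "two_spin \<equiv> two_spin_config K L"

text \<open>The neighbourhood of the stable configuration \<open>r\<close>, which a path at the level of the saddles or
  below can leave only inside a corridor. Both a row and a column are needed: if \<open>L = K + 1\<close>, a background of another spin with a
  single row of \<open>r\<close> in which one vertex is missing also has perimeter \<open>2 * K + 2\<close>, and it
  satisfies the condition on the rows.\<close>

definition mostly :: "nat \<Rightarrow> config \<Rightarrow> bool" where
  "mostly r \<sigma> \<longleftrightarrow> (\<exists>i<K. \<exists>x. \<forall>j<L. j \<noteq> x \<longrightarrow> \<sigma> (i, j) = r) \<and>
                (\<exists>j<L. \<exists>x. \<forall>i<K. i \<noteq> x \<longrightarrow> \<sigma> (i, j) = r)"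

text \<open>These are the vertical strips, possibly with one bar attached; \<open>strips_eq_fill\<close> below gives
  their shape. The intrinsic description is symmetric in the two spins and is easy to check for the
  result of an update.\<close>

definition strips :: "nat \<Rightarrow> nat \<Rightarrow> config set" where
  "strips r t = {\<sigma> \<in> X. (\<forall>v\<in>V. \<sigma> v \<in> {r, t}) \<and> per \<sigma> \<le> 2 * K + 2 \<and>
                       (\<forall>i<K. rowc \<sigma> i \<noteq> 0)}"

lemma strips_commute: "strips r t = strips t r"
  unfolding strips_def by auto

lemma vertex_iff: "(i, j) \<in> V \<longleftrightarrow> i < K \<and> j < L"
  by (simp add: vertices_def)

text \<open>If no row is monochromatic, the rows alone contribute \<open>2 * K\<close> to the perimeter. The remaining
  two units allow one column with two changes, and nothing else.\<close>

lemma profile: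
  assumes per: "per \<sigma> \<le> 2 * K + 2" and rows: "\<forall>i<K. rowc \<sigma> i \<noteq> 0"
  obtains
    (strip) "\<And>i. i < K \<Longrightarrow> rowc \<sigma> i = 2" "\<And>j. j < L \<Longrightarrow> colc \<sigma> j = 0" "per \<sigma> = 2 * K"
  | (bar) x where "x < L" "\<And>i. i < K \<Longrightarrow> rowc \<sigma> i = 2" "colc \<sigma> x = 2"
      "\<And>j. j < L \<Longrightarrow> j \<noteq> x \<Longrightarrow> colc \<sigma> j = 0" "per \<sigma> = 2 * K + 2"
proof (cases "\<forall>j<L. colc \<sigma> j = 0")
  case True
  have same: "rowc \<sigma> i = rowc \<sigma> 0" if "i < K" for i
    unfolding row_changes_def
  proof (rule cyc_changes_cong)
    fix j assume "j < L"
    then show "\<sigma> (i, j) = \<sigma> (0, j)"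
      by (intro col_changes_eq_0D) (use True that K4 in auto)
  qed
  have "(\<Sum>i<K. rowc \<sigma> i) = (\<Sum>i<K. rowc \<sigma> 0)" by (intro sum.cong refl same) simp
  moreover have "(\<Sum>j<L. colc \<sigma> j) = 0" using True by simp
  ultimately have p: "per \<sigma> = K * rowc \<sigma> 0" by (simp add: perimeter_def)
  have "2 \<le> rowc \<sigma> 0" using rows K4 by (intro row_changes_nonzero_ge_2) simp
  moreover have "\<not> 3 \<le> rowc \<sigma> 0"
  proof
    assume "3 \<le> rowc \<sigma> 0"
    then have "K * 3 \<le> per \<sigma>" unfolding p by (rule mult_le_mono2)
    then show False using per K4 by linarith
  qed
  ultimately have r0: "rowc \<sigma> 0 = 2" by linarith
  then have "rowc \<sigma> i = 2" if "i < K" for i using same[OF that] by metis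
  then show ?thesis using strip p True r0 by simp
next
  case False
  then obtain x where x: "x < L" "colc \<sigma> x \<noteq> 0" by blast
  have x2: "2 \<le> colc \<sigma> x" using x(2) by (rule col_changes_nonzero_ge_2)
  have rows2: "2 \<le> rowc \<sigma> i" if "i < K" for i
    using rows that by (intro row_changes_nonzero_ge_2) simp
  have sumrows: "2 * K \<le> (\<Sum>i<K. rowc \<sigma> i)"
    using sum_mono[of "{..<K}" "\<lambda>_. 2" "rowc \<sigma>"] rows2 by simp
  have sumcols: "(\<Sum>j<L. colc \<sigma> j) = colc \<sigma> x + (\<Sum>j\<in>{..<L} - {x}. colc \<sigma> j)"
    using x(1) by (simp add: sum.remove)
  have eqs: "colc \<sigma> x = 2" "(\<Sum>j\<in>{..<L} - {x}. colc \<sigma> j) = 0" "(\<Sum>i<K. rowc \<sigma> i) = 2 * K"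
    "per \<sigma> = 2 * K + 2"
    using per sumrows sumcols x2 unfolding perimeter_def by linarith+
  have "rowc \<sigma> i = 2" if "i < K" for i
  proof -
    have "2 * (K - 1) \<le> (\<Sum>i\<in>{..<K} - {i}. rowc \<sigma> i)"
      using sum_mono[of "{..<K} - {i}" "\<lambda>_. 2" "rowc \<sigma>"] rows2 that by simp
    moreover have "(\<Sum>i<K. rowc \<sigma> i) = rowc \<sigma> i + (\<Sum>i\<in>{..<K} - {i}. rowc \<sigma> i)"
      using that by (simp add: sum.remove)
    ultimately show ?thesis using eqs(3) rows2[OF that] K4 by linarith
  qed
  moreover have "colc \<sigma> j = 0" if "j < L" "j \<noteq> x" for j
    using eqs(2) that by simp
  ultimately show ?thesis using bar x(1) eqs by blast
qed

lemma another_column3: "\<exists>j<L. j \<noteq> x \<and> j \<noteq> y \<and> j \<noteq> z"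
proof -
  have "card ({..<L} - {x, y, z}) \<ge> L - card {x, y, z}"
    using diff_card_le_card_Diff[of "{x, y, z}" "{..<L}"] by simp
  moreover have "card {x, y, z} \<le> 3" by (simp add: card_insert_if)
  ultimately have "card ({..<L} - {x, y, z}) > 0" using K4 KL by linarith
  then have "{..<L} - {x, y, z} \<noteq> {}" using card_gt_0_iff by blast
  then show ?thesis by auto
qed

lemma another_column: "\<exists>j<L. j \<noteq> x \<and> j \<noteq> y"
  using another_column3[of x y y] by blast

lemma another_row:
  obtains k where "k < K" "k \<noteq> i"
  by (rule that[of "if i = 0 then 1 else 0"]) (use K4 in auto)

text \<open>The last configuration before a row ceases to be almost monochromatic is the strip of two
  columns with one vertex missing: a second monochromatic row would make nearly all columns and
  rows change, and without one the \<open>profile\<close> lemma determines the configuration.\<close>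

lemma leaving_mostly_aux:
  assumes \<sigma>: "\<sigma> \<in> X" "per \<sigma> \<le> 2 * K + 2" and a: "a < K" and x: "x < L" "\<sigma> (a, x) \<noteq> r"
    and row: "\<And>j. j < L \<Longrightarrow> j \<noteq> x \<Longrightarrow> \<sigma> (a, j) = r"
    and others: "\<And>k y. k < K \<Longrightarrow> k \<noteq> a \<Longrightarrow> \<exists>j<L. j \<noteq> y \<and> \<sigma> (k, j) \<noteq> r"
    and col: "j0 < L" "\<And>i. i < K \<Longrightarrow> i \<noteq> y0 \<Longrightarrow> \<sigma> (i, j0) = r"
  shows "\<sigma> \<in> strips r (\<sigma> (a, x))" "per \<sigma> = 2 * K + 2"
proof -
  have rowa: "2 \<le> rowc \<sigma> a"
  proof -
    obtain j where "j < L" "j \<noteq> x" using another_column[of x x] by blast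
    then show ?thesis using row_changes_ge_2[of j L x \<sigma> a] row x by simp
  qed
  have rows: "rowc \<sigma> i' \<noteq> 0" if i': "i' < K" for i'
  proof
    assume const: "rowc \<sigma> i' = 0"
    then have "i' \<noteq> a" using rowa by auto
    then obtain j1 where "j1 < L" "\<sigma> (i', j1) \<noteq> r" using others[OF i'] by blast
    then have nonr: "\<sigma> (i', j) \<noteq> r" if "j < L" for j
      using row_changes_eq_0D[OF const that] by metis
    have "i' = y0" using nonr[OF col(1)] col(2)[OF i'] by blast
    have "2 * card ({..<K} - {i'}) + 2 * card ({..<L} - {x}) \<le> per \<sigma>"
    proof (rule perimeter_ge)
      fix k assume k: "k \<in> {..<K} - {i'}"
      show "2 \<le> rowc \<sigma> k"
      proof (cases "k = a")
        case False
        then obtain j where "j < L" "\<sigma> (k, j) \<noteq> r" using others[of k] k by blast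
        moreover have "\<sigma> (k, j0) = r" using col(2)[of k] k \<open>i' = y0\<close> by simp
        ultimately show ?thesis using row_changes_ge_2[of j L j0 \<sigma> k] col(1) by simp
      qed (use rowa in simp)
    next
      fix j assume "j \<in> {..<L} - {x}"
      then show "2 \<le> colc \<sigma> j"
        using col_changes_ge_2[of a K i' \<sigma> j] a i' row[of j] nonr[of j] by auto
    qed auto
    then show False using \<sigma>(2) i' x(1) K4 KL by simp
  qed
  define t where "t = \<sigma> (a, x)"
  have col_nonconst: "colc \<sigma> j \<noteq> 0" if "k < K" "j < L" "j \<noteq> x" "\<sigma> (k, j) \<noteq> r" for k j
    using col_changes_ge_2[of k K a \<sigma> j] that a row[of j] by auto
  obtain k where k: "k < K" "k \<noteq> a" by (rule another_row)
  from others[OF k, of x] obtain y where y: "y < L" "y \<noteq> x" "\<sigma> (k, y) \<noteq> r" by blast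
  have all_rows: "\<forall>i<K. rowc \<sigma> i \<noteq> 0" using rows by blast
  show "per \<sigma> = 2 * K + 2"
  using \<sigma>(2) all_rows proof (cases rule: profile)
    case strip
    then show ?thesis using col_nonconst[OF k(1) y] y(1) by simp
  qed auto
  have "\<sigma> (i, j) \<in> {r, t}" if ij: "i < K" "j < L" for i j
  using \<sigma>(2) all_rows proof (cases rule: profile)
    case strip
    then show ?thesis using col_nonconst[OF k(1) y] y(1) by simp
  next
    case (bar z)
    have "z = y" using bar(4)[OF y(1)] col_nonconst[OF k(1) y] by blast
    have r: "\<sigma> (i, j) = r" if "j < L" "j \<noteq> x" "j \<noteq> y" for j
      using bar(4)[of j] col_nonconst[of i j] that ij \<open>z = y\<close> by auto
    have t: "\<sigma> (i, x) = t"
      using col_changes_eq_0D[OF bar(4)[OF x(1)], of i a] ij(1) a y(2) \<open>z = y\<close>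
      by (simp add: t_def)
    obtain j' where j': "j' < L" "j' \<noteq> x" "j' \<noteq> y" using another_column by blast
    have "\<sigma> (i, j) = \<sigma> (i, j') \<or> \<sigma> (i, j) = \<sigma> (i, x)"
      by (rule two_changes_two_values[of L "\<lambda>j. \<sigma> (i, j)"])
        (use bar(2)[OF ij(1)] j'(1) x ij r[OF j'] t t_def in \<open>auto simp: row_changes_def\<close>)
    then show ?thesis using r[OF j'] t by simp
  qed
  then show "\<sigma> \<in> strips r (\<sigma> (a, x))"
    using \<sigma> rows by (auto simp: strips_def t_def vertices_def)
qed

lemma row_changes_upd: "i \<noteq> fst v \<Longrightarrow> rowc (\<sigma>(v := c)) i = rowc \<sigma> i"
  by (cases v) (simp add: row_changes_def)

text \<open>The only exit from the neighbourhood of \<open>r\<close> at perimeter at most \<open>2 * K + 2\<close> is the completion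
  of a second column. A column cannot be the first line to fail: all columns but one would then
  contain two spins, and almost all rows as well, or else all columns change and, there being at least
  \<open>K + 1\<close> of them, every row is monochromatic and all columns look alike.\<close>

lemma leaving_mostly:
  assumes \<sigma>: "\<sigma> \<in> X" "per \<sigma> \<le> 2 * K + 2" "mostly r \<sigma>"
    and \<sigma>': "\<sigma>' \<in> X" "per \<sigma>' \<le> 2 * K + 2" "\<not> mostly r \<sigma>'"
    and v: "v \<in> V" and upd: "\<sigma>' = \<sigma>(v := c)"
  obtains t where "t \<in> spins q" "t \<noteq> r" "\<sigma> \<in> strips r t" "\<sigma>' \<in> strips r t" "per \<sigma> = 2 * K + 2"
proof -
  obtain a b where ab: "v = (a, b)" "a < K" "b < L" using v by (cases v) (auto simp: vertices_def)
  obtain i x where ix: "i < K" "\<And>j. j < L \<Longrightarrow> j \<noteq> x \<Longrightarrow> \<sigma> (i, j) = r"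
    using \<sigma>(3) unfolding mostly_def by blast
  obtain j0 y0 where jy: "j0 < L" "\<And>i. i < K \<Longrightarrow> i \<noteq> y0 \<Longrightarrow> \<sigma> (i, j0) = r"
    using \<sigma>(3) unfolding mostly_def by blast
  show ?thesis
  proof (cases "\<exists>i<K. \<exists>x. \<forall>j<L. j \<noteq> x \<longrightarrow> \<sigma>' (i, j) = r")
    case False
    then have rows': "\<exists>j<L. j \<noteq> x \<and> \<sigma>' (i, j) \<noteq> r" if "i < K" for i x using that by blast
    have "i = a"
    proof (rule ccontr)
      assume "i \<noteq> a"
      then have "\<sigma>' (i, j) = \<sigma> (i, j)" for j using upd ab by simp
      then show False using rows'[OF ix(1), of x] ix(2) by auto
    qed
    from rows'[OF ix(1), of x] have b: "b \<noteq> x" "c \<noteq> r"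
      using ix(2) upd ab \<open>i = a\<close> by (auto split: if_splits)
    from rows'[OF ix(1), of b] have x: "x < L" "\<sigma> (a, x) \<noteq> r"
      using ix(2) upd ab \<open>i = a\<close> by (auto split: if_splits)
    have others: "\<exists>j<L. j \<noteq> y \<and> \<sigma> (k, j) \<noteq> r" if "k < K" "k \<noteq> a" for k y
      using rows'[of k y] that upd ab by simp
    define t where "t = \<sigma> (a, x)"
    have strip: "\<sigma> \<in> strips r t" "per \<sigma> = 2 * K + 2"
      using leaving_mostly_aux[OF \<sigma>(1,2) ab(2) x _ others jy] ix(2) \<open>i = a\<close>
      unfolding t_def by blast+
    have nonconst: "rowc \<sigma>' k \<noteq> 0" if "k < K" for k
    proof (cases "k = a")
      case True
      obtain j where j: "j < L" "j \<noteq> x" "j \<noteq> b" using another_column by blast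
      have "\<sigma>' (a, j) = r" "\<sigma>' (a, x) = t"
        using j ix(2) \<open>i = a\<close> upd ab b by (simp_all add: t_def)
      then show ?thesis
        using True row_changes_ge_2[of j L x \<sigma>' a] j(1) x unfolding t_def by auto
    next
      case False
      then show ?thesis using strip(1) that row_changes_upd[of k v \<sigma> c] upd ab
        by (simp add: strips_def)
    qed
    \<comment> \<open>A third spin would give row \<open>a\<close> a third change.\<close>
    have "c \<in> {r, t}"
    proof -
      obtain j where j: "j < L" "j \<noteq> x" "j \<noteq> b" using another_column by blast
      have vals: "\<sigma>' (a, j) = r" "\<sigma>' (a, x) = t" "\<sigma>' (a, b) = c"
        using j ix(2) \<open>i = a\<close> upd ab b by (simp_all add: t_def)
      have "\<forall>k<K. rowc \<sigma>' k \<noteq> 0" using nonconst by blast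
      then have "rowc \<sigma>' a = 2"
        by (cases rule: profile[OF \<sigma>'(2)]) (use ab(2) in auto)
      then have "\<sigma>' (a, b) = \<sigma>' (a, j) \<or> \<sigma>' (a, b) = \<sigma>' (a, x)"
        by (intro two_changes_two_values[of L "\<lambda>j. \<sigma>' (a, j)"])
          (use j x ab vals t_def in \<open>auto simp: row_changes_def\<close>)
      then show ?thesis using vals by auto
    qed
    then have "\<sigma>' \<in> strips r t"
      using strip(1) \<sigma>' nonconst upd by (auto simp: strips_def)
    moreover have "t \<in> spins q"
      using \<sigma>(1) ab x(1) by (auto simp: t_def configs_def vertices_def)
    ultimately show ?thesis using that[of t] strip x(2) by (simp add: t_def)
  next
    case True
    then have cols': "\<exists>i<K. i \<noteq> x \<and> \<sigma>' (i, j) \<noteq> r" if "j < L" for j x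
      using that \<sigma>'(3) unfolding mostly_def by blast
    have "j0 = b"
    proof (rule ccontr)
      assume "j0 \<noteq> b"
      then have "\<sigma>' (i, j0) = \<sigma> (i, j0)" for i using upd ab by simp
      then show False using cols'[OF jy(1), of y0] jy(2) by auto
    qed
    from cols'[OF jy(1), of a] have y0: "y0 < K" "\<sigma> (y0, b) \<noteq> r"
      using jy(2) upd ab \<open>j0 = b\<close> by (auto split: if_splits)
    have others: "\<exists>i<K. i \<noteq> y \<and> \<sigma> (i, j) \<noteq> r" if "j < L" "j \<noteq> b" for j y
      using cols'[of j y] that upd ab by simp
    have colb: "2 \<le> colc \<sigma> b"
    proof -
      obtain k where "k < K" "k \<noteq> y0" by (rule another_row)
      then show ?thesis
        using col_changes_ge_2[of k K y0 \<sigma> b] jy(2) y0 \<open>j0 = b\<close> by simp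
    qed
    have False
    proof (cases "\<exists>y<L. colc \<sigma> y = 0")
      case True
      then obtain y where y: "y < L" "colc \<sigma> y = 0" by blast
      have "y \<noteq> b" using y(2) colb by auto
      then obtain k where "k < K" "\<sigma> (k, y) \<noteq> r" using others[OF y(1)] by blast
      then have nonr: "\<sigma> (k, y) \<noteq> r" if "k < K" for k
        using col_changes_eq_0D[OF y(2) that] by metis
      have "y = x" using nonr[OF ix(1)] ix(2)[OF y(1)] by blast
      have "2 * card ({..<K} - {y0}) + 2 * card ({..<L} - {y}) \<le> per \<sigma>"
      proof (rule perimeter_ge)
        fix k assume "k \<in> {..<K} - {y0}"
        then show "2 \<le> rowc \<sigma> k"
          using row_changes_ge_2[of b L y \<sigma> k] jy(2)[of k] nonr[of k] ab y \<open>j0 = b\<close> by auto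
      next
        fix j assume j: "j \<in> {..<L} - {y}"
        show "2 \<le> colc \<sigma> j"
        proof (cases "j = b")
          case False
          then obtain k where "k < K" "\<sigma> (k, j) \<noteq> r" using others[of j] j by blast
          then show ?thesis
            using col_changes_ge_2[of k K i \<sigma> j] ix j \<open>y = x\<close> by auto
        qed (use colb in simp)
      qed auto
      then show False using \<sigma>(2) y0(1) y(1) K4 KL by simp
    next
      case False
      have "2 * card ({..<L} :: nat set) + (\<Sum>i<K. rowc \<sigma> i) \<le> per \<sigma>"
      proof -
        have "(\<Sum>j<L. 2) \<le> (\<Sum>j<L. colc \<sigma> j)"
          by (rule sum_mono) (use False in \<open>auto intro: col_changes_nonzero_ge_2\<close>)
        then show ?thesis by (simp add: perimeter_def)
      qed
      then have "(\<Sum>i<K. rowc \<sigma> i) = 0" using \<sigma>(2) KL unfolding card_lessThan by linarith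
      then have const: "\<sigma> (k, j) = \<sigma> (k, b)" if "k < K" "j < L" for k j
        using row_changes_eq_0D[of L \<sigma> k j b] that ab(3) by simp
      obtain j where j: "j < L" "j \<noteq> b" using another_column[of b b] by blast
      obtain k where "k < K" "k \<noteq> y0" "\<sigma> (k, j) \<noteq> r" using others[OF j] by blast
      then show False using const[of k j] jy(2)[of k] j(1) \<open>j0 = b\<close> by simp
    qed
    then show ?thesis ..
  qed
qed

section \<open>The corridor between two stable configurations\<close>

text \<open>One column \<open>x\<close> has spin \<open>t\<close> except in row \<open>i\<close>, and an adjacent column \<open>y\<close> carries a bar of \<open>h\<close>
  vertices of spin \<open>t\<close> that avoids row \<open>i\<close>. The bar with \<open>h = K - 1\<close> gives a rectangle. A bar
  of length one is excluded: to proceed along the corridor, a path has to meet a longer bar or a bar on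
  a full column next, and these can also be reached from below.\<close>

definition gapped_at ::
    "nat \<Rightarrow> nat \<Rightarrow> nat \<Rightarrow> nat \<Rightarrow> nat \<Rightarrow> nat \<Rightarrow> nat \<Rightarrow> config \<Rightarrow> bool" where
  "gapped_at r t i x y m h \<sigma> \<longleftrightarrow>
     i < K \<and> x < L \<and> y < L \<and> (y = (x + 1) mod L \<or> x = (y + 1) mod L) \<and>
     i \<notin> arc K m h \<and> 2 \<le> h \<and> h < K \<and>
     (\<forall>k<K. \<forall>j<L. \<sigma> (k, j) =
        (if j = x then if k = i then r else t
         else if j = y then if k \<in> arc K m h then t else r
         else r))"

definition gapped :: "nat \<Rightarrow> nat \<Rightarrow> config set" where
  "gapped r t = {\<sigma> \<in> X. \<exists>i x y m h. gapped_at r t i x y m h \<sigma>}"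

text \<open>The passage between the neighbourhoods of \<open>r\<close> and \<open>t\<close>. Its configurations of perimeter
  \<open>2 * K + 2\<close> will turn out to be the essential saddles.\<close>

definition corridor :: "nat \<Rightarrow> nat \<Rightarrow> config set" where
  "corridor r t = strips r t \<union> gapped r t \<union> gapped t r"

definition spin_count :: "config \<Rightarrow> nat \<Rightarrow> nat" where
  "spin_count \<sigma> s = card {v \<in> V. \<sigma> v = s}"

text \<open>The configurations of the corridor through which it can be entered from the side of \<open>r\<close>: a
  single column, a single column with a bar of length one, and a column with a gap next to a bar of
  at most \<open>K - 2\<close> vertices. Counting the vertices of spin \<open>t\<close> distinguishes them.\<close>

definition entrance :: "nat \<Rightarrow> nat \<Rightarrow> config set" where
  "entrance r t = {\<sigma> \<in> strips r t. spin_count \<sigma> t \<le> K + 1} \<union> {\<sigma> \<in> gapped r t. spin_count \<sigma> t \<le> 2 * K - 3}"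

lemma corridor_commute: "corridor r t = corridor t r"
  unfolding corridor_def using strips_commute by blast

lemma adjacent_neq:
  assumes "x < L" "y < L" "y = (x + 1) mod L \<or> x = (y + 1) mod L"
  shows "x \<noteq> y"
  using succ_mod_neq(1)[of L x] succ_mod_neq(1)[of L y] assms K4 KL by fastforce

lemma cnt_rows: "spin_count \<sigma> s = (\<Sum>i<K. card {j. j < L \<and> \<sigma> (i, j) = s})"
proof -
  have "{v \<in> V. \<sigma> v = s} = Sigma {..<K} (\<lambda>i. {j. j < L \<and> \<sigma> (i, j) = s})"
    by (auto simp: vertices_def)
  then show ?thesis by (simp add: spin_count_def)
qed

lemma cnt_cols: "spin_count \<sigma> s = (\<Sum>j<L. card {i. i < K \<and> \<sigma> (i, j) = s})"
proof -
  have "{v \<in> V. \<sigma> v = s} = prod.swap ` Sigma {..<L} (\<lambda>j. {i. i < K \<and> \<sigma> (i, j) = s})"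
    by (auto simp: vertices_def image_iff)
  moreover have "inj_on prod.swap (Sigma {..<L} (\<lambda>j. {i. i < K \<and> \<sigma> (i, j) = s}))"
    by (rule inj_swap)
  ultimately show ?thesis by (simp add: spin_count_def card_image)
qed

lemma cnt_one_column:
  assumes "\<And>i j. i < K \<Longrightarrow> j < L \<Longrightarrow> j \<noteq> x \<Longrightarrow> \<sigma> (i, j) \<noteq> s"
  shows "spin_count \<sigma> s \<le> K"
proof -
  have "{v \<in> V. \<sigma> v = s} \<subseteq> {..<K} \<times> {x}"
  proof
    fix v assume v: "v \<in> {v \<in> V. \<sigma> v = s}"
    obtain i j where ij: "v = (i, j)" by (cases v)
    then have "i < K" "j < L" "\<sigma> (i, j) = s" using v by (auto simp: vertices_def)
    moreover from this have "j = x" using assms by blast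
    ultimately show "v \<in> {..<K} \<times> {x}" using ij by simp
  qed
  from card_mono[OF _ this] show ?thesis by (simp add: spin_count_def)
qed

lemma profile_at:
  assumes "per \<sigma> \<le> 2 * K + 2" "\<forall>i<K. rowc \<sigma> i \<noteq> 0" "y < L" "colc \<sigma> y \<noteq> 0"
  shows "(\<forall>i<K. rowc \<sigma> i = 2) \<and> colc \<sigma> y = 2 \<and> (\<forall>j<L. j \<noteq> y \<longrightarrow> colc \<sigma> j = 0)"
  using assms(1,2)
proof (cases rule: profile)
  case strip
  then show ?thesis using strip(2)[OF assms(3)] assms(4) by simp
next
  case (bar x)
  have "x = y" using bar(4)[OF assms(3)] assms(4) by metis
  show ?thesis
    using bar(2-4) unfolding \<open>x = y\<close> by (intro conjI allI impI) simp_all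
qed

text \<open>Making a row monochromatic again can only mean to take away the vertex \<open>b\<close> of spin \<open>t\<close> that is
  left in it. As more than one column contains spin \<open>t\<close>, there is a bar next to column \<open>b\<close>, and
  column \<open>b\<close> becomes a column with a gap.\<close>

lemma strip_closing_row:
  assumes \<sigma>: "\<sigma> \<in> strips r t" and rt: "r \<noteq> t" "r \<in> spins q" and ab: "a < K" "b < L"
    and row: "\<And>j. j < L \<Longrightarrow> j \<noteq> b \<Longrightarrow> \<sigma> (a, j) = r" and b: "\<sigma> (a, b) = t"
    and spin_count: "K + 2 \<le> spin_count \<sigma> t"
  shows "\<sigma>((a, b) := r) \<in> gapped r t"
proof -
  have two: "\<sigma> (k, j) = r \<or> \<sigma> (k, j) = t" if "k < K" "j < L" for k j
    using \<sigma> that by (auto simp: strips_def vertices_def)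
  obtain k y where ky: "k < K" "y < L" "y \<noteq> b" "\<sigma> (k, y) = t"
  proof (rule ccontr)
    assume "\<not> thesis"
    then have "\<And>k y. k < K \<Longrightarrow> y < L \<Longrightarrow> y \<noteq> b \<Longrightarrow> \<sigma> (k, y) \<noteq> t" using that by blast
    then have "spin_count \<sigma> t \<le> K" by (rule cnt_one_column)
    then show False using spin_count by simp
  qed
  have coly: "colc \<sigma> y \<noteq> 0"
    using col_changes_ge_2[of a K k \<sigma> y] ab ky row[of y] rt by auto
  have "per \<sigma> \<le> 2 * K + 2" "\<forall>i<K. rowc \<sigma> i \<noteq> 0" using \<sigma> by (auto simp: strips_def)
  then have "(\<forall>i<K. rowc \<sigma> i = 2) \<and> colc \<sigma> y = 2 \<and> (\<forall>j<L. j \<noteq> y \<longrightarrow> colc \<sigma> j = 0)"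
    by (rule profile_at[OF _ _ ky(2) coly])
  then have rows: "\<And>i. i < K \<Longrightarrow> rowc \<sigma> i = 2" and cy: "colc \<sigma> y = 2"
    and cols: "\<And>j. j < L \<Longrightarrow> j \<noteq> y \<Longrightarrow> colc \<sigma> j = 0" by blast+
  have others: "\<sigma> (i, j) = r" if "i < K" "j < L" "j \<noteq> b" "j \<noteq> y" for i j
    using col_changes_eq_0D[OF cols[OF that(2,4)] that(1) ab(1)] row[OF that(2,3)] by simp
  have colb: "\<sigma> (i, b) = t" if "i < K" for i
    using col_changes_eq_0D[OF cols[OF ab(2)] that ab(1)] b ky(3) by simp
  obtain m h where mh: "0 < h" "h < K" "{i. i < K \<and> \<sigma> (i, y) = t} = arc K m h"
    by (rule two_changes_arc[of K "\<lambda>i. \<sigma> (i, y)" k a t])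
      (use cy ky ab row[of y] rt in \<open>auto simp: col_changes_def\<close>)
  have coly': "\<sigma> (i, y) = (if i \<in> arc K m h then t else r)" if "i < K" for i
    using mh(3) two[OF that ky(2)] that by auto
  have a: "a \<notin> arc K m h" unfolding mh(3)[symmetric] using row[of y] ky rt by auto
  have "2 \<le> h"
  proof -
    have "{v \<in> V. \<sigma> v = t} \<subseteq> {..<K} \<times> {b} \<union> arc K m h \<times> {y}"
    proof
      fix v assume v: "v \<in> {v \<in> V. \<sigma> v = t}"
      obtain i j where ij: "v = (i, j)" by (cases v)
      then have "i < K" "j < L" "\<sigma> (i, j) = t" using v by (auto simp: vertices_def)
      moreover from this have "j = b \<or> j = y" using others[of i j] rt by metis
      ultimately show "v \<in> {..<K} \<times> {b} \<union> arc K m h \<times> {y}"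
        using ij unfolding mh(3)[symmetric] by auto
    qed
    then have "spin_count \<sigma> t \<le> card ({..<K} \<times> {b} \<union> arc K m h \<times> {y})"
      unfolding spin_count_def by (rule card_mono[rotated]) (simp add: arc_def)
    also have "\<dots> \<le> K + h"
      by (rule order_trans[OF card_Un_le]) (use mh(2) in \<open>simp add: card_cartesian_product card_arc\<close>)
    finally show ?thesis using spin_count by simp
  qed
  moreover have "y = (b + 1) mod L \<or> b = (y + 1) mod L"
  proof -
    obtain j where j: "j < L" "j \<noteq> b" "j \<noteq> y" using another_column by blast
    obtain c l where cl: "c < L" "0 < l" "l < L" "{j. j < L \<and> \<sigma> (k, j) = t} = arc L c l"
      by (rule two_changes_arc[of L "\<lambda>j. \<sigma> (k, j)" y j t])
        (use rows[OF ky(1)] ky j others[of k j] rt in \<open>auto simp: row_changes_def\<close>)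
    have set: "{j. j < L \<and> \<sigma> (k, j) = t} = {b, y}"
      using others[OF ky(1)] colb[OF ky(1)] ky ab rt by auto
    have "l = 2" using card_arc[of l L c] cl(3) unfolding cl(4)[symmetric] set using ky(3) by simp
    then have "arc L c l = {c, (c + 1) mod L}"
      using cl(1) by (auto simp: numeral_2_eq_2 arc_Suc)
    then show ?thesis using set cl(4) ky(3) by (metis doubleton_eq_iff)
  qed
  moreover have "\<forall>k<K. \<forall>j<L. (\<sigma>((a, b) := r)) (k, j) =
      (if j = b then if k = a then r else t else if j = y then if k \<in> arc K m h then t else r
       else r)"
  proof (intro allI impI)
    fix k j assume kj: "k < K" "j < L"
    consider "j = b" | "j \<noteq> b" "j = y" | "j \<noteq> b" "j \<noteq> y" by blast
    then show "(\<sigma>((a, b) := r)) (k, j) =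
      (if j = b then if k = a then r else t else if j = y then if k \<in> arc K m h then t else r
       else r)"
    proof cases
      case 1
      then show ?thesis using colb[OF kj(1)] by simp
    next
      case 2
      then show ?thesis using coly'[OF kj(1)] by simp
    next
      case 3
      then show ?thesis using others[OF kj] by simp
    qed
  qed
  ultimately have "gapped_at r t a b y m h (\<sigma>((a, b) := r))"
    unfolding gapped_at_def using ab ky(2) a mh(2) by blast
  moreover have "\<sigma>((a, b) := r) \<in> X"
    using \<sigma> ab rt by (auto simp: strips_def configs_def vertices_def PiE_def extensional_def)
  ultimately show ?thesis unfolding gapped_def by blast
qed

text \<open>A third spin would cost two units in its column, so that all other columns and the rest of
  its row would have to be constant; then one of the two old spins would fit into a single column.\<close>

lemma strip_neighbours:
  assumes \<sigma>: "\<sigma> \<in> strips r t" and rt: "r \<noteq> t"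
    and cnts: "K + 2 \<le> spin_count \<sigma> t" "K + 2 \<le> spin_count \<sigma> r"
    and \<sigma>': "\<sigma>' \<in> X" "per \<sigma>' \<le> 2 * K + 2" and v: "v \<in> V" and upd: "\<sigma>' = \<sigma>(v := c)"
  shows "\<sigma>' \<in> corridor r t"
proof -
  obtain a b where ab: "v = (a, b)" "a < K" "b < L" using v by (cases v) (auto simp: vertices_def)
  have two: "\<sigma> (k, j) = r \<or> \<sigma> (k, j) = t" if "k < K" "j < L" for k j
    using \<sigma> that by (auto simp: strips_def vertices_def)
  have c: "c \<in> spins q" using PiE_mem[OF \<sigma>'(1)[unfolded configs_def] v] upd by simp
  show ?thesis
  proof (cases "\<forall>i<K. rowc \<sigma>' i \<noteq> 0")
    case True
    have "c = r \<or> c = t"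
    proof (rule ccontr)
      assume third: "\<not> ?thesis"
      obtain k where k: "k < K" "k \<noteq> a" by (rule another_row)
      have neq_c: "\<sigma>' (i, j) \<noteq> c" if "i < K" "j < L" "(i, j) \<noteq> (a, b)" for i j
        using third two[OF that(1,2)] that(3) upd ab by auto
      have vc: "\<sigma>' (a, b) = c" using upd ab by simp
      have "colc \<sigma>' b \<noteq> 0"
        using col_changes_ge_2[of a K k \<sigma>' b] ab k neq_c[of k b] vc by auto
      from profile_at[OF \<sigma>'(2) True ab(3) this]
      have rows: "rowc \<sigma>' a = 2" and cols: "\<And>j. j < L \<Longrightarrow> j \<noteq> b \<Longrightarrow> colc \<sigma>' j = 0"
        using ab(2) by blast+
      obtain j1 where j1: "j1 < L" "j1 \<noteq> b" using another_column[of b b] by blast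
      define p where "p = \<sigma>' (a, j1)"
      have rowa: "\<sigma>' (a, j) = p" if "j < L" "j \<noteq> b" for j
      proof -
        have "\<sigma>' (a, j) = \<sigma>' (a, b) \<or> \<sigma>' (a, j) = \<sigma>' (a, j1)"
          by (rule two_changes_two_values[of L "\<lambda>j. \<sigma>' (a, j)"])
            (use rows that j1 ab neq_c[of a j1] vc in \<open>auto simp: row_changes_def\<close>)
        then show ?thesis using neq_c[of a j] vc that ab by (auto simp: p_def)
      qed
      have all: "\<sigma> (i, j) = p" if "i < K" "j < L" "j \<noteq> b" for i j
        using col_changes_eq_0D[OF cols[OF that(2,3)] that(1) ab(2)] rowa[OF that(2,3)] upd ab that
        by simp
      have "p = r \<or> p = t" using all[OF ab(2) j1] two[OF ab(2) j1(1)] by simp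
      then show False
      proof
        assume "p = r"
        then have "\<sigma> (i, j) \<noteq> t" if "i < K" "j < L" "j \<noteq> b" for i j using all that rt by simp
        then have "spin_count \<sigma> t \<le> K" by (rule cnt_one_column)
        then show False using cnts by simp
      next
        assume "p = t"
        then have "\<sigma> (i, j) \<noteq> r" if "i < K" "j < L" "j \<noteq> b" for i j using all that rt by simp
        then have "spin_count \<sigma> r \<le> K" by (rule cnt_one_column)
        then show False using cnts by simp
      qed
    qed
    then have "\<sigma>' \<in> strips r t"
      using \<sigma> \<sigma>' True upd by (auto simp: strips_def)
    then show ?thesis by (simp add: corridor_def)
  next
    case False
    then obtain i where i: "i < K" "rowc \<sigma>' i = 0" by blast
    have nonconst: "rowc \<sigma> i \<noteq> 0" using \<sigma> i(1) unfolding strips_def by blast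
    have "i = a"
    proof (rule ccontr)
      assume "i \<noteq> a"
      then show False using row_changes_upd[of i v \<sigma> c] upd ab(1) i(2) nonconst by simp
    qed
    have row: "\<sigma> (a, j) = c" if "j < L" "j \<noteq> b" for j
      using row_changes_eq_0D[OF i(2) that(1) ab(3)] upd ab that \<open>i = a\<close> by simp
    have ab_neq: "\<sigma> (a, b) \<noteq> c"
    proof
      assume "\<sigma> (a, b) = c"
      then have "\<sigma>' = \<sigma>" using upd ab by (metis fun_upd_triv)
      then show False using i(2) nonconst by simp
    qed
    obtain j1 where "j1 < L" "j1 \<noteq> b" using another_column[of b b] by blast
    then consider "c = r" "\<sigma> (a, b) = t" | "c = t" "\<sigma> (a, b) = r"
      using row two[OF ab(2)] ab ab_neq by metis
    then show ?thesis
    proof cases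
      case 1
      then have "\<sigma>' \<in> gapped r t"
        unfolding upd ab(1) using strip_closing_row[OF \<sigma> rt _ ab(2,3) _ _ cnts(1)] row c by simp
      then show ?thesis by (simp add: corridor_def)
    next
      case 2
      have "\<sigma> \<in> strips t r" using \<sigma> strips_commute by blast
      then have "\<sigma>' \<in> gapped t r"
        unfolding upd ab(1) using strip_closing_row[OF _ rt[symmetric] _ ab(2,3) _ _ cnts(2)] row c 2
        by simp
      then show ?thesis by (simp add: corridor_def)
    qed
  qed
qed

lemma finite_arc: "finite (arc n c l)"
  by (simp add: arc_def)

lemma arc_pair: "x < n \<Longrightarrow> arc n x 2 = {x, (x + 1) mod n}"
  by (auto simp: numeral_2_eq_2 arc_Suc)

lemma row_changes_arc:
  assumes "t \<noteq> r" "0 < l" "l < L" "\<And>j. j < L \<Longrightarrow> \<sigma> (i, j) = (if j \<in> arc L c l then t else r)"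
  shows "rowc \<sigma> i = 2"
  unfolding row_changes_def by (rule cyc_changes_arc[OF assms])

lemma col_changes_arc:
  assumes "t \<noteq> r" "0 < l" "l < K" "\<And>i. i < K \<Longrightarrow> \<sigma> (i, j) = (if i \<in> arc K c l then t else r)"
  shows "colc \<sigma> j = 2"
  unfolding col_changes_def by (rule cyc_changes_arc[OF assms])

lemma row_changes_const: "(\<And>j. j < L \<Longrightarrow> \<sigma> (i, j) = a) \<Longrightarrow> rowc \<sigma> i = 0"
  unfolding row_changes_def by (rule cyc_changes_const)

lemma col_changes_const: "(\<And>i. i < K \<Longrightarrow> \<sigma> (i, j) = a) \<Longrightarrow> colc \<sigma> j = 0"
  unfolding col_changes_def by (rule cyc_changes_const)

lemma arc_all_but_one: "i < K \<Longrightarrow> arc K (i + 1) (K - 1) = {..<K} - {i}"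
  using arc_complement[of K 1 i] K4 by simp

lemma gapped_atD:
  assumes "gapped_at r t i x y m h \<sigma>"
  shows "i < K" "x < L" "y < L" "y = (x + 1) mod L \<or> x = (y + 1) mod L" "x \<noteq> y"
    "i \<notin> arc K m h" "2 \<le> h" "h < K"
    "\<And>k. k < K \<Longrightarrow> k \<noteq> i \<Longrightarrow> \<sigma> (k, x) = t" "\<And>j. j < L \<Longrightarrow> \<sigma> (i, j) = r"
    "\<And>k. k < K \<Longrightarrow> k \<in> arc K m h \<Longrightarrow> \<sigma> (k, y) = t"
    "\<And>k. k < K \<Longrightarrow> k \<notin> arc K m h \<Longrightarrow> \<sigma> (k, y) = r"
    "\<And>k j. k < K \<Longrightarrow> j < L \<Longrightarrow> j \<noteq> x \<Longrightarrow> j \<noteq> y \<Longrightarrow> \<sigma> (k, j) = r"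
  using assms adjacent_neq[of x y] unfolding gapped_at_def by auto

text \<open>Every row but \<open>i\<close> and each of the columns \<open>x\<close> and \<open>y\<close> have exactly two changes.\<close>

lemma gapped_perimeter:
  assumes g: "gapped_at r t i x y m h \<sigma>" and rt: "r \<noteq> t"
  shows "per \<sigma> = 2 * K + 2"
proof -
  note D = gapped_atD[OF g]
  have row: "rowc \<sigma> k = 2" if k: "k < K" "k \<noteq> i" for k
  proof (cases "k \<in> arc K m h")
    case True
    obtain z where z: "arc L z 2 = {x, y}"
      using D(4) arc_pair[of x L] arc_pair[of y L] D(2,3) by (metis insert_commute)
    show ?thesis
    proof (rule row_changes_arc[OF rt[symmetric], where l = 2 and c = z])
      fix j assume j: "j < L"
      show "\<sigma> (k, j) = (if j \<in> arc L z 2 then t else r)"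
        unfolding z using D(9)[OF k] D(11)[OF k(1) True] D(13)[OF k(1) j] by auto
    qed (use K4 KL in auto)
  next
    case False
    show ?thesis
    proof (rule row_changes_arc[OF rt[symmetric], where l = "Suc 0" and c = x])
      fix j assume j: "j < L"
      show "\<sigma> (k, j) = (if j \<in> arc L x (Suc 0) then t else r)"
        using D(9)[OF k] D(12)[OF k(1) False] D(13)[OF k(1) j] D(2,5) by auto
    qed (use K4 KL in auto)
  qed
  have rowi: "rowc \<sigma> i = 0" by (rule row_changes_const) (rule D(10))
  have colx: "colc \<sigma> x = 2"
  proof (rule col_changes_arc[OF rt[symmetric], where l = "K - 1" and c = "i + 1"])
    fix k assume "k < K"
    then show "\<sigma> (k, x) = (if k \<in> arc K (i + 1) (K - 1) then t else r)"
      unfolding arc_all_but_one[OF D(1)] using D(9)[of k] D(10)[OF D(2)] by auto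
  qed (use K4 in auto)
  have coly: "colc \<sigma> y = 2"
    by (rule col_changes_arc[OF rt[symmetric], where l = h and c = m]) (use D in auto)
  have col: "colc \<sigma> j = 0" if "j < L" "j \<noteq> x" "j \<noteq> y" for j
    by (rule col_changes_const[of _ _ r]) (use D(13) that in auto)
  have "(\<Sum>k<K. rowc \<sigma> k) = (\<Sum>k\<in>{..<K} - {i}. rowc \<sigma> k)"
    using D(1) rowi by (simp add: sum.remove)
  also have "\<dots> = (\<Sum>k\<in>{..<K} - {i}. 2)" by (rule sum.cong) (use row in auto)
  also have "\<dots> = 2 * (K - 1)" using D(1) by simp
  finally have rows: "(\<Sum>k<K. rowc \<sigma> k) = 2 * (K - 1)" .
  have "(\<Sum>j<L. colc \<sigma> j) = (\<Sum>j\<in>{x, y}. colc \<sigma> j)"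
    by (rule sum.mono_neutral_right) (use D(2,3) col in auto)
  also have "\<dots> = 4" using D(5) colx coly by simp
  finally show ?thesis using rows K4 by (simp add: perimeter_def)
qed

lemma gapped_cnt:
  assumes g: "gapped_at r t i x y m h \<sigma>" and rt: "r \<noteq> t"
  shows "spin_count \<sigma> t = K - 1 + h"
proof -
  note D = gapped_atD[OF g]
  have "{v \<in> V. \<sigma> v = t} = ({..<K} - {i}) \<times> {x} \<union> arc K m h \<times> {y}" (is "?A = ?B")
  proof (rule set_eqI)
    fix v :: "nat \<times> nat"
    obtain k j where v: "v = (k, j)" by (cases v)
    show "v \<in> ?A \<longleftrightarrow> v \<in> ?B"
    proof (cases "k < K \<and> j < L")
      case True
      consider "j = x" | "j = y" | "j \<noteq> x" "j \<noteq> y" by blast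
      then show ?thesis
      proof cases
        case 1
        then show ?thesis using True v D(9)[of k] D(10)[of x] D(5) rt
          by (auto simp: vertices_def)
      next
        case 2
        then show ?thesis using True v D(11,12)[of k] D(5) rt by (auto simp: vertices_def)
      next
        case 3
        then show ?thesis using True v D(13)[of k j] rt by (auto simp: vertices_def)
      qed
    next
      case False
      then show ?thesis using v D(2,3) arc_subset[of K m h] K4 by (auto simp: vertices_def)
    qed
  qed
  moreover have "card (({..<K} - {i}) \<times> {x} \<union> arc K m h \<times> {y}) = (K - 1) + h"
    using D(1,5,8) by (subst card_Un_disjoint) (auto simp: card_cartesian_product card_arc finite_arc)
  ultimately show ?thesis by (simp add: spin_count_def)
qed

text \<open>The perimeter of the rectangle with two columns and \<open>K - 1\<close> rows is at the allowed maximum, and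
  an update in one of the \<open>L - 2\<close> other columns makes a third column change. In the columns of the
  rectangle, the missing vertices can be filled and the corners can be removed.\<close>

lemma block_neighbours:
  assumes \<sigma>: "\<sigma> \<in> X" and rt: "r \<noteq> t" and i: "i < K" and xy: "x < L" "y < L"
    and adj: "y = (x + 1) mod L \<or> x = (y + 1) mod L"
    and blk: "\<And>k j. k < K \<Longrightarrow> j < L \<Longrightarrow> \<sigma> (k, j) = (if k \<noteq> i \<and> (j = x \<or> j = y) then t else r)"
    and \<sigma>': "\<sigma>' \<in> X" "per \<sigma>' \<le> 2 * K + 2" and v: "v \<in> V" and upd: "\<sigma>' = \<sigma>(v := c)"
  shows "\<sigma>' = \<sigma> \<or> \<sigma>' \<in> strips r t \<or> \<sigma>' \<in> gapped r t"
proof (rule ccontr)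
  assume contra: "\<not> ?thesis"
  obtain a b where ab: "v = (a, b)" "a < K" "b < L" using v by (cases v) (auto simp: vertices_def)
  have "x \<noteq> y" by (rule adjacent_neq[OF xy adj])
  have same: "\<sigma>' (k, j) = \<sigma> (k, j)" if "k \<noteq> a \<or> j \<noteq> b" for k j using upd ab that by auto
  have vc: "\<sigma>' (a, b) = c" using upd ab by simp
  have new: "c \<noteq> \<sigma> (a, b)"
  proof
    assume "c = \<sigma> (a, b)"
    then have "\<sigma>' = \<sigma>" using upd ab by (metis fun_upd_triv)
    then show False using contra by blast
  qed
  \<comment> \<open>Two rows that show the unchanged rectangle; they exist because \<open>4 \<le> K\<close>.\<close>
  obtain k1 k2 where k12: "k1 < K" "k2 < K" "k1 \<noteq> k2" "k1 \<noteq> i" "k2 \<noteq> i" "k1 \<noteq> a" "k2 \<noteq> a"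
  proof -
    have "card ({..<K} - {i, a}) \<ge> K - card {i, a}"
      using diff_card_le_card_Diff[of "{i, a}" "{..<K}"] by simp
    moreover have "card {i, a} \<le> 2" by (simp add: card_insert_if)
    ultimately have "\<not> card ({..<K} - {i, a}) \<le> Suc 0" using K4 by linarith
    then show ?thesis using that unfolding card_le_Suc0_iff_eq[OF finite_Diff[OF finite_lessThan]]
      by blast
  qed
  have rows: "2 \<le> rowc \<sigma>' k" if k: "k < K" "k \<noteq> i" for k
  proof -
    obtain j where j: "j < L" "j \<noteq> x" "j \<noteq> y" "j \<noteq> b" using another_column3 by blast
    obtain z where "z \<in> {x, y}" "z \<noteq> b" using \<open>x \<noteq> y\<close> by blast
    then have z: "z < L" "\<sigma>' (k, z) = t" using xy same blk k by auto
    show ?thesis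
      by (rule row_changes_ge_2[OF z(1) j(1)]) (use z same[of k j] j blk[of k j] k rt in auto)
  qed
  have cols: "2 \<le> colc \<sigma>' z" if z: "z = x \<or> z = y" "z \<noteq> b" for z
  proof (rule col_changes_ge_2[OF i k12(1)])
    show "\<sigma>' (i, z) \<noteq> \<sigma>' (k1, z)"
      using same[of i z] same[of k1 z] blk[of i z] blk[of k1 z] k12 i z xy rt by auto
  qed
  consider "b \<noteq> x" "b \<noteq> y" | "a = i" "b = x \<or> b = y" | "a \<noteq> i" "b = x \<or> b = y" by blast
  then show False
  proof cases
    case 1
    have "2 \<le> colc \<sigma>' b"
    proof (rule col_changes_ge_2[OF ab(2) k12(1)])
      show "\<sigma>' (a, b) \<noteq> \<sigma>' (k1, b)"
        using same[of k1 b] blk[of k1 b] blk[of a b] k12 ab 1 vc new by auto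
    qed
    then have "2 * card ({..<K} - {i}) + 2 * card {x, y, b} \<le> per \<sigma>'"
      by (intro perimeter_ge) (use rows cols 1 xy ab in auto)
    then show False using \<sigma>'(2) i 1 \<open>x \<noteq> y\<close> K4 by simp
  next
    case 2
    then obtain b' where b': "b' = x \<or> b' = y" "b' \<noteq> b" "b' < L" using \<open>x \<noteq> y\<close> xy by blast
    have "\<sigma> (a, b) = r" using 2 blk ab by simp
    have rowi: "2 \<le> rowc \<sigma>' i"
      by (rule row_changes_ge_2[OF ab(3) b'(3)])
        (use vc new 2 same[of i b'] blk[of i b'] blk[of i b] i b' ab in auto)
    have "c = t"
    proof (rule ccontr)
      assume "c \<noteq> t"
      then have "2 \<le> colc \<sigma>' b"
        using col_changes_ge_2[of a K k1 \<sigma>' b] ab k12 vc same[of k1 b] blk[of k1 b] 2 by auto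
      then have "2 * card {..<K} + 2 * card {b, b'} \<le> per \<sigma>'"
        by (intro perimeter_ge) (use rows rowi cols b' ab in force)+
      then show False using \<sigma>'(2) b'(2) by simp
    qed
    have "\<sigma>' v' \<in> {r, t}" if "v' \<in> V" for v'
      using that upd ab \<open>c = t\<close> blk by (cases v') (auto simp: vertices_def)
    moreover have "rowc \<sigma>' k \<noteq> 0" if "k < K" for k
      using rows[OF that] rowi by (cases "k = i") auto
    ultimately have "\<sigma>' \<in> strips r t" using \<sigma>' by (simp add: strips_def)
    then show False using contra by blast
  next
    case 3
    then obtain b' where b': "b' = x \<or> b' = y" "b' \<noteq> b" "b' < L" using \<open>x \<noteq> y\<close> xy by blast
    have ib: "\<sigma>' (i, b) = r" using same[of i b] 3 blk[of i b] i ab by simp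
    have kb: "\<sigma>' (k, b) = t" if "k < K" "k \<noteq> i" "k \<noteq> a" for k
      using same[of k b] 3 blk[of k b] that ab by simp
    have colb: "colc \<sigma>' b \<le> 2"
    proof -
      have "(\<Sum>k<K. rowc \<sigma>' k) \<ge> (\<Sum>k\<in>{..<K} - {i}. rowc \<sigma>' k)" by (rule sum_mono2) auto
      moreover have "(\<Sum>k\<in>{..<K} - {i}. rowc \<sigma>' k) \<ge> (\<Sum>k\<in>{..<K} - {i}. 2)"
        by (rule sum_mono) (use rows in auto)
      moreover have "(\<Sum>k\<in>{..<K} - {i}. 2) = 2 * (K - 1)" using i by simp
      moreover have "(\<Sum>j<L. colc \<sigma>' j) \<ge> (\<Sum>j\<in>{b, b'}. colc \<sigma>' j)"
        by (rule sum_mono2) (use ab b' in auto)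
      moreover have "(\<Sum>j\<in>{b, b'}. colc \<sigma>' j) = colc \<sigma>' b + colc \<sigma>' b'" using b' by simp
      moreover have "2 \<le> colc \<sigma>' b'" by (rule cols) (use b' in auto)
      ultimately show ?thesis using \<sigma>'(2) K4 unfolding perimeter_def by linarith
    qed
    have "\<sigma> (a, b) = t" using 3 blk ab by simp
    have "\<sigma>' (a, b) = \<sigma>' (i, b) \<or> \<sigma>' (a, b) = \<sigma>' (k1, b)"
      by (rule two_changes_two_values[of K "\<lambda>k. \<sigma>' (k, b)"])
        (use colb i k12 ab ib kb[of k1] rt in \<open>auto simp: col_changes_def\<close>)
    then have "c = r" using vc new ib kb[of k1] k12 \<open>\<sigma> (a, b) = t\<close> by auto
    obtain m h where mh: "h < K" "{k. k < K \<and> \<sigma>' (k, b) = t} = arc K m h"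
      by (rule two_changes_arc[of K "\<lambda>k. \<sigma>' (k, b)" k1 i t])
        (use colb i k12 ib kb[of k1] rt in \<open>auto simp: col_changes_def\<close>)
    have b_arc: "\<sigma>' (k, b) = (if k \<in> arc K m h then t else r)" if "k < K" for k
      unfolding mh(2)[symmetric] using that ib kb[of k] vc \<open>c = r\<close> by auto
    have "i \<notin> arc K m h" unfolding mh(2)[symmetric] using ib rt by simp
    have "2 \<le> h"
    proof -
      have "card {k1, k2} \<le> card (arc K m h)"
        by (rule card_mono) (use k12 kb in \<open>auto simp: mh(2)[symmetric]\<close>)
      then show ?thesis using card_arc[of h K m] mh(1) k12(3) by simp
    qed
    have rest: "\<sigma>' (k, j) = (if j = b' \<and> k \<noteq> i then t else r)" if "k < K" "j < L" "j \<noteq> b" for k j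
      using same[of k j] that blk[OF that(1,2)] b' 3(2) by auto
    have "gapped_at r t i b' b m h \<sigma>'"
      unfolding gapped_at_def
    proof (intro conjI allI impI)
      show "b = (b' + 1) mod L \<or> b' = (b + 1) mod L" using 3(2) b' adj \<open>x \<noteq> y\<close> by metis
      fix k j assume kj: "k < K" "j < L"
      show "\<sigma>' (k, j) = (if j = b' then if k = i then r else t
          else if j = b then if k \<in> arc K m h then t else r else r)"
        using rest[OF kj] b_arc[OF kj(1)] b'(2) by auto
    qed fact+
    then have "\<sigma>' \<in> gapped r t" using \<sigma>'(1) unfolding gapped_def by blast
    then show False using contra by blast
  qed
qed

lemma cnt_two_spins:
  assumes "\<And>v. v \<in> V \<Longrightarrow> \<sigma> v = r \<or> \<sigma> v = t" "r \<noteq> t"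
  shows "spin_count \<sigma> r + spin_count \<sigma> t = K * L"
proof -
  have "spin_count \<sigma> r + spin_count \<sigma> t = card ({v \<in> V. \<sigma> v = r} \<union> {v \<in> V. \<sigma> v = t})"
    unfolding spin_count_def by (rule card_Un_disjoint[symmetric]) (use assms(2) in \<open>auto simp: vertices_def\<close>)
  also have "{v \<in> V. \<sigma> v = r} \<union> {v \<in> V. \<sigma> v = t} = V" using assms(1) by auto
  finally show ?thesis by (simp add: vertices_def)
qed

lemma gapped_neighbours:
  assumes \<sigma>: "\<sigma> \<in> gapped r t" and rt: "r \<noteq> t" and spin_count: "2 * K - 2 \<le> spin_count \<sigma> t"
    and \<sigma>': "\<sigma>' \<in> X" "per \<sigma>' \<le> 2 * K + 2" and v: "v \<in> V" and upd: "\<sigma>' = \<sigma>(v := c)"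
  shows "\<sigma>' \<in> corridor r t"
proof -
  obtain i x y m h where g: "\<sigma> \<in> X" "gapped_at r t i x y m h \<sigma>"
    using \<sigma> unfolding gapped_def by blast
  note D = gapped_atD[OF g(2)]
  have h: "h = K - 1" using gapped_cnt[OF g(2) rt] spin_count D(8) K4 by linarith
  have "arc K m h = {..<K} - {i}"
  proof (rule card_subset_eq)
    show "arc K m h \<subseteq> {..<K} - {i}" using arc_subset[of K m h] D(6) K4 by auto
    show "card (arc K m h) = card ({..<K} - {i})" using D(1,8) h by (simp add: card_arc)
  qed simp
  then have "\<sigma> (k, j) = (if k \<noteq> i \<and> (j = x \<or> j = y) then t else r)" if "k < K" "j < L" for k j
    using that D(9)[of k] D(10)[of j] D(11)[of k] D(12)[of k] D(13)[of k j] by auto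
  then have "\<sigma>' = \<sigma> \<or> \<sigma>' \<in> strips r t \<or> \<sigma>' \<in> gapped r t"
    by (intro block_neighbours[OF g(1) rt D(1-4) _ \<sigma>' v upd])
  then show ?thesis using \<sigma> by (auto simp: corridor_def)
qed

lemma corridor_neighbours:
  assumes \<sigma>: "\<sigma> \<in> corridor r t" and rt: "r \<noteq> t"
    and \<sigma>': "\<sigma>' \<in> X" "per \<sigma>' \<le> 2 * K + 2" and v: "v \<in> V" and upd: "\<sigma>' = \<sigma>(v := c)"
  shows "\<sigma>' \<in> corridor r t \<or> \<sigma> \<in> entrance r t \<or> \<sigma> \<in> entrance t r"
proof -
  consider "\<sigma> \<in> strips r t" | "\<sigma> \<in> gapped r t" | "\<sigma> \<in> gapped t r"
    using \<sigma> unfolding corridor_def by blast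
  then show ?thesis
  proof cases
    case 1
    then have "\<sigma> \<in> strips t r" using strips_commute by blast
    then show ?thesis using strip_neighbours[OF 1 rt _ _ \<sigma>' v upd] 1
      by (fastforce simp: entrance_def not_le)
  next
    case 2
    then show ?thesis using gapped_neighbours[OF 2 rt _ \<sigma>' v upd]
      by (fastforce simp: entrance_def)
  next
    case 3
    then show ?thesis using gapped_neighbours[OF 3 rt[symmetric] _ \<sigma>' v upd] corridor_commute
      by (fastforce simp: entrance_def)
  qed
qed

lemma strips_value: "\<sigma> \<in> strips r t \<Longrightarrow> i < K \<Longrightarrow> j < L \<Longrightarrow> \<sigma> (i, j) = r \<or> \<sigma> (i, j) = t"
  unfolding strips_def using vertex_iff by blast

lemma gapped_mostly:
  assumes "\<sigma> \<in> gapped r t"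
  shows "mostly r \<sigma>"
proof -
  obtain i x y m h where "gapped_at r t i x y m h \<sigma>" using assms unfolding gapped_def by blast
  note D = gapped_atD[OF this]
  obtain j where "j < L" "j \<noteq> x" "j \<noteq> y" using another_column by blast
  then show ?thesis unfolding mostly_def using D(1,10,13) by blast
qed

lemma gapped_not_mostly:
  assumes "\<sigma> \<in> gapped r t" "r \<noteq> t"
  shows "\<not> mostly t \<sigma>"
proof
  assume "mostly t \<sigma>"
  then obtain k z where kz: "k < K" "\<And>j. j < L \<Longrightarrow> j \<noteq> z \<Longrightarrow> \<sigma> (k, j) = t"
    unfolding mostly_def by blast
  obtain i x y m h where "gapped_at r t i x y m h \<sigma>" using assms(1) unfolding gapped_def by blast
  note D = gapped_atD[OF this]
  obtain j where "j < L" "j \<noteq> x" "j \<noteq> y" "j \<noteq> z" using another_column3 by blast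
  then show False using kz D(13)[of k j] assms(2) by simp
qed

lemma strip_has_both:
  assumes "\<sigma> \<in> strips r t" "i < K"
  shows "\<exists>j<L. \<sigma> (i, j) = t"
proof (rule ccontr)
  assume none: "\<not> ?thesis"
  have "\<sigma> (i, j) = r" if "j < L" for j
    using none assms that strips_value by blast
  then have "rowc \<sigma> i = 0" by (rule row_changes_const)
  then show False using assms unfolding strips_def by blast
qed

text \<open>Averaging: if fewer than \<open>2 * card A\<close> pairs satisfy \<open>P\<close>, some line contains at most one of them.\<close>

lemma at_most_one:
  fixes n :: nat
  assumes "finite A" "(\<Sum>i\<in>A. card {j. j < n \<and> P i j}) < 2 * card A"
  shows "\<exists>i\<in>A. \<exists>x. \<forall>j<n. j \<noteq> x \<longrightarrow> \<not> P i j"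
proof (rule ccontr)
  assume contra: "\<not> ?thesis"
  have "2 \<le> card {j. j < n \<and> P i j}" if "i \<in> A" for i
  proof (rule ccontr)
    assume "\<not> ?thesis"
    then have "card {j. j < n \<and> P i j} \<le> Suc 0" by simp
    moreover have "finite {j. j < n \<and> P i j}" by simp
    ultimately have "\<forall>x\<in>{j. j < n \<and> P i j}. \<forall>y\<in>{j. j < n \<and> P i j}. x = y"
      using card_le_Suc0_iff_eq by blast
    then show False using contra that by blast
  qed
  then have "(\<Sum>i\<in>A. 2) \<le> (\<Sum>i\<in>A. card {j. j < n \<and> P i j})" by (intro sum_mono)
  then show False using assms by simp
qed

text \<open>By averaging, some row and some column contain at most one of the at most \<open>K + 1\<close> vertices of spin
  \<open>t\<close>. As each of the \<open>K\<close> rows contains one, no row contains more than two.\<close>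

lemma thin_strip_mostly:
  assumes \<sigma>: "\<sigma> \<in> strips r t" and rt: "r \<noteq> t" and spin_count: "spin_count \<sigma> t \<le> K + 1"
  shows "mostly r \<sigma>" "\<not> mostly t \<sigma>"
proof -
  have two: "\<sigma> (k, j) = r" if "k < K" "j < L" "\<sigma> (k, j) \<noteq> t" for k j
    using \<sigma> that strips_value by blast
  have "\<exists>i\<in>{..<K}. \<exists>x. \<forall>j<L. j \<noteq> x \<longrightarrow> \<not> \<sigma> (i, j) = t"
    by (rule at_most_one) (use spin_count K4 in \<open>auto simp: cnt_rows\<close>)
  then have row: "\<exists>i<K. \<exists>x. \<forall>j<L. j \<noteq> x \<longrightarrow> \<sigma> (i, j) = r" using two by (metis lessThan_iff)
  have "\<exists>j\<in>{..<L}. \<exists>x. \<forall>i<K. i \<noteq> x \<longrightarrow> \<not> \<sigma> (i, j) = t"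
    by (rule at_most_one) (use spin_count K4 KL in \<open>auto simp: cnt_cols\<close>)
  then have "\<exists>j<L. \<exists>x. \<forall>i<K. i \<noteq> x \<longrightarrow> \<sigma> (i, j) = r" using two by (metis lessThan_iff)
  then show "mostly r \<sigma>" using row unfolding mostly_def by blast
  show "\<not> mostly t \<sigma>"
  proof
    assume "mostly t \<sigma>"
    then obtain k z where kz: "k < K" "\<And>j. j < L \<Longrightarrow> j \<noteq> z \<Longrightarrow> \<sigma> (k, j) = t"
      unfolding mostly_def by blast
    have "{..<L} - {z} \<subseteq> {j. j < L \<and> \<sigma> (k, j) = t}" using kz by auto
    from card_mono[OF _ this] have big: "L - 1 \<le> card {j. j < L \<and> \<sigma> (k, j) = t}"
      using diff_card_le_card_Diff[of "{z}" "{..<L}"] by simp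
    have "1 \<le> card {j. j < L \<and> \<sigma> (i, j) = t}" if "i < K" for i
      using strip_has_both[OF \<sigma> that] by (simp add: Suc_le_eq card_gt_0_iff)
    then have "(\<Sum>i\<in>{..<K} - {k}. 1) \<le> (\<Sum>i\<in>{..<K} - {k}. card {j. j < L \<and> \<sigma> (i, j) = t})"
      by (intro sum_mono) auto
    moreover have "(\<Sum>i\<in>{..<K} - {k}. 1) = K - 1" using kz(1) by simp
    moreover have "spin_count \<sigma> t = card {j. j < L \<and> \<sigma> (k, j) = t} +
        (\<Sum>i\<in>{..<K} - {k}. card {j. j < L \<and> \<sigma> (i, j) = t})"
      using kz(1) by (simp add: cnt_rows sum.remove)
    ultimately show False using big spin_count K4 KL by linarith
  qed
qed

text \<open>This separates the two ends of a corridor.\<close>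

lemma entrance_mostly:
  assumes "\<sigma> \<in> entrance r t" "r \<noteq> t"
  shows "mostly r \<sigma>" "\<not> mostly t \<sigma>"
  using assms thin_strip_mostly gapped_mostly gapped_not_mostly unfolding entrance_def by blast+

lemma entrance_corridor: "entrance r t \<subseteq> corridor r t"
  unfolding entrance_def corridor_def by blast

lemma constant_config_vertex: "i < K \<Longrightarrow> j < L \<Longrightarrow> constant_config K L s (i, j) = s"
  by (simp add: constant_config_def vertices_def)

lemma mostly_constant_iff: "mostly r (constant_config K L s) \<longleftrightarrow> s = r"
proof
  assume "mostly r (constant_config K L s)"
  then obtain i x where ix: "i < K" "\<And>j. j < L \<Longrightarrow> j \<noteq> x \<Longrightarrow> constant_config K L s (i, j) = r"
    unfolding mostly_def by blast
  obtain j where "j < L" "j \<noteq> x" using another_column by blast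
  then show "s = r" using ix constant_config_vertex by metis
next
  assume "s = r"
  then show "mostly r (constant_config K L s)"
    unfolding mostly_def using constant_config_vertex K4 KL
    by (metis less_le_trans less_trans zero_less_numeral)
qed

lemma constant_not_gapped:
  assumes "r \<noteq> t"
  shows "constant_config K L s \<notin> gapped r t"
proof
  assume "constant_config K L s \<in> gapped r t"
  then obtain i x y m h where "gapped_at r t i x y m h (constant_config K L s)"
    unfolding gapped_def by blast
  note D = gapped_atD[OF this]
  obtain k where "k < K" "k \<noteq> i" by (rule another_row)
  then show False
    using D(9)[of k] D(10)[OF D(2)] assms constant_config_vertex D(1,2) by simp
qed

lemma constant_not_corridor:
  assumes "r \<noteq> t"
  shows "constant_config K L s \<notin> corridor r t"
proof -
  have "rowc (constant_config K L s) 0 = 0"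
    by (rule row_changes_const) (use constant_config_vertex K4 in simp)
  moreover have "0 < K" using K4 by simp
  ultimately have "constant_config K L s \<notin> strips r t" unfolding strips_def by blast
  then show ?thesis
    using constant_not_gapped[OF assms] constant_not_gapped[OF assms[symmetric]]
    unfolding corridor_def by simp
qed

section \<open>Filling the torus column by column\<close>

text \<open>An order of filling the columns in which the filled columns are contiguous at any time. The two
  examples needed proceed to the right and to the left.\<close>

definition column_order :: "(nat \<Rightarrow> nat) \<Rightarrow> bool" where
  "column_order f \<longleftrightarrow> (\<forall>j\<le>L. \<exists>c. f ` {..<j} = arc L c j)"

text \<open>The first \<open>k\<close> vertices when the columns are filled in the order \<open>f\<close>, each one cyclically from row
  \<open>i\<close> on. For \<open>k = j * K + h\<close> this is a strip of \<open>j\<close> columns with a bar of length \<open>h\<close>.\<close>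

definition fill :: "nat \<Rightarrow> (nat \<Rightarrow> nat) \<Rightarrow> nat \<Rightarrow> (nat \<times> nat) set" where
  "fill i f k = {..<K} \<times> f ` {..<k div K} \<union> arc K i (k mod K) \<times> {f (k div K)}"

lemma column_order_up: "column_order (\<lambda>b. (c + b) mod L)"
  unfolding column_order_def arc_def by blast

lemma down_image:
  assumes "j \<le> L"
  shows "(\<lambda>b. (c + (L - b)) mod L) ` {..<j} = arc L (c + (L - j) + 1) j"
proof -
  have eq: "c + (L - b) = c + (L - j) + 1 + (j - 1 - b)" if "b < j" for b
    using that assms by simp
  have rev: "(\<lambda>b. j - 1 - b) ` {..<j} = {..<j}"
  proof (intro subset_antisym subsetI)
    fix x assume "x \<in> {..<j}"
    then have "x = j - 1 - (j - 1 - x)" "j - 1 - x \<in> {..<j}" by auto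
    then show "x \<in> (\<lambda>b. j - 1 - b) ` {..<j}" by (rule image_eqI)
  qed auto
  have "(\<lambda>b. (c + (L - b)) mod L) ` {..<j} =
      (\<lambda>b. (c + (L - j) + 1 + (j - 1 - b)) mod L) ` {..<j}"
    by (rule image_cong) (simp_all only: eq lessThan_iff)
  also have "\<dots> = (\<lambda>b. (c + (L - j) + 1 + b) mod L) ` (\<lambda>b. j - 1 - b) ` {..<j}"
    by (simp only: image_image)
  finally show ?thesis unfolding rev arc_def .
qed

lemma column_order_down: "column_order (\<lambda>b. (c + (L - b)) mod L)"
  unfolding column_order_def using down_image by blast

lemma column_orderD:
  assumes "column_order f"
  shows "j \<le> L \<Longrightarrow> card (f ` {..<j}) = j" "f ` {..<L} = {..<L}"
    "j < L \<Longrightarrow> f j < L" "j < L \<Longrightarrow> f j \<notin> f ` {..<j}"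
proof -
  show card: "card (f ` {..<j}) = j" if "j \<le> L" for j
    using assms that card_arc unfolding column_order_def by metis
  show all: "f ` {..<L} = {..<L}"
    using assms arc_full[of L] KL unfolding column_order_def by fastforce
  show "f j < L" if "j < L" using all that by blast
  show "f j \<notin> f ` {..<j}" if "j < L"
  proof
    assume "f j \<in> f ` {..<j}"
    then have "f ` {..<Suc j} = f ` {..<j}" by (auto simp: lessThan_Suc)
    then show False using card[of "Suc j"] card[of j] that by simp
  qed
qed

lemma two_spin_vertex:
  "i < K \<Longrightarrow> j < L \<Longrightarrow> two_spin r t D (i, j) = (if (i, j) \<in> D then t else r)"
  by (simp add: two_spin_config_def vertices_def)

lemma two_spin_in_X: "r \<in> spins q \<Longrightarrow> t \<in> spins q \<Longrightarrow> two_spin r t D \<in> X"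
  by (simp add: two_spin_config_def configs_def)

lemma config_eqI:
  assumes "\<sigma> \<in> X" "\<sigma>' \<in> X" "\<And>i j. i < K \<Longrightarrow> j < L \<Longrightarrow> \<sigma> (i, j) = \<sigma>' (i, j)"
  shows "\<sigma> = \<sigma>'"
proof (rule PiE_ext[OF assms(1,2)[unfolded configs_def]])
  fix v assume "v \<in> V"
  then show "\<sigma> v = \<sigma>' v" using assms(3) by (cases v) (auto simp: vertices_def)
qed

lemma fill_0: "fill i f 0 = {}"
  by (simp add: fill_def)

lemma fill_full: "column_order f \<Longrightarrow> fill i f (K * L) = V"
  using column_orderD(2) K4 by (auto simp: fill_def vertices_def)

lemma div_mod_mult_add: "h < K \<Longrightarrow> (j * K + h) div K = j" "h < K \<Longrightarrow> (j * K + h) mod K = h"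
  using K4 by simp_all

lemma fill_Suc:
  assumes f: "column_order f" and k: "k < K * L"
  shows "\<exists>v\<in>V. v \<notin> fill i f k \<and> fill i f (Suc k) = insert v (fill i f k)"
proof -
  define j h where "j = k div K" and "h = k mod K"
  have k_eq: "k = j * K + h" and h: "h < K" using K4 by (simp_all add: j_def h_def)
  have j: "j < L" using k K4 by (simp add: j_def div_less_iff_less_mult mult.commute)
  define v where "v = ((i + h) mod K, f j)"
  have fk: "fill i f k = {..<K} \<times> f ` {..<j} \<union> arc K i h \<times> {f j}"
    by (simp add: fill_def j_def h_def)
  have "(i + h) mod K \<notin> arc K i h" using mem_arc_iff[of h K h i] h by simp
  then have new: "v \<notin> fill i f k"
    using column_orderD(4)[OF f j] unfolding fk v_def by auto
  have "fill i f (Suc k) = insert v (fill i f k)"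
  proof (cases "Suc h < K")
    case True
    then have "Suc k div K = j" "Suc k mod K = Suc h"
      using div_mod_mult_add[of "Suc h" j] k_eq by simp_all
    then have "fill i f (Suc k) = {..<K} \<times> f ` {..<j} \<union> arc K i (Suc h) \<times> {f j}"
      by (simp add: fill_def)
    then show ?thesis unfolding fk arc_Suc v_def by auto
  next
    case False
    then have "Suc h = K" using h by simp
    then have "Suc k = Suc j * K + 0" using k_eq by simp
    then have "Suc k div K = Suc j" "Suc k mod K = 0"
      using div_mod_mult_add[of 0 "Suc j"] K4 by simp_all
    then have "fill i f (Suc k) = {..<K} \<times> f ` {..<Suc j}"
      by (simp add: fill_def)
    also have "\<dots> = {..<K} \<times> f ` {..<j} \<union> arc K i (Suc h) \<times> {f j}"
      using \<open>Suc h = K\<close> arc_full[of K i] K4 by (auto simp: lessThan_Suc)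
    finally show ?thesis unfolding fk arc_Suc v_def by auto
  qed
  moreover have "v \<in> V" using column_orderD(3)[OF f j] K4 by (simp add: v_def vertices_def)
  ultimately show ?thesis using new by blast
qed

text \<open>Each row meets the filled set in an arc.\<close>

lemma fill_row:
  fixes i k :: nat
  assumes f: "column_order f" and rt: "r \<noteq> t" and a: "a < K" and k: "k \<le> K * L"
  defines "\<sigma> \<equiv> two_spin r t (fill i f k)"
    and "m \<equiv> (if a \<in> arc K i (k mod K) then Suc (k div K) else k div K)"
  shows "rowc \<sigma> a = (if 0 < m \<and> m < L then 2 else 0)"
proof -
  have m: "m \<le> L"
  proof (cases "k = K * L")
    case True
    then show ?thesis using K4 by (simp add: m_def)
  next
    case False
    then have "k div K < L" using k K4 by (simp add: div_less_iff_less_mult mult.commute)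
    then show ?thesis by (simp add: m_def)
  qed
  have val: "\<sigma> (a, j) = (if j \<in> f ` {..<m} then t else r)" if "j < L" for j
    unfolding \<sigma>_def two_spin_vertex[OF a that] fill_def m_def using a by (auto simp: lessThan_Suc)
  obtain c where c: "f ` {..<m} = arc L c m" using f m unfolding column_order_def by blast
  consider "m = 0" | "m = L" | "0 < m" "m < L" using m by linarith
  then show ?thesis
  proof cases
    case 1
    then have "rowc \<sigma> a = 0" by (intro row_changes_const[of _ _ r]) (simp add: val)
    then show ?thesis using 1 by simp
  next
    case 2
    have "rowc \<sigma> a = 0"
      by (intro row_changes_const[of _ _ t]) (use 2 val column_orderD(2)[OF f] in auto)
    then show ?thesis using 2 by simp
  next
    case 3
    have "rowc \<sigma> a = 2"
      by (rule row_changes_arc[OF rt[symmetric] 3, of _ _ c]) (simp add: val c)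
    then show ?thesis using 3 by simp
  qed
qed

lemma fill_col:
  fixes i k :: nat
  assumes f: "column_order f" and rt: "r \<noteq> t" and b: "b < L"
  defines "\<sigma> \<equiv> two_spin r t (fill i f k)"
  shows "b \<noteq> f (k div K) \<or> k mod K = 0 \<Longrightarrow> colc \<sigma> b = 0"
    "k < K * L \<Longrightarrow> 0 < k mod K \<Longrightarrow> colc \<sigma> (f (k div K)) = 2"
proof -
  assume "b \<noteq> f (k div K) \<or> k mod K = 0"
  then have "\<sigma> (a, b) = (if b \<in> f ` {..<k div K} then t else r)" if "a < K" for a
    unfolding \<sigma>_def two_spin_vertex[OF that b] fill_def using that by auto
  then show "colc \<sigma> b = 0" by (rule col_changes_const)
next
  assume k: "k < K * L" "0 < k mod K"
  have j: "k div K < L" using k K4 by (simp add: div_less_iff_less_mult mult.commute)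
  show "colc \<sigma> (f (k div K)) = 2"
  proof (rule col_changes_arc[OF rt[symmetric] k(2)])
    fix a assume "a < K"
    then show "\<sigma> (a, f (k div K)) = (if a \<in> arc K i (k mod K) then t else r)"
      unfolding \<sigma>_def two_spin_vertex[OF \<open>a < K\<close> column_orderD(3)[OF f j]] fill_def
      using column_orderD(4)[OF f j] by auto
  qed (use K4 in simp)
qed

lemma fill_col_sum:
  assumes f: "column_order f" and rt: "r \<noteq> t" and k: "k \<le> K * L"
  shows "(\<Sum>b<L. colc (two_spin r t (fill i f k)) b) = (if k mod K = 0 then 0 else 2)"
proof (cases "k mod K = 0")
  case True
  then show ?thesis using fill_col(1)[OF f rt] by simp
next
  case False
  then have "k \<noteq> K * L" by (metis mod_mult_self1_is_0)
  then have k': "k < K * L" using k by simp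
  then have "k div K < L" using K4 by (simp add: div_less_iff_less_mult mult.commute)
  then have fl: "f (k div K) < L" by (rule column_orderD(3)[OF f])
  have "(\<Sum>b<L. colc (two_spin r t (fill i f k)) b) =
      (\<Sum>b\<in>{f (k div K)}. colc (two_spin r t (fill i f k)) b)"
    by (rule sum.mono_neutral_right) (use fl fill_col(1)[OF f rt] in auto)
  also have "\<dots> = 2" using fill_col(2)[OF f rt fl k'] False by simp
  finally show ?thesis using False by simp
qed

lemma fill_perimeter_le:
  assumes f: "column_order f" and rt: "r \<noteq> t" and k: "k \<le> K * L"
  shows "per (two_spin r t (fill i f k)) \<le> 2 * K + 2"
proof -
  have "(\<Sum>a<K. rowc (two_spin r t (fill i f k)) a) \<le> (\<Sum>a<K. 2)"
    by (rule sum_mono) (use fill_row[OF f rt _ k] in simp)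
  then show ?thesis unfolding perimeter_def fill_col_sum[OF assms] by simp
qed

text \<open>While the first or the last column is being filled, at least one row is monochromatic and
  pays for the two bonds that the growing bar costs.\<close>

lemma fill_perimeter_less:
  assumes f: "column_order f" and rt: "r \<noteq> t" and k: "k \<le> K * L"
    and cases: "k mod K = 0 \<or> k < K \<or> K * (L - 1) < k"
  shows "per (two_spin r t (fill i f k)) < 2 * K + 2"
proof -
  let ?\<sigma> = "two_spin r t (fill i f k)"
  show ?thesis
  proof (cases "k mod K = 0")
    case True
    have "(\<Sum>a<K. rowc ?\<sigma> a) \<le> (\<Sum>a<K. 2)"
      by (rule sum_mono) (use fill_row[OF f rt _ k] in simp)
    then show ?thesis unfolding perimeter_def fill_col_sum[OF f rt k] using True by simp
  next
    case False
    obtain a where a: "a < K" "rowc ?\<sigma> a = 0"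
    proof (cases "k < K")
      case True
      have "card (arc K i (k mod K)) < card {..<K}" using True by (simp add: card_arc)
      then obtain a where "a < K" "a \<notin> arc K i (k mod K)"
        using arc_subset[of K i "k mod K"] K4 by (metis lessThan_iff less_irrefl subsetI
            card_mono finite_arc not_less)
      then show ?thesis using that fill_row[OF f rt _ k, of a i] True by simp
    next
      case False
      then have "K * (L - 1) < k" "k < K * L" using cases \<open>k mod K \<noteq> 0\<close> k
        by (auto simp: le_less)
      then have "k div K = L - 1"
        using KL K4 by (intro div_nat_eqI) (auto simp: mult.commute)
      have "i mod K \<in> arc K i (k mod K)"
        using mem_arc_iff[of 0 K "k mod K" i] \<open>k mod K \<noteq> 0\<close> K4 by simp
      then show ?thesis
        using that[of "i mod K"] fill_row[OF f rt _ k, of "i mod K" i] \<open>k div K = L - 1\<close> K4 by simp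
    qed
    have "(\<Sum>a'<K. rowc ?\<sigma> a') = (\<Sum>a'\<in>{..<K} - {a}. rowc ?\<sigma> a')"
      using a by (simp add: sum.remove)
    also have "\<dots> \<le> (\<Sum>a'\<in>{..<K} - {a}. 2)"
      by (rule sum_mono) (use fill_row[OF f rt _ k] in simp)
    also have "\<dots> = 2 * (K - 1)" using a by simp
    finally have "(\<Sum>a'<K. rowc ?\<sigma> a') \<le> 2 * (K - 1)" .
    moreover have "(\<Sum>b<L. colc ?\<sigma> b) \<le> 2" unfolding fill_col_sum[OF f rt k] by simp
    ultimately show ?thesis unfolding perimeter_def using K4 by linarith
  qed
qed

text \<open>Between the completion of the first column and the beginning of the last one, no row is
  monochromatic.\<close>

lemma fill_strips:
  assumes f: "column_order f" and rt: "r \<noteq> t" "r \<in> spins q" "t \<in> spins q"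
    and k: "K \<le> k" "k \<le> K * (L - 1)"
  shows "two_spin r t (fill i f k) \<in> strips r t"
    "k mod K \<noteq> 0 \<Longrightarrow> per (two_spin r t (fill i f k)) = 2 * K + 2"
proof -
  let ?\<sigma> = "two_spin r t (fill i f k)"
  have kKL: "k < K * L"
  proof -
    have "K * (L - 1) < K * L" using K4 KL by simp
    then show ?thesis using k(2) by (rule le_less_trans[rotated])
  qed
  then have kKL': "k \<le> K * L" by simp
  have pos: "0 < k div K" using k(1) K4 by (simp add: div_greater_zero_iff)
  have top: "k div K \<le> L - 1" using k(2) K4 by (metis div_le_mono nonzero_mult_div_cancel_left
        not_numeral_le_zero)
  have row: "rowc ?\<sigma> a = 2" if a: "a < K" for a
  proof (cases "a \<in> arc K i (k mod K)")
    case True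
    then have "k mod K \<noteq> 0" by (cases "k mod K = 0") auto
    have "k div K \<noteq> L - 1"
    proof
      assume "k div K = L - 1"
      then have "k = K * (L - 1) + k mod K" by (metis mult_div_mod_eq)
      then show False using k(2) \<open>k mod K \<noteq> 0\<close> by simp
    qed
    then show ?thesis using fill_row[OF f rt(1) a kKL', of i] True top by simp
  next
    case False
    then show ?thesis using fill_row[OF f rt(1) a kKL', of i] pos top KL by simp
  qed
  have "?\<sigma> v = r \<or> ?\<sigma> v = t" if "v \<in> V" for v
    using that by (simp add: two_spin_config_def)
  then show "?\<sigma> \<in> strips r t"
    using fill_perimeter_le[OF f rt(1) kKL'] two_spin_in_X[OF rt(2,3)] row by (simp add: strips_def)
  assume "k mod K \<noteq> 0"
  have "(\<Sum>a<K. rowc ?\<sigma> a) = (\<Sum>a<K. 2)" by (rule sum.cong) (use row in auto)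
  then show "per ?\<sigma> = 2 * K + 2"
    unfolding perimeter_def fill_col_sum[OF f rt(1) kKL'] using \<open>k mod K \<noteq> 0\<close> by simp
qed

text \<open>If \<open>m\<close> were not adjacent to the arc \<open>{0..<j}\<close>, there would be a change at \<open>m\<close> besides the two at the ends of
  the arc.\<close>

lemma arc_extension:
  assumes cyc: "cyc_changes n g \<le> 2" and rt: "r \<noteq> t" and jm: "0 < j" "j \<le> m" "m < n"
    and g: "\<And>k. k < n \<Longrightarrow> g ((c + k) mod n) = (if k < j \<or> k = m then t else r)"
  shows "m = j \<or> m = n - 1"
proof (rule ccontr)
  assume "\<not> ?thesis"
  then have m: "j < m" "m < n - 1" using jm by linarith+
  have n: "0 < n" using m by simp
  have g1: "g ((c + k + 1) mod n) = (if k + 1 < j \<or> k + 1 = m then t else r)" if "k + 1 < n" for k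
    using g[OF that] by (simp add: add.assoc)
  have wrap: "g ((c + (n - 1) + 1) mod n) = t"
  proof -
    have "(c + (n - 1) + 1) mod n = (c + 0) mod n" using n by simp
    then show ?thesis using g[OF n] jm(1) by simp
  qed
  let ?A = "{k. k < n \<and> g ((c + k) mod n) \<noteq> g ((c + k + 1) mod n)}"
  have "j - 1 \<in> ?A" using g[of "j - 1"] g1[of "j - 1"] m jm rt by simp
  moreover have "m \<in> ?A" using g[of m] g1[of m] m rt by simp
  moreover have "n - 1 \<in> ?A" using g[of "n - 1"] wrap m rt by simp
  ultimately have "card {j - 1, m, n - 1} \<le> card ?A" by (intro card_mono) auto
  moreover have "j - 1 \<noteq> m" "m \<noteq> n - 1" "j - 1 \<noteq> n - 1" using m jm by linarith+
  then have "card {j - 1, m, n - 1} = 3" by simp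
  ultimately show False using cyc cyc_changes_rotate[OF n, of g c] by simp
qed

text \<open>By the \<open>profile\<close> lemma all columns but at most one are constant, and they form an arc because
  every row has two changes. The exceptional column is the bar. A row inside the bar and a row
  outside of it are both cut into two arcs, so the bar has to be adjacent to the strip, on the right
  (\<open>p = j\<close>) or on the left (\<open>p = L - 1\<close>); the direction of filling is chosen accordingly.\<close>

lemma strips_eq_fill:
  assumes \<sigma>: "\<sigma> \<in> strips r t" and rt: "r \<noteq> t" "r \<in> spins q" "t \<in> spins q"
  obtains i c f k where "f = (\<lambda>b. (c + b) mod L) \<or> f = (\<lambda>b. (c + (L - b)) mod L)"
    "K \<le> k" "k \<le> K * (L - 1)" "\<sigma> = two_spin r t (fill i f k)"
proof -
  note result = that
  have result': thesis
    if "1 \<le> j" "j * K + h \<le> K * (L - 1)"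
      "f = (\<lambda>b. (c + b) mod L) \<or> f = (\<lambda>b. (c + (L - b)) mod L)"
      "\<sigma> = two_spin r t (fill i f (j * K + h))" for i c f j h
  proof -
    have "1 * K \<le> j * K" using that(1) by (rule mult_le_mono1)
    then have "K \<le> j * K + h" by linarith
    then show thesis using result that(2-4) by blast
  qed
  have X: "\<sigma> \<in> X" and per: "per \<sigma> \<le> 2 * K + 2" and rows: "\<forall>i<K. rowc \<sigma> i \<noteq> 0"
    using \<sigma> unfolding strips_def by auto
  have both: "\<exists>j<L. \<sigma> (i, j) = t" "\<exists>j<L. \<sigma> (i, j) \<noteq> t" if "i < K" for i
    using strip_has_both[OF \<sigma> that] strip_has_both[of \<sigma> t r i] \<sigma> strips_commute that rt(1)
    by metis+
  have row_arc: "\<exists>c l. c < L \<and> 0 < l \<and> l < L \<and> {j. j < L \<and> \<sigma> (i, j) = t} = arc L c l"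
    if i: "i < K" and row: "rowc \<sigma> i = 2" for i
  proof -
    obtain j j' where jj: "j < L" "\<sigma> (i, j) = t" "j' < L" "\<sigma> (i, j') \<noteq> t" using both[OF i] by blast
    obtain c l where "c < L" "0 < l" "l < L" "{j. j < L \<and> \<sigma> (i, j) = t} = arc L c l"
      by (rule two_changes_arc[of L "\<lambda>j. \<sigma> (i, j)" j j' t])
        (use jj row in \<open>simp_all add: row_changes_def\<close>)
    then show ?thesis by blast
  qed
  from per rows show ?thesis
  proof (cases rule: profile)
    case strip
    have K0: "0 < K" using K4 by simp
    obtain c l where cl: "c < L" "0 < l" "l < L" "{j. j < L \<and> \<sigma> (0, j) = t} = arc L c l"
      using row_arc[OF K0 strip(1)[OF K0]] by blast
    define f where "f = (\<lambda>b. (c + b) mod L)"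
    have img: "f ` {..<l} = arc L c l" by (simp add: f_def arc_def)
    have "\<sigma> = two_spin r t (fill 0 f (l * K + 0))"
    proof (rule config_eqI[OF X two_spin_in_X[OF rt(2,3)]])
      fix i j assume ij: "i < K" "j < L"
      have "\<sigma> (i, j) = \<sigma> (0, j)" by (rule col_changes_eq_0D[OF strip(2)[OF ij(2)] ij(1) K0])
      also have "\<dots> = (if j \<in> arc L c l then t else r)"
        using cl(4) ij(2) strips_value[OF \<sigma> K0 ij(2)] by auto
      also have "\<dots> = two_spin r t (fill 0 f (l * K + 0)) (i, j)"
        unfolding two_spin_vertex[OF ij] fill_def img[symmetric] using ij K0 by simp
      finally show "\<sigma> (i, j) = two_spin r t (fill 0 f (l * K + 0)) (i, j)" .
    qed
    moreover have "l * K + 0 \<le> K * (L - 1)"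
    proof -
      have "l \<le> L - 1" using cl(3) by simp
      then have "K * l \<le> K * (L - 1)" by (rule mult_le_mono2)
      then show ?thesis by (simp only: mult.commute[of l K] add_0_right)
    qed
    moreover have "1 \<le> l" using cl(2) by simp
    ultimately show ?thesis using result' unfolding f_def by blast
  next
    case (bar x)
    have const: "\<sigma> (i, j) = \<sigma> (i', j)" if "i < K" "i' < K" "j < L" "j \<noteq> x" for i i' j
      by (rule col_changes_eq_0D[OF bar(4)[OF that(3,4)] that(1,2)])
    \<comment> \<open>Row \<open>k0\<close> shows the strip without the bar, row \<open>k1\<close> with it.\<close>
    obtain k0 k1 where k01: "k0 < K" "\<sigma> (k0, x) = r" "k1 < K" "\<sigma> (k1, x) = t"
    proof -
      have "\<exists>k<K. \<sigma> (k, x) = s" if "s \<noteq> s'" "{r, t} = {s, s'}" for s s'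
      proof (rule ccontr)
        assume none: "\<not> ?thesis"
        then have "\<sigma> (k, x) = s'" if "k < K" for k
          using strips_value[OF \<sigma> that bar(1)] that \<open>{r, t} = {s, s'}\<close> by (metis doubleton_eq_iff)
        then have "colc \<sigma> x = 0" by (rule col_changes_const)
        then show False using bar(3) by simp
      qed
      from this[of r t] this[of t r] show ?thesis using that rt(1) by (metis insert_commute)
    qed
    obtain m h where mh: "m < K" "0 < h" "h < K" "{k. k < K \<and> \<sigma> (k, x) = t} = arc K m h"
      by (rule two_changes_arc[of K "\<lambda>k. \<sigma> (k, x)" k1 k0 t])
        (use bar(3) k01 rt(1) in \<open>simp_all add: col_changes_def\<close>)
    obtain c j where cj: "c < L" "0 < j" "j < L" "{b. b < L \<and> \<sigma> (k0, b) = t} = arc L c j"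
      using row_arc[OF k01(1) bar(2)[OF k01(1)]] by blast
    have x_notin: "x \<notin> arc L c j" unfolding cj(4)[symmetric] using k01(2) rt(1) by simp
    obtain p where p: "p < L" "x = (c + p) mod L" using obtain_rotation[OF bar(1)] .
    have jp: "j \<le> p" using x_notin mem_arc_iff[of p L j c] p cj(3) by simp
    have pj: "p = j \<or> p = L - 1"
    proof (rule arc_extension[OF _ rt(1) cj(2) jp p(1), of "\<lambda>b. \<sigma> (k1, b)" c])
      show "cyc_changes L (\<lambda>b. \<sigma> (k1, b)) \<le> 2"
        using bar(2)[OF k01(3)] by (simp add: row_changes_def)
      fix k assume k: "k < L"
      have lt: "(c + k) mod L < L" using k by (intro mod_less_divisor) simp
      show "\<sigma> (k1, (c + k) mod L) = (if k < j \<or> k = p then t else r)"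
      proof (cases "k = p")
        case True
        then show ?thesis using k01(4) p(2) by simp
      next
        case False
        then have "(c + k) mod L \<noteq> x" unfolding p(2) using rotation_eq_iff[OF k p(1)] by simp
        then have "\<sigma> (k1, (c + k) mod L) = \<sigma> (k0, (c + k) mod L)"
          by (rule const[OF k01(3,1) lt])
        also have "\<dots> = (if k < j then t else r)"
        proof -
          have "(c + k) mod L \<in> arc L c j \<longleftrightarrow> k < j" using mem_arc_iff[OF k] cj(3) by simp
          then show ?thesis using cj(4) lt strips_value[OF \<sigma> k01(1) lt] by auto
        qed
        finally show ?thesis using False by simp
      qed
    qed
    define f where "f = (if p = j then (\<lambda>b. (c + b) mod L)
        else (\<lambda>b. ((c + (j - 1)) mod L + (L - b)) mod L))"
    have f: "f ` {..<j} = arc L c j" "f j = x"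
    proof -
      show "f ` {..<j} = arc L c j"
      proof (cases "p = j")
        case True
        then show ?thesis by (simp add: f_def arc_def)
      next
        case False
        have "f ` {..<j} = arc L ((c + (j - 1)) mod L + (L - j) + 1) j"
          using False down_image[of j "(c + (j - 1)) mod L"] cj(3) by (simp add: f_def)
        also have "\<dots> = arc L c j"
        proof (rule arc_cong)
          have "((c + (j - 1)) mod L + (L - j) + 1) mod L =
              ((c + (j - 1)) mod L + (L - j + 1)) mod L" by (simp only: add.assoc)
          also have "\<dots> = (c + (j - 1) + (L - j + 1)) mod L" by (rule mod_add_left_eq)
          also have "c + (j - 1) + (L - j + 1) = c + L" using cj by simp
          finally show "((c + (j - 1)) mod L + (L - j) + 1) mod L = c mod L" by simp
        qed
        finally show ?thesis .
      qed
      show "f j = x"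
      proof (cases "p = j")
        case True
        then show ?thesis by (simp add: f_def p(2))
      next
        case False
        then have "p = L - 1" using pj by blast
        have "f j = (c + (j - 1) + (L - j)) mod L"
          using False by (simp add: f_def mod_add_left_eq)
        also have "c + (j - 1) + (L - j) = c + (L - 1)" using cj by simp
        finally show ?thesis using \<open>p = L - 1\<close> p(2) by simp
      qed
    qed
    have "\<sigma> = two_spin r t (fill m f (j * K + h))"
    proof (rule config_eqI[OF X two_spin_in_X[OF rt(2,3)]])
      fix a b assume ab: "a < K" "b < L"
      have "two_spin r t (fill m f (j * K + h)) (a, b) =
          (if b \<in> arc L c j \<or> b = x \<and> a \<in> arc K m h then t else r)"
        unfolding two_spin_vertex[OF ab] fill_def div_mod_mult_add[OF mh(3)] f using ab by auto
      also have "\<dots> = \<sigma> (a, b)"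
      proof (cases "b = x")
        case True
        have "a \<in> arc K m h \<longleftrightarrow> \<sigma> (a, x) = t" unfolding mh(4)[symmetric] using ab(1) by simp
        then show ?thesis using True x_notin strips_value[OF \<sigma> ab] by simp metis
      next
        case False
        have "\<sigma> (a, b) = \<sigma> (k0, b)" by (rule const[OF ab(1) k01(1) ab(2) False])
        moreover have "b \<in> arc L c j \<longleftrightarrow> \<sigma> (k0, b) = t"
          unfolding cj(4)[symmetric] using ab(2) by simp
        ultimately show ?thesis using False strips_value[OF \<sigma> ab] by metis
      qed
      finally show "\<sigma> (a, b) = two_spin r t (fill m f (j * K + h)) (a, b)" ..
    qed
    moreover have "j * K + h \<le> K * (L - 1)"
    proof -
      obtain b where b: "b < L" "\<sigma> (k1, b) \<noteq> t" using both(2)[OF k01(3)] by blast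
      then have "b \<noteq> x" using k01(4) by blast
      then have "b \<notin> arc L c j"
        unfolding cj(4)[symmetric] using const[OF k01(3,1) b(1)] b(2) by simp
      then have "arc L c j \<subseteq> {..<L} - {x, b}" using arc_subset[of L c j] x_notin cj(3) by auto
      then have "card (arc L c j) \<le> card ({..<L} - {x, b})" by (intro card_mono) simp_all
      also have "\<dots> = L - 2" using bar(1) b(1) \<open>b \<noteq> x\<close> by (simp add: card_Diff_subset)
      finally have "j < L - 1" using cj(3) KL K4 by (simp add: card_arc)
      then have "Suc j * K \<le> (L - 1) * K" by (intro mult_le_mono1) simp
      then show ?thesis using mh(3) by (simp add: mult.commute)
    qed
    moreover have "1 \<le> j" using cj(2) by simp
    moreover have "f = (\<lambda>b. (c + b) mod L) \<or> f = (\<lambda>b. ((c + (j - 1)) mod L + (L - b)) mod L)"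
      unfolding f_def by simp
    ultimately show ?thesis using result' by blast
  qed
qed

section \<open>Filling orders through prescribed corridor configurations\<close>

text \<open>An enumeration of the vertices, given by its initial segments. Flipping the vertices in this order
  leads from one stable configuration to another, and the number of flipped vertices identifies the
  configuration on this path.\<close>

definition chain :: "(nat \<Rightarrow> (nat \<times> nat) set) \<Rightarrow> bool" where
  "chain D \<longleftrightarrow> D 0 = {} \<and> D (K * L) = V \<and>
     (\<forall>k<K * L. \<exists>v\<in>V. v \<notin> D k \<and> D (Suc k) = insert v (D k))"

lemma fill_chain: "column_order f \<Longrightarrow> chain (fill i f)"
  unfolding chain_def using fill_0 fill_full fill_Suc by blast

lemma finite_V: "finite V" and card_V: "card V = K * L"
  by (simp_all add: vertices_def)

lemma chain_card:
  assumes "chain D" "k \<le> K * L"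
  shows "D k \<subseteq> V \<and> card (D k) = k"
  using assms(2)
proof (induction k)
  case 0
  then show ?case using assms(1) by (simp add: chain_def)
next
  case (Suc k)
  then obtain v where v: "v \<in> V" "v \<notin> D k" "D (Suc k) = insert v (D k)"
    using assms(1) unfolding chain_def by (meson Suc_le_lessD)
  have "D k \<subseteq> V" "card (D k) = k" using Suc by simp_all
  then show ?case using v finite_subset[OF _ finite_V] by simp
qed

lemma cnt_two_spin: "r \<noteq> t \<Longrightarrow> D \<subseteq> V \<Longrightarrow> spin_count (two_spin r t D) t = card D"
  unfolding spin_count_def two_spin_config_def by (rule arg_cong[where f = card]) auto

lemma cnt_chain:
  assumes "chain D" "k \<le> K * L" "r \<noteq> t"
  shows "spin_count (two_spin r t (D k)) t = k"
  using chain_card[OF assms(1,2)] cnt_two_spin[OF assms(3)] by simp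

lemma arc_mono: "s \<le> h \<Longrightarrow> arc n m s \<subseteq> arc n m h"
  by (auto simp: arc_def)

text \<open>Two adjacent bars of which the shorter one lies along the longer one change no row outside of
  the longer one; this bounds the perimeter of the seeds from which the gapped configurations grow.\<close>

lemma double_bar_perimeter:
  assumes rt: "r \<noteq> t" and xy: "x < L" "y < L" "y = (x + 1) mod L \<or> x = (y + 1) mod L"
    and ps: "p < K" "s < K" "arc K m s \<subseteq> arc K e p"
  shows "per (two_spin r t (arc K e p \<times> {x} \<union> arc K m s \<times> {y})) \<le>
    2 * p + 2 + (if s = 0 then 0 else 2)"
proof -
  let ?\<sigma> = "two_spin r t (arc K e p \<times> {x} \<union> arc K m s \<times> {y})"
  have "x \<noteq> y" by (rule adjacent_neq[OF xy])
  have val: "?\<sigma> (k, j) = (if k \<in> arc K e p \<and> j = x \<or> k \<in> arc K m s \<and> j = y then t else r)"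
    if "k < K" "j < L" for k j
    by (simp add: two_spin_vertex[OF that])
  have row: "rowc ?\<sigma> k \<le> 2" if k: "k < K" for k
  proof -
    obtain z where z: "arc L z 2 = {x, y}"
      using xy(3) arc_pair[of x L] arc_pair[of y L] xy(1,2) by (metis insert_commute)
    consider "k \<notin> arc K e p" | "k \<in> arc K e p" "k \<notin> arc K m s" | "k \<in> arc K m s"
      using ps(3) by blast
    then show ?thesis
    proof cases
      case 1
      then have "rowc ?\<sigma> k = 0"
        by (intro row_changes_const[of _ _ r]) (use val[OF k] ps(3) in auto)
      then show ?thesis by simp
    next
      case 2
      have "rowc ?\<sigma> k = 2"
      proof (rule row_changes_arc[OF rt[symmetric], where l = "Suc 0" and c = x])
        fix j assume "j < L"
        then show "?\<sigma> (k, j) = (if j \<in> arc L x (Suc 0) then t else r)"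
          using val[OF k] 2 xy(1) by simp
      qed (use K4 KL in auto)
      then show ?thesis by simp
    next
      case 3
      have "rowc ?\<sigma> k = 2"
      proof (rule row_changes_arc[OF rt[symmetric], where l = 2 and c = z])
        fix j assume "j < L"
        then show "?\<sigma> (k, j) = (if j \<in> arc L z 2 then t else r)"
          unfolding z using val[OF k] 3 ps(3) by auto
      qed (use K4 KL in auto)
      then show ?thesis by simp
    qed
  qed
  have row0: "rowc ?\<sigma> k = 0" if "k < K" "k \<notin> arc K e p" for k
    by (rule row_changes_const[of _ _ r]) (use val[OF that(1)] that ps(3) in auto)
  have colx: "colc ?\<sigma> x \<le> 2"
  proof (cases "p = 0")
    case True
    then have "colc ?\<sigma> x = 0"
      by (intro col_changes_const[of _ _ r]) (use val[OF _ xy(1)] \<open>x \<noteq> y\<close> in auto)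
    then show ?thesis by simp
  next
    case False
    have "colc ?\<sigma> x = 2"
      by (rule col_changes_arc[OF rt[symmetric] _ ps(1), of _ _ e])
        (use False val[OF _ xy(1)] \<open>x \<noteq> y\<close> in auto)
    then show ?thesis by simp
  qed
  have coly: "colc ?\<sigma> y \<le> (if s = 0 then 0 else 2)"
  proof (cases "s = 0")
    case True
    then have "colc ?\<sigma> y = 0"
      by (intro col_changes_const[of _ _ r]) (use val[OF _ xy(2)] \<open>x \<noteq> y\<close> in auto)
    then show ?thesis by simp
  next
    case False
    have "colc ?\<sigma> y = 2"
      by (rule col_changes_arc[OF rt[symmetric] _ ps(2), of _ _ m])
        (use False val[OF _ xy(2)] \<open>x \<noteq> y\<close> in auto)
    then show ?thesis using False by simp
  qed
  have col: "colc ?\<sigma> j = 0" if "j < L" "j \<noteq> x" "j \<noteq> y" for j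
    by (rule col_changes_const[of _ _ r]) (use val[OF _ that(1)] that in auto)
  have sub: "arc K e p \<subseteq> {..<K}" using arc_subset[of K e p] K4 by simp
  have "(\<Sum>k<K. rowc ?\<sigma> k) = (\<Sum>k\<in>arc K e p. rowc ?\<sigma> k)"
    by (rule sum.mono_neutral_right) (use sub row0 in auto)
  also have "\<dots> \<le> (\<Sum>k\<in>arc K e p. 2)" by (rule sum_mono) (use row sub in auto)
  also have "\<dots> = 2 * p" using ps(1) by (simp add: card_arc)
  finally have rows: "(\<Sum>k<K. rowc ?\<sigma> k) \<le> 2 * p" .
  have "(\<Sum>j<L. colc ?\<sigma> j) = (\<Sum>j\<in>{x, y}. colc ?\<sigma> j)"
    by (rule sum.mono_neutral_right) (use xy col in auto)
  also have "\<dots> = colc ?\<sigma> x + colc ?\<sigma> y" using \<open>x \<noteq> y\<close> by simp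
  finally show ?thesis using rows colx coly unfolding perimeter_def by linarith
qed

lemma fill_saddle_strips:
  assumes f: "column_order f" and rt: "r \<noteq> t" "r \<in> spins q" "t \<in> spins q" and k: "k \<le> K * L"
    and per: "per (two_spin r t (fill i f k)) = 2 * K + 2"
  shows "two_spin r t (fill i f k) \<in> strips r t"
proof -
  have "\<not> (k mod K = 0 \<or> k < K \<or> K * (L - 1) < k)"
  proof
    assume "k mod K = 0 \<or> k < K \<or> K * (L - 1) < k"
    from fill_perimeter_less[OF f rt(1) k this, of i] show False using per by simp
  qed
  then show ?thesis using fill_strips(1)[OF f rt, of k i] by simp
qed

lemma column_order_through:
  assumes "x < L" "y < L" "y = (x + 1) mod L \<or> x = (y + 1) mod L"
  obtains f where "column_order f" "f 0 = x" "f 1 = y"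
  using assms(3)
proof
  assume "y = (x + 1) mod L"
  then show ?thesis using that[OF column_order_up[of x]] assms(1) by simp
next
  assume x: "x = (y + 1) mod L"
  have "(x + (L - 1)) mod L = (y + 1 + (L - 1)) mod L" unfolding x by (rule mod_add_left_eq)
  also have "y + 1 + (L - 1) = y + L" using KL by simp
  finally have "(x + (L - 1)) mod L = y" using assms(2) by simp
  then show ?thesis using that[OF column_order_down[of x]] assms(1) by simp
qed

text \<open>The bar lies in the segment of the cycle that is obtained by cutting it at row \<open>i\<close>.\<close>

lemma bar_position:
  assumes i: "i < K" "i \<notin> arc K m h" and h: "0 < h"
  obtains s where "1 \<le> s" "s + h \<le> K" "arc K m h = arc K (i + s) h"
proof -
  have K0: "0 < K" using K4 by simp
  have "m mod K < K" using K0 by (rule mod_less_divisor)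
  then obtain s where s: "s < K" "m mod K = (i + s) mod K" by (rule obtain_rotation)
  have arc_m: "arc K m h = arc K (i + s) h" by (rule arc_cong[OF s(2)])
  have pos: "(i + (s + k)) mod K \<in> arc K m h" if "k < h" for k
  proof -
    have "(i + s + k) mod K \<in> arc K (i + s) h" unfolding arc_def using that by blast
    then show ?thesis by (simp only: arc_m add.assoc)
  qed
  have "i mod K = i" using i(1) by simp
  have "s \<noteq> 0"
  proof
    assume "s = 0"
    then show False using pos[OF h] i \<open>i mod K = i\<close> by simp
  qed
  moreover have "s + h \<le> K"
  proof (rule ccontr)
    assume "\<not> ?thesis"
    then have "K - s < h" using s(1) by linarith
    from pos[OF this] have "(i + K) mod K \<in> arc K m h" using s(1) by simp
    then show False using i \<open>i mod K = i\<close> by simp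
  qed
  ultimately show ?thesis using that[of s] arc_m by simp
qed

text \<open>A bar of at most \<open>K - 2\<close> rows that avoids row \<open>i\<close> also misses one of the two rows next to
  row \<open>i\<close> along the cycle; this row \<open>w\<close> can be added to the column last.\<close>

lemma column_covering_bar:
  assumes i: "i < K" "i \<notin> arc K m h" and h: "h \<le> K - 2" "0 < h"
  obtains e w where "arc K m h \<subseteq> arc K e (K - 2)" "w < K" "w \<notin> arc K e (K - 2)"
    "insert w (arc K e (K - 2)) = {..<K} - {i}"
proof -
  have K0: "0 < K" using K4 by simp
  have "i mod K = i" using i(1) by simp
  obtain s where s: "1 \<le> s" "s + h \<le> K" and arc_m: "arc K m h = arc K (i + s) h"
    using bar_position[OF i h(2)] .
  \<comment> \<open>If the bar starts right after row \<open>i\<close>, the \<open>K - 2\<close> rows start there, too, and leave out the last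
    row before \<open>i\<close>; otherwise they leave out the first row after \<open>i\<close>.\<close>
  define d where "d = (if s = 1 then 1 else 2 :: nat)"
  define e where "e = i + d"
  have d: "1 \<le> d" "d \<le> s" "s - d + h \<le> K - 2"
    using s h(1) by (auto simp: d_def)
  have "d \<le> 2" by (simp add: d_def)
  have "arc K m h \<subseteq> arc K e (K - 2)"
  proof
    fix a assume "a \<in> arc K m h"
    then have "a \<in> arc K (i + s) h" by (simp only: arc_m)
    then obtain k where k: "k < h" "a = (i + s + k) mod K" unfolding arc_def by blast
    have "a = (e + (s - d + k)) mod K" using k(2) d(2) by (simp add: e_def add.assoc)
    moreover have "s - d + k < K - 2" using d(3) k(1) by linarith
    ultimately show "a \<in> arc K e (K - 2)" unfolding arc_def by blast
  qed
  moreover have sub: "arc K e (K - 2) \<subseteq> {..<K} - {i}"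
  proof
    fix a assume "a \<in> arc K e (K - 2)"
    then obtain k where k: "k < K - 2" "a = (i + (d + k)) mod K"
      unfolding arc_def e_def add.assoc by blast
    have "d + k < K" "0 < d + k" using k(1) d(1) \<open>d \<le> 2\<close> by linarith+
    then have "(i + (d + k)) mod K \<noteq> (i + 0) mod K" by (subst rotation_eq_iff) auto
    moreover have "a < K" unfolding k(2) using K0 by (rule mod_less_divisor)
    ultimately show "a \<in> {..<K} - {i}" using k(2) \<open>i mod K = i\<close> by simp
  qed
  moreover have "card (({..<K} - {i}) - arc K e (K - 2)) = 1"
    using card_Diff_subset[OF finite_arc sub] i(1) K4 by (simp add: card_arc)
  then obtain w where "({..<K} - {i}) - arc K e (K - 2) = {w}" by (rule card_1_singletonE)
  ultimately show ?thesis using that[of e w] by blast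
qed

text \<open>First \<open>K - 2\<close> vertices of column \<open>x\<close> and then the bar are filled; up to this point the perimeter is at
  most \<open>2 * K\<close>, because the bar lies along the column. The next vertex \<open>w\<close> leads directly to the
  gapped configuration, after which the gap is closed and the columns are filled as before. A
  bar of length \<open>K - 1\<close> does not fit along \<open>K - 2\<close> vertices, which is why its last vertex is added only
  after \<open>w\<close>; in this case the path meets a further gapped configuration before \<open>\<sigma>\<close>.\<close>

lemma gapped_chain:
  assumes g: "gapped_at r t i x y m h \<sigma>" and \<sigma>: "\<sigma> \<in> X"
    and rt: "r \<noteq> t" "r \<in> spins q" "t \<in> spins q"
  obtains D where "chain D" "\<sigma> = two_spin r t (D (K - 1 + h))"
    "\<And>k. k \<le> K * L \<Longrightarrow> per (two_spin r t (D k)) \<le> 2 * K + 2"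
    "\<And>k. k \<le> K * L \<Longrightarrow> K - 1 + h < k \<Longrightarrow> per (two_spin r t (D k)) = 2 * K + 2 \<Longrightarrow>
       two_spin r t (D k) \<in> strips r t"
    "\<And>k. h \<le> K - 2 \<Longrightarrow> k < K - 1 + h \<Longrightarrow> per (two_spin r t (D k)) < 2 * K + 2"
proof -
  note G = gapped_atD[OF g]
  \<comment> \<open>\<open>h'\<close> is the length of the bar at the moment when \<open>w\<close> is added; it differs from \<open>h\<close> only for
    the rectangle.\<close>
  define h' where "h' = min h (K - 2)"
  have h': "2 \<le> h'" "h' \<le> h" "h' \<le> K - 2" "h \<le> K - 2 \<Longrightarrow> h' = h"
    using G(7) K4 by (auto simp: h'_def)
  have "i \<notin> arc K m h'" using G(6) arc_mono[OF h'(2)] by blast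
  then obtain e w where e: "arc K m h' \<subseteq> arc K e (K - 2)" "w < K" "w \<notin> arc K e (K - 2)"
      "insert w (arc K e (K - 2)) = {..<K} - {i}"
    using column_covering_bar[OF G(1) _ h'(3)] h'(1) by (metis less_le_trans zero_less_numeral)
  obtain f where f: "column_order f" "f 0 = x" "f 1 = y"
    using column_order_through[OF G(2-4)] .
  define D where "D k = (if k \<le> K - 2 then arc K e k \<times> {x}
      else if k \<le> K - 2 + h' then arc K e (K - 2) \<times> {x} \<union> arc K m (k - (K - 2)) \<times> {y}
      else if k \<le> K - 1 + h then ({..<K} - {i}) \<times> {x} \<union> arc K m (k - (K - 1)) \<times> {y}
      else fill m f k)" for k
  have D1: "D k = arc K e k \<times> {x}" if "k \<le> K - 2" for k using that by (simp add: D_def)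
  have D2: "D (K - 2 + s) = arc K e (K - 2) \<times> {x} \<union> arc K m s \<times> {y}" if "s \<le> h'" for s
    using that by (cases "s = 0") (auto simp: D_def)
  have D3: "D (K - 1 + s) = ({..<K} - {i}) \<times> {x} \<union> arc K m s \<times> {y}" if "h' \<le> s" "s \<le> h" for s
    using that h'(1) K4 by (auto simp: D_def)
  have D4: "D k = fill m f k" if "K - 1 + h < k" for k
    using that h'(2) K4 by (auto simp: D_def)
  have fill1: "fill m f (K + h) = {..<K} \<times> {x} \<union> arc K m h \<times> {y}"
    using div_mod_mult_add[of h 1] G(8) f by (simp add: fill_def lessThan_Suc)
  have arc_new: "(c + s) mod K \<notin> arc K c s" if "s < K" for c s
    using mem_arc_iff[OF that, of s c] that by simp
  have in_V: "(a mod K, x) \<in> V" "(a mod K, y) \<in> V" for a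
    using G(2,3) K4 by (simp_all add: vertices_def)
  have size: "K - 1 + h < K * L"
  proof -
    have "K - 1 + h < 2 * K" using G(8) by simp
    also have "\<dots> \<le> K * L" using KL K4 by (simp add: mult.commute)
    finally show ?thesis .
  qed
  have step: "\<exists>v\<in>V. v \<notin> D k \<and> D (Suc k) = insert v (D k)" if k: "k < K * L" for k
  proof -
    consider (a) "k < K - 2" | (b) s where "k = K - 2 + s" "s < h'" | (c) "k = K - 2 + h'"
      | (d) s where "k = K - 1 + s" "h' \<le> s" "s < h" | (e) "k = K - 1 + h" | (f) "K - 1 + h < k"
    proof -
      have "k < K - 2 \<or> (k = K - 2 + (k - (K - 2)) \<and> k - (K - 2) < h') \<or> k = K - 2 + h' \<or>
        (k = K - 1 + (k - (K - 1)) \<and> h' \<le> k - (K - 1) \<and> k - (K - 1) < h) \<or> k = K - 1 + h \<or>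
        K - 1 + h < k" using h'(1) K4 by linarith
      then show ?thesis using that by metis
    qed
    then show ?thesis
    proof cases
      case a
      then have "Suc k \<le> K - 2" by simp
      then show ?thesis
        using D1[of k] D1[of "Suc k"] a arc_new[of k e] in_V(1)[of "e + k"]
        by (intro bexI[of _ "((e + k) mod K, x)"]) (auto simp: arc_Suc)
    next
      case (b s)
      have "Suc k = K - 2 + Suc s" using b by simp
      moreover have "s < K" using b(2) h'(3) by linarith
      ultimately show ?thesis
        using D2[of s] D2[of "Suc s"] b arc_new[of s m] in_V(2)[of "m + s"] G(5)
        by (intro bexI[of _ "((m + s) mod K, y)"]) (auto simp: arc_Suc)
    next
      case c
      have "Suc k = K - 1 + h'" using c K4 by simp
      then have "D (Suc k) = insert w (arc K e (K - 2)) \<times> {x} \<union> arc K m h' \<times> {y}"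
        using D3[of h'] h'(2) e(4) by simp
      then show ?thesis
        using D2[of h'] c e(2,3) in_V(1)[of w] G(5)
        by (intro bexI[of _ "(w, x)"]) auto
    next
      case (d s)
      have "Suc k = K - 1 + Suc s" using d by simp
      moreover have "s < K" using d(3) G(8) by linarith
      ultimately show ?thesis
        using D3[of s] D3[of "Suc s"] d arc_new[of s m] in_V(2)[of "m + s"] G(5)
        by (intro bexI[of _ "((m + s) mod K, y)"]) (auto simp: arc_Suc)
    next
      case e
      have "Suc k = K + h" using e K4 by simp
      then have "D (Suc k) = {..<K} \<times> {x} \<union> arc K m h \<times> {y}" using D4[of "Suc k"] e fill1 by simp
      then show ?thesis
        using D3[of h] h'(2) e in_V(1)[of i] G(1,5,6)
        by (intro bexI[of _ "(i, x)"]) auto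
    next
      case f
      then show ?thesis using D4[of k] D4[of "Suc k"] fill_Suc[OF \<open>column_order f\<close> k, of m] by simp
    qed
  qed
  have "chain D"
    unfolding chain_def using D1[of 0] D4[OF size] fill_full[OF f(1), of m] step by simp
  moreover have gap: "gapped_at r t i x y m s (two_spin r t (D (K - 1 + s)))"
    if s: "h' \<le> s" "s \<le> h" for s
    unfolding gapped_at_def
  proof (intro conjI allI impI)
    show "i \<notin> arc K m s" using G(6) arc_mono[OF s(2)] by blast
    show "2 \<le> s" "s < K" using s h'(1) G(8) by linarith+
    fix k j assume kj: "k < K" "j < L"
    show "two_spin r t (D (K - 1 + s)) (k, j) = (if j = x then if k = i then r else t
        else if j = y then if k \<in> arc K m s then t else r else r)"
      unfolding two_spin_vertex[OF kj] D3[OF s] using G(5) kj by auto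
  qed (use G(1-4) in simp_all)
  moreover have "\<sigma> = two_spin r t (D (K - 1 + h))"
  proof (rule config_eqI[OF \<sigma> two_spin_in_X[OF rt(2,3)]])
    fix k j assume "k < K" "j < L"
    then show "\<sigma> (k, j) = two_spin r t (D (K - 1 + h)) (k, j)"
      using g gap[OF h'(2) order_refl] unfolding gapped_at_def by simp
  qed
  moreover have low: "per (two_spin r t (D k)) < 2 * K + 2" if k: "k \<le> K - 2 + h'" for k
  proof (cases "k \<le> K - 2")
    case True
    have "per (two_spin r t (arc K e k \<times> {x} \<union> arc K m 0 \<times> {y})) \<le> 2 * k + 2 + 0"
      using double_bar_perimeter[OF rt(1) G(2-4), of k 0 m e] True K4 by simp
    then show ?thesis using D1[OF True] True K4 by simp
  next
    case False
    define s where "s = k - (K - 2)"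
    have s: "k = K - 2 + s" "s \<le> h'" "s \<noteq> 0" using False k by (simp_all add: s_def)
    have "arc K m s \<subseteq> arc K e (K - 2)" using e(1) arc_mono[OF s(2)] by blast
    then have "per (two_spin r t (D k)) \<le> 2 * (K - 2) + 2 + 2"
      using double_bar_perimeter[OF rt(1) G(2-4), of "K - 2" s m e] D2[OF s(2)] s h'(3) K4 by simp
    then show ?thesis using K4 by linarith
  qed
  moreover have "per (two_spin r t (D k)) \<le> 2 * K + 2" if k: "k \<le> K * L" for k
  proof -
    consider "k \<le> K - 2 + h'" | s where "k = K - 1 + s" "h' \<le> s" "s \<le> h" | "K - 1 + h < k"
    proof -
      have "k \<le> K - 2 + h' \<or> (k = K - 1 + (k - (K - 1)) \<and> h' \<le> k - (K - 1) \<and> k - (K - 1) \<le> h) \<or>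
        K - 1 + h < k" using K4 by linarith
      then show ?thesis using that by metis
    qed
    then show ?thesis
    proof cases
      case 1
      then show ?thesis using low by (simp add: less_imp_le)
    next
      case (2 s)
      then show ?thesis using gapped_perimeter[OF gap[OF 2(2,3)] rt(1)] by simp
    next
      case 3
      then show ?thesis using D4 fill_perimeter_le[OF f(1) rt(1) k, of m] by simp
    qed
  qed
  moreover have "two_spin r t (D k) \<in> strips r t"
    if "k \<le> K * L" "K - 1 + h < k" "per (two_spin r t (D k)) = 2 * K + 2" for k
    using fill_saddle_strips[OF f(1) rt that(1), of m] that D4 by simp
  moreover have "per (two_spin r t (D k)) < 2 * K + 2"
    if "h \<le> K - 2" "k < K - 1 + h" for k
    by (rule low) (use that h'(4) in simp)
  ultimately show ?thesis using that by blast
qed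

lemma strips_fill:
  assumes \<sigma>: "\<sigma> \<in> strips r t" and rt: "r \<noteq> t" "r \<in> spins q" "t \<in> spins q"
  obtains i c f k where "column_order f" "K \<le> k" "k \<le> K * L"
    "\<sigma> = two_spin r t (fill i f k)" "spin_count \<sigma> t = k" "k \<le> K * (L - 1)"
    "f = (\<lambda>b. (c + b) mod L) \<or> f = (\<lambda>b. (c + (L - b)) mod L)"
proof -
  obtain i c f k where F: "f = (\<lambda>b. (c + b) mod L) \<or> f = (\<lambda>b. (c + (L - b)) mod L)"
    "K \<le> k" "k \<le> K * (L - 1)" "\<sigma> = two_spin r t (fill i f k)"
    using strips_eq_fill[OF \<sigma> rt] by metis
  have f: "column_order f" using F(1) column_order_up column_order_down by blast
  have "K * (L - 1) \<le> K * L" by simp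
  then have le: "k \<le> K * L" using F(3) by (rule order_trans[rotated])
  moreover have "spin_count \<sigma> t = k" unfolding F(4) by (rule cnt_chain[OF fill_chain[OF f] le rt(1)])
  ultimately show ?thesis using that[OF f F(2) _ F(4) _ F(3,1)] by simp
qed

lemma strip_not_saddle_dvd:
  assumes \<sigma>: "\<sigma> \<in> strips r t" and rt: "r \<noteq> t" "r \<in> spins q" "t \<in> spins q"
    and per: "per \<sigma> < 2 * K + 2"
  shows "K dvd spin_count \<sigma> t"
proof -
  obtain i f k where F: "column_order f" "K \<le> k" "k \<le> K * (L - 1)"
    "\<sigma> = two_spin r t (fill i f k)" "spin_count \<sigma> t = k"
    using strips_fill[OF \<sigma> rt] by metis
  have "k mod K = 0"
    using fill_strips(2)[OF F(1) rt F(2,3), of i] per unfolding F(4) by (metis less_irrefl)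
  then show ?thesis using F(5) by (simp add: dvd_eq_mod_eq_0)
qed

lemma strip_saddle_not_dvd:
  assumes \<sigma>: "\<sigma> \<in> strips r t" and rt: "r \<noteq> t" "r \<in> spins q" "t \<in> spins q"
    and per: "per \<sigma> = 2 * K + 2"
  shows "\<not> K dvd spin_count \<sigma> t"
proof -
  obtain i f k where F: "column_order f" "K \<le> k" "k \<le> K * L"
    "\<sigma> = two_spin r t (fill i f k)" "spin_count \<sigma> t = k"
    using strips_fill[OF \<sigma> rt] by metis
  have "k mod K \<noteq> 0"
  proof
    assume "k mod K = 0"
    then have "per \<sigma> < 2 * K + 2"
      unfolding F(4) by (intro fill_perimeter_less[OF F(1) rt(1) F(3)]) simp
    then show False using per by simp
  qed
  then show ?thesis using F(5) by (simp add: dvd_eq_mod_eq_0)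
qed

lemma entrance_chain:
  assumes \<sigma>: "\<sigma> \<in> entrance r t" and rt: "r \<noteq> t" "r \<in> spins q" "t \<in> spins q"
  obtains D k where "chain D" "k \<le> K * L" "\<sigma> = two_spin r t (D k)"
    "\<And>k'. k' < k \<Longrightarrow> per (two_spin r t (D k')) < 2 * K + 2"
proof -
  consider "\<sigma> \<in> strips r t" "spin_count \<sigma> t \<le> K + 1" | "\<sigma> \<in> gapped r t" "spin_count \<sigma> t \<le> 2 * K - 3"
    using \<sigma> unfolding entrance_def by blast
  then show ?thesis
  proof cases
    case 1
    obtain i f k where F: "column_order f" "K \<le> k" "k \<le> K * L"
      "\<sigma> = two_spin r t (fill i f k)" "spin_count \<sigma> t = k"
      using strips_fill[OF 1(1) rt] by metis
    have "per (two_spin r t (fill i f k')) < 2 * K + 2" if "k' < k" for k'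
    proof (rule fill_perimeter_less[OF F(1) rt(1)])
      show "k' \<le> K * L" using that F(3) by simp
      have "k' < K \<or> k' = K" using that 1(2) F(5) by linarith
      then show "k' mod K = 0 \<or> k' < K \<or> K * (L - 1) < k'" by auto
    qed
    then show ?thesis using that[OF fill_chain[OF F(1)] F(3,4)] by blast
  next
    case 2
    obtain i x y m h where g: "gapped_at r t i x y m h \<sigma>" "\<sigma> \<in> X"
      using 2(1) unfolding gapped_def by blast
    have h: "h \<le> K - 2" using gapped_cnt[OF g(1) rt(1)] 2(2) K4 by linarith
    obtain D where D: "chain D" "\<sigma> = two_spin r t (D (K - 1 + h))"
      "\<And>k. h \<le> K - 2 \<Longrightarrow> k < K - 1 + h \<Longrightarrow> per (two_spin r t (D k)) < 2 * K + 2"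
      using gapped_chain[OF g rt] by metis
    have "K - 1 + h \<le> 2 * K" using h by linarith
    also have "\<dots> \<le> K * L" using KL K4 by (simp add: mult.commute)
    finally show ?thesis using that[OF D(1) _ D(2)] D(3)[OF h] by blast
  qed
qed

lemma two_spin_swap: "two_spin r t (V - D) = two_spin t r D"
  unfolding two_spin_config_def by (rule ext) auto

text \<open>Emptying the torus instead of filling it exchanges the roles of \<open>r\<close> and \<open>t\<close>.\<close>

lemma chain_reverse:
  assumes "chain D"
  shows "chain (\<lambda>k. V - D (K * L - k))"
  unfolding chain_def
proof (intro conjI allI impI)
  show "V - D (K * L - 0) = {}" "V - D (K * L - K * L) = V"
    using assms by (simp_all add: chain_def)
  fix k assume k: "k < K * L"
  define m where "m = K * L - Suc k"
  have m: "m < K * L" "K * L - k = Suc m" using k by (simp_all add: m_def)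
  then obtain v where v: "v \<in> V" "v \<notin> D m" "D (Suc m) = insert v (D m)"
    using assms unfolding chain_def by blast
  have "D m \<subseteq> V" using chain_card[OF assms, of m] m by simp
  then show "\<exists>v\<in>V. v \<notin> V - D (K * L - k) \<and> V - D (K * L - Suc k) = insert v (V - D (K * L - k))"
    using v m(2) unfolding m_def[symmetric] by (intro bexI[of _ v]) auto
qed

text \<open>Every corridor saddle lies on a filling path whose other saddles are strips with a bar, except that
  the path for a gapped saddle may meet further gapped ones between it and the nearer end.\<close>

lemma corridor_chain:
  assumes \<sigma>: "\<sigma> \<in> corridor r t" "per \<sigma> = 2 * K + 2"
    and rt: "r \<noteq> t" "r \<in> spins q" "t \<in> spins q"
  obtains D where "chain D" "spin_count \<sigma> t \<le> K * L" "\<sigma> = two_spin r t (D (spin_count \<sigma> t))"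
    "\<And>k. k \<le> K * L \<Longrightarrow> per (two_spin r t (D k)) \<le> 2 * K + 2"
    "\<And>k. k \<le> K * L \<Longrightarrow> per (two_spin r t (D k)) = 2 * K + 2 \<Longrightarrow>
       two_spin r t (D k) \<in> strips r t \<or>
       \<sigma> \<in> gapped r t \<and> k \<le> spin_count \<sigma> t \<or> \<sigma> \<in> gapped t r \<and> spin_count \<sigma> t \<le> k"
proof -
  have gapped: "\<exists>D. chain D \<and> spin_count \<sigma> t \<le> K * L \<and> \<sigma> = two_spin r t (D (spin_count \<sigma> t)) \<and>
      (\<forall>k\<le>K * L. per (two_spin r t (D k)) \<le> 2 * K + 2 \<and>
        (per (two_spin r t (D k)) = 2 * K + 2 \<longrightarrow>
           two_spin r t (D k) \<in> strips r t \<or> k \<le> spin_count \<sigma> t))"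
    if mem: "\<sigma> \<in> gapped r t" and rt: "r \<noteq> t" "r \<in> spins q" "t \<in> spins q" for r t
  proof -
    obtain i x y m h where g: "gapped_at r t i x y m h \<sigma>" "\<sigma> \<in> X"
      using mem unfolding gapped_def by blast
    have spin_count: "spin_count \<sigma> t = K - 1 + h" by (rule gapped_cnt[OF g(1) rt(1)])
    obtain D where D: "chain D" "\<sigma> = two_spin r t (D (K - 1 + h))"
      "\<And>k. k \<le> K * L \<Longrightarrow> per (two_spin r t (D k)) \<le> 2 * K + 2"
      "\<And>k. k \<le> K * L \<Longrightarrow> K - 1 + h < k \<Longrightarrow> per (two_spin r t (D k)) = 2 * K + 2 \<Longrightarrow>
         two_spin r t (D k) \<in> strips r t"
      using gapped_chain[OF g rt] by metis
    have "K - 1 + h \<le> 2 * K" using gapped_atD(8)[OF g(1)] by linarith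
    also have "\<dots> \<le> K * L" using KL K4 by (simp add: mult.commute)
    finally have le: "K - 1 + h \<le> K * L" .
    show ?thesis unfolding spin_count using D le not_le by blast
  qed
  consider "\<sigma> \<in> strips r t" | "\<sigma> \<in> gapped r t" | "\<sigma> \<in> gapped t r"
    using \<sigma>(1) unfolding corridor_def by blast
  then show ?thesis
  proof cases
    case 1
    obtain i f k where F: "column_order f" "K \<le> k" "k \<le> K * L"
      "\<sigma> = two_spin r t (fill i f k)" "spin_count \<sigma> t = k"
      using strips_fill[OF 1 rt] by metis
    show ?thesis
    proof (rule that[OF fill_chain[OF F(1)], of i])
      show "spin_count \<sigma> t \<le> K * L" "\<sigma> = two_spin r t (fill i f (spin_count \<sigma> t))"
        unfolding F(5) by (rule F(3), rule F(4))
    qed (use fill_perimeter_le[OF F(1) rt(1)] fill_saddle_strips[OF F(1) rt] in blast)+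
  next
    case 2
    obtain D where D: "chain D" "spin_count \<sigma> t \<le> K * L" "\<sigma> = two_spin r t (D (spin_count \<sigma> t))"
      "\<forall>k\<le>K * L. per (two_spin r t (D k)) \<le> 2 * K + 2 \<and>
        (per (two_spin r t (D k)) = 2 * K + 2 \<longrightarrow>
           two_spin r t (D k) \<in> strips r t \<or> k \<le> spin_count \<sigma> t)"
      using gapped[OF 2 rt] by (elim exE conjE)
    show ?thesis by (rule that[OF D(1-3)]) (use D(4) 2 in blast)+
  next
    case 3
    obtain D where D: "chain D" "spin_count \<sigma> r \<le> K * L" "\<sigma> = two_spin t r (D (spin_count \<sigma> r))"
      "\<forall>k\<le>K * L. per (two_spin t r (D k)) \<le> 2 * K + 2 \<and>
        (per (two_spin t r (D k)) = 2 * K + 2 \<longrightarrow>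
           two_spin t r (D k) \<in> strips t r \<or> k \<le> spin_count \<sigma> r)"
      using gapped[OF 3 rt(1)[symmetric] rt(3,2)] by (elim exE conjE)
    have le: "K * L - k \<le> K * L" for k by simp
    have "two_spin t r (D (spin_count \<sigma> r)) v = r \<or> two_spin t r (D (spin_count \<sigma> r)) v = t"
      if "v \<in> V" for v
      using that by (simp add: two_spin_config_def)
    then have "\<And>v. v \<in> V \<Longrightarrow> \<sigma> v = r \<or> \<sigma> v = t" unfolding D(3)[symmetric] .
    then have sum: "spin_count \<sigma> r + spin_count \<sigma> t = K * L" by (rule cnt_two_spins[OF _ rt(1)])
    let ?D = "\<lambda>k. V - D (K * L - k)"
    have swap: "two_spin r t (?D k) = two_spin t r (D (K * L - k))" for k
      by (rule two_spin_swap)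
    show ?thesis
    proof (rule that[OF chain_reverse[OF D(1)]])
      show "spin_count \<sigma> t \<le> K * L" using sum by linarith
      have "K * L - spin_count \<sigma> t = spin_count \<sigma> r" using sum by linarith
      then show "\<sigma> = two_spin r t (?D (spin_count \<sigma> t))" unfolding swap using D(3) by simp
      fix k assume k: "k \<le> K * L"
      show "per (two_spin r t (?D k)) \<le> 2 * K + 2" unfolding swap using D(4) le by blast
      assume "per (two_spin r t (?D k)) = 2 * K + 2"
      then have "two_spin t r (D (K * L - k)) \<in> strips t r \<or> K * L - k \<le> spin_count \<sigma> r"
        unfolding swap using D(4) le by blast
      moreover have "spin_count \<sigma> t \<le> k" if "K * L - k \<le> spin_count \<sigma> r" using that sum k by linarith
      ultimately show "two_spin r t (?D k) \<in> strips r t \<or>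
          \<sigma> \<in> gapped r t \<and> k \<le> spin_count \<sigma> t \<or> \<sigma> \<in> gapped t r \<and> spin_count \<sigma> t \<le> k"
        unfolding swap using strips_commute 3 by blast
    qed
  qed
qed

section \<open>The saddles of the corridor as bars and rectangles\<close>

lemma rectangle_eq_arcs: "rectangle K L a b i j = arc K i b \<times> arc L j a"
  unfolding rectangle_def arc_def by blast

lemma B_barI:
  assumes "i < K" "j < L" "1 \<le> h" "h \<le> b - 1" "m + h \<le> b" "c = j + a \<or> c = j + L - 1"
  shows "two_spin r t (rectangle K L a b i j \<union> rectangle K L 1 h (i + m) c)
    \<in> B_bar K L a b h r t"
  unfolding B_bar_def using assms
  by (intro CollectI exI[of _ i] exI[of _ j] exI[of _ m] exI[of _ c] conjI refl)

text \<open>As the strip consists of full columns, the bar may be taken as the place where filling starts. A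
  bar on the right comes from filling to the right, a bar on the left from filling to the left.\<close>

lemma B_bar_fill:
  assumes jh: "1 \<le> j" "j \<le> L" "1 \<le> h" "h < K"
  shows "B_bar K L j K h r t = {two_spin r t (fill i f (j * K + h)) | i f c.
    f = (\<lambda>b. (c + b) mod L) \<or> f = (\<lambda>b. (c + (L - b)) mod L)}" (is "?B = ?F")
proof (rule subset_antisym)
  have K0: "0 < K" using K4 by simp
  have L0: "0 < L" using KL by simp
  note dm = div_mod_mult_add[OF jh(4), of j]
  have down_set: "(\<lambda>b. (c + (j - 1) + (L - b)) mod L) ` {..<j} = arc L c j"
    "(c + (j - 1) + (L - j)) mod L = (c + L - 1) mod L" for c
  proof -
    have "(\<lambda>b. (c + (j - 1) + (L - b)) mod L) ` {..<j} = arc L (c + (j - 1) + (L - j) + 1) j"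
      by (rule down_image) (rule jh(2))
    also have "c + (j - 1) + (L - j) + 1 = c + L" using jh by simp
    also have "arc L (c + L) j = arc L c j" by (rule arc_cong) simp
    finally show "(\<lambda>b. (c + (j - 1) + (L - b)) mod L) ` {..<j} = arc L c j" .
    show "(c + (j - 1) + (L - j)) mod L = (c + L - 1) mod L" using jh by simp
  qed
  show "?B \<subseteq> ?F"
  proof
    fix \<sigma> assume "\<sigma> \<in> ?B"
    then obtain i c m c' where B: "c' = c + j \<or> c' = c + L - 1"
      "\<sigma> = two_spin r t (rectangle K L j K i c \<union> rectangle K L 1 h (i + m) c')"
      unfolding B_bar_def by blast
    have \<sigma>: "\<sigma> = two_spin r t
        ({..<K} \<times> arc L c j \<union> arc K (i + m) h \<times> {c' mod L})"
      unfolding B(2) rectangle_eq_arcs arc_full[OF K0] by simp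
    from B(1) show "\<sigma> \<in> ?F"
    proof
      assume c': "c' = c + j"
      have "\<sigma> = two_spin r t (fill (i + m) (\<lambda>b. (c + b) mod L) (j * K + h))"
        unfolding \<sigma> fill_def dm c' arc_def[of L c j] ..
      then show ?thesis by blast
    next
      assume c': "c' = c + L - 1"
      have "\<sigma> = two_spin r t
          (fill (i + m) (\<lambda>b. (c + (j - 1) + (L - b)) mod L) (j * K + h))"
        unfolding \<sigma> fill_def dm c' down_set ..
      then show ?thesis by blast
    qed
  qed
  show "?F \<subseteq> ?B"
  proof
    fix \<sigma> assume "\<sigma> \<in> ?F"
    then obtain i f c where F: "f = (\<lambda>b. (c + b) mod L) \<or> f = (\<lambda>b. (c + (L - b)) mod L)"
      "\<sigma> = two_spin r t (fill i f (j * K + h))" by blast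
    have intro: "\<sigma> \<in> ?B"
      if "f ` {..<j} = arc L c0 j" "f j = c' mod L" "c0 < L" "c' = c0 + j \<or> c' = c0 + L - 1" for c0 c'
    proof -
      have eq: "\<sigma> = two_spin r t
          (rectangle K L j K (i mod K) c0 \<union> rectangle K L 1 h (i mod K + 0) c')"
        unfolding F(2) fill_def dm that(1,2) rectangle_eq_arcs arc_full[OF K0] by (simp add: arc_mod)
      have "i mod K < K" using K0 by (rule mod_less_divisor)
      moreover have "h \<le> K - 1" "0 + h \<le> K" using jh(4) by simp_all
      ultimately show ?thesis unfolding eq using that(3,4) jh(3) by (intro B_barI)
    qed
    from F(1) show "\<sigma> \<in> ?B"
    proof
      assume f: "f = (\<lambda>b. (c + b) mod L)"
      show ?thesis
      proof (rule intro[of "c mod L" "c mod L + j"])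
        show "f ` {..<j} = arc L (c mod L) j" unfolding f arc_mod by (simp add: arc_def)
        show "f j = (c mod L + j) mod L" by (simp add: f mod_add_left_eq)
        show "c mod L < L" using L0 by (rule mod_less_divisor)
      qed simp
    next
      assume f: "f = (\<lambda>b. (c + (L - b)) mod L)"
      let ?c = "(c + (L - j) + 1) mod L"
      show ?thesis
      proof (rule intro[of ?c "?c + L - 1"])
        show "f ` {..<j} = arc L ?c j" unfolding f arc_mod by (rule down_image) (rule jh(2))
        have "(?c + L - 1) mod L = (?c + (L - 1)) mod L" using L0 by simp
        also have "\<dots> = (c + (L - j) + 1 + (L - 1)) mod L" by (rule mod_add_left_eq)
        also have "c + (L - j) + 1 + (L - 1) = c + (L - j) + L" using L0 by simp
        finally show "f j = (?c + L - 1) mod L" by (simp add: f)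
        show "?c < L" using L0 by (rule mod_less_divisor)
      qed simp
    qed
  qed
qed

lemma B_bar_strip:
  assumes \<sigma>: "\<sigma> \<in> B_bar K L j K h r t" and jh: "1 \<le> j" "j \<le> L - 2" "1 \<le> h" "h < K"
    and rt: "r \<noteq> t" "r \<in> spins q" "t \<in> spins q"
  shows "\<sigma> \<in> strips r t" "per \<sigma> = 2 * K + 2" "spin_count \<sigma> t = j * K + h"
proof -
  have "j \<le> L" using jh(2) by simp
  obtain i f c where F: "f = (\<lambda>b. (c + b) mod L) \<or> f = (\<lambda>b. (c + (L - b)) mod L)"
      "\<sigma> = two_spin r t (fill i f (j * K + h))"
    using \<sigma> unfolding B_bar_fill[OF jh(1) \<open>j \<le> L\<close> jh(3,4)] by (elim CollectE exE conjE)
  have f: "column_order f" using F(1) column_order_up column_order_down by blast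
  have "Suc j \<le> L - 1" using jh(2) KL K4 by linarith
  then have "K * Suc j \<le> K * (L - 1)" by (rule mult_le_mono2)
  then have top: "j * K + h \<le> K * (L - 1)" using jh(4) by (simp add: mult.commute)
  have "K * (L - 1) \<le> K * L" by simp
  then have le: "j * K + h \<le> K * L" using top by (rule order_trans[rotated])
  have "1 * K \<le> j * K" using jh(1) by (rule mult_le_mono1)
  then have bot: "K \<le> j * K + h" by linarith
  show "\<sigma> \<in> strips r t" unfolding F(2) by (rule fill_strips(1)[OF f rt bot top])
  show "per \<sigma> = 2 * K + 2" unfolding F(2)
    by (rule fill_strips(2)[OF f rt bot top]) (use div_mod_mult_add(2)[OF jh(4), of j] jh(3) in simp)
  show "spin_count \<sigma> t = j * K + h" unfolding F(2) by (rule cnt_chain[OF fill_chain[OF f] le rt(1)])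
qed

lemma strip_saddle_B_bar:
  assumes \<sigma>: "\<sigma> \<in> strips r t" "per \<sigma> = 2 * K + 2" and rt: "r \<noteq> t" "r \<in> spins q" "t \<in> spins q"
  obtains j h where "1 \<le> j" "j \<le> L - 2" "1 \<le> h" "h < K" "\<sigma> \<in> B_bar K L j K h r t"
proof -
  obtain i c f k where F: "K \<le> k" "\<sigma> = two_spin r t (fill i f k)" "spin_count \<sigma> t = k"
    "k \<le> K * (L - 1)" "f = (\<lambda>b. (c + b) mod L) \<or> f = (\<lambda>b. (c + (L - b)) mod L)"
    using strips_fill[OF \<sigma>(1) rt] by metis
  define j h where "j = k div K" and "h = k mod K"
  have k: "k = j * K + h" and h: "h < K" using K4 by (simp_all add: j_def h_def)
  have "h \<noteq> 0"
    using strip_saddle_not_dvd[OF \<sigma>(1) rt \<sigma>(2)] F(3) by (simp add: h_def dvd_eq_mod_eq_0)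
  then have h1: "1 \<le> h" by simp
  have j1: "1 \<le> j" using F(1) K4 by (simp add: j_def Suc_le_eq div_greater_zero_iff)
  have j: "j \<le> L - 2"
  proof (rule ccontr)
    assume "\<not> ?thesis"
    then have "L - 1 \<le> j" by simp
    then have "K * (L - 1) \<le> K * j" by (rule mult_le_mono2)
    then show False using F(4) h1 unfolding k mult.commute[of j K] by linarith
  qed
  then have "j \<le> L" by simp
  then have "\<sigma> \<in> B_bar K L j K h r t"
    unfolding B_bar_fill[OF j1 \<open>j \<le> L\<close> h1 h] using F(2,5) unfolding k by blast
  then show ?thesis using that[OF j1 j h1 h] by simp
qed

lemma arc_missing_row:
  assumes "i < K"
  shows "arc K i (K - 1) = {..<K} - {(i + K - 1) mod K}" "(i + K - 1) mod K < K"
proof -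
  have K0: "0 < K" using K4 by simp
  show lt: "(i + K - 1) mod K < K" using K0 by (rule mod_less_divisor)
  have "((i + K - 1) mod K + 1) mod K = (i + K - 1 + 1) mod K" by (rule mod_add_left_eq)
  also have "\<dots> = i mod K" using K0 by simp
  finally have "arc K ((i + K - 1) mod K + 1) (K - 1) = arc K i (K - 1)" by (rule arc_cong)
  then show "arc K i (K - 1) = {..<K} - {(i + K - 1) mod K}" using arc_all_but_one[OF lt] by simp
qed

lemma two_spin_gapped:
  assumes "i < K" "x < L" "y < L" "y = (x + 1) mod L \<or> x = (y + 1) mod L"
    "i \<notin> arc K m h" "2 \<le> h" "h < K" and rt: "r \<in> spins q" "t \<in> spins q"
  shows "two_spin r t (({..<K} - {i}) \<times> {x} \<union> arc K m h \<times> {y}) \<in> gapped r t"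
proof -
  let ?\<sigma> = "two_spin r t (({..<K} - {i}) \<times> {x} \<union> arc K m h \<times> {y})"
  have "gapped_at r t i x y m h ?\<sigma>"
    unfolding gapped_at_def
  proof (intro conjI allI impI)
    fix k j assume kj: "k < K" "j < L"
    show "?\<sigma> (k, j) = (if j = x then if k = i then r else t
        else if j = y then if k \<in> arc K m h then t else r else r)"
      unfolding two_spin_vertex[OF kj] using adjacent_neq[OF assms(2-4)] kj by auto
  qed (rule assms)+
  then show ?thesis unfolding gapped_def using two_spin_in_X[OF rt] by blast
qed

lemma gapped_two_spin:
  assumes "\<sigma> \<in> gapped r t" and rt: "r \<in> spins q" "t \<in> spins q"
  obtains i x y m h where "i < K" "x < L" "y < L" "y = (x + 1) mod L \<or> x = (y + 1) mod L"
    "i \<notin> arc K m h" "2 \<le> h" "h < K"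
    "\<sigma> = two_spin r t (({..<K} - {i}) \<times> {x} \<union> arc K m h \<times> {y})"
proof -
  obtain i x y m h where g: "gapped_at r t i x y m h \<sigma>" "\<sigma> \<in> X"
    using assms(1) unfolding gapped_def by blast
  note G = gapped_atD[OF g(1)]
  have "\<sigma> = two_spin r t (({..<K} - {i}) \<times> {x} \<union> arc K m h \<times> {y})"
  proof (rule config_eqI[OF g(2) two_spin_in_X[OF rt]])
    fix k j assume kj: "k < K" "j < L"
    show "\<sigma> (k, j) = two_spin r t (({..<K} - {i}) \<times> {x} \<union> arc K m h \<times> {y}) (k, j)"
      unfolding two_spin_vertex[OF kj] using g(1) kj G(5) unfolding gapped_at_def by auto
  qed
  then show ?thesis using that[OF G(1-4,6-8)] by blast
qed

lemma B_bar_gapped: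
  assumes \<sigma>: "\<sigma> \<in> B_bar K L 1 (K - 1) h r t" and h: "2 \<le> h" and rt: "r \<in> spins q" "t \<in> spins q"
  shows "\<sigma> \<in> gapped r t"
proof -
  obtain i x m c where B: "i < K" "x < L" "m + h \<le> K - 1" "c = x + 1 \<or> c = x + L - 1"
    "\<sigma> = two_spin r t (rectangle K L 1 (K - 1) i x \<union> rectangle K L 1 h (i + m) c)"
    using \<sigma> unfolding B_bar_def by blast
  define y where "y = c mod L"
  have y: "y < L" using B(2) unfolding y_def by (intro mod_less_divisor) simp
  have adj: "y = (x + 1) mod L \<or> x = (y + 1) mod L"
    using B(4)
  proof
    assume c: "c = x + L - 1"
    have "(y + 1) mod L = (x + L - 1 + 1) mod L" unfolding y_def c by (rule mod_add_left_eq)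
    also have "x + L - 1 + 1 = x + L" using B(2) by simp
    finally show ?thesis using B(2) by simp
  qed (simp add: y_def)
  have sub: "arc K (i + m) h \<subseteq> arc K i (K - 1)"
  proof
    fix a assume "a \<in> arc K (i + m) h"
    then obtain k where k: "k < h" "a = (i + (m + k)) mod K" unfolding arc_def add.assoc by blast
    have "m + k < K - 1" using k(1) B(3) by linarith
    then show "a \<in> arc K i (K - 1)" unfolding k(2) arc_def by blast
  qed
  have "\<sigma> = two_spin r t
      (({..<K} - {(i + K - 1) mod K}) \<times> {x} \<union> arc K (i + m) h \<times> {y})"
    unfolding B(5) rectangle_eq_arcs arc_missing_row(1)[OF B(1)] using B(2) by (simp add: y_def)
  moreover have "two_spin r t
      (({..<K} - {(i + K - 1) mod K}) \<times> {x} \<union> arc K (i + m) h \<times> {y}) \<in> gapped r t"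
  proof (rule two_spin_gapped[OF arc_missing_row(2)[OF B(1)] B(2) y adj _ h _ rt])
    show "(i + K - 1) mod K \<notin> arc K (i + m) h" using sub arc_missing_row(1)[OF B(1)] by blast
    show "h < K" using B(3) K4 by linarith
  qed
  ultimately show ?thesis by simp
qed

lemma R_bar_gapped:
  assumes \<sigma>: "\<sigma> \<in> R_bar K L 2 (K - 1) r t" and rt: "r \<in> spins q" "t \<in> spins q"
  shows "\<sigma> \<in> gapped r t"
proof -
  obtain i x where B: "i < K" "x < L"
    "\<sigma> = two_spin r t (rectangle K L 2 (K - 1) i x)"
    using \<sigma> unfolding R_bar_def by blast
  have y: "(x + 1) mod L < L" using B(2) by (intro mod_less_divisor) simp
  have "rectangle K L 2 (K - 1) i x =
      ({..<K} - {(i + K - 1) mod K}) \<times> {x} \<union> arc K i (K - 1) \<times> {(x + 1) mod L}"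
    unfolding rectangle_eq_arcs arc_pair[OF B(2)] arc_missing_row(1)[OF B(1)] by blast
  then have "\<sigma> = two_spin r t
      (({..<K} - {(i + K - 1) mod K}) \<times> {x} \<union> arc K i (K - 1) \<times> {(x + 1) mod L})"
    using B(3) by simp
  moreover have "two_spin r t
      (({..<K} - {(i + K - 1) mod K}) \<times> {x} \<union> arc K i (K - 1) \<times> {(x + 1) mod L}) \<in> gapped r t"
    by (rule two_spin_gapped[OF arc_missing_row(2)[OF B(1)] B(2) y _ _ _ _ rt])
      (use arc_missing_row(1)[OF B(1)] K4 in auto)
  ultimately show ?thesis by simp
qed

lemma gapped_bar_or_rectangle:
  assumes \<sigma>: "\<sigma> \<in> gapped r t" and rt: "r \<in> spins q" "t \<in> spins q"
  shows "\<sigma> \<in> R_bar K L 2 (K - 1) r t \<or> (\<exists>h\<in>{2..K - 2}. \<sigma> \<in> B_bar K L 1 (K - 1) h r t)"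
proof -
  obtain i x y m h where G: "i < K" "x < L" "y < L" "y = (x + 1) mod L \<or> x = (y + 1) mod L"
    "i \<notin> arc K m h" "2 \<le> h" "h < K"
    "\<sigma> = two_spin r t (({..<K} - {i}) \<times> {x} \<union> arc K m h \<times> {y})"
    using gapped_two_spin[OF \<sigma> rt] by metis
  define i' where "i' = (i + 1) mod K"
  have K0: "0 < K" using K4 by simp
  have i': "i' < K" unfolding i'_def using K0 by (rule mod_less_divisor)
  have col: "arc K i' (K - 1) = {..<K} - {i}"
    unfolding i'_def arc_mod by (rule arc_all_but_one[OF G(1)])
  show ?thesis
  proof (cases "h = K - 1")
    case True
    have "arc K m h = {..<K} - {i}"
    proof (rule card_subset_eq)
      show "arc K m h \<subseteq> {..<K} - {i}" using arc_subset[OF K0, of m h] G(5) by blast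
      show "card (arc K m h) = card ({..<K} - {i})" using G(1,7) True by (simp add: card_arc)
    qed simp
    then have \<sigma>_eq: "\<sigma> = two_spin r t (arc K i' (K - 1) \<times> {x, y})"
      unfolding G(8) col by (intro arg_cong[where f = "two_spin r t"]) blast
    obtain z where z: "z < L" "arc L z 2 = {x, y}"
      using G(2-4) arc_pair[of x L] arc_pair[of y L] by (metis insert_commute)
    have "\<sigma> = two_spin r t (rectangle K L 2 (K - 1) i' z)"
      unfolding \<sigma>_eq rectangle_eq_arcs z(2) ..
    then show ?thesis unfolding R_bar_def using i' z(1) by blast
  next
    case False
    then have h: "h \<in> {2..K - 2}" using G(6,7) by simp
    have h0: "0 < h" using G(6) by simp
    obtain s where s: "1 \<le> s" "s + h \<le> K" "arc K m h = arc K (i + s) h"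
      using bar_position[OF G(1,5) h0] .
    have "(i' + (s - 1)) mod K = (i + 1 + (s - 1)) mod K" unfolding i'_def by (rule mod_add_left_eq)
    also have "i + 1 + (s - 1) = i + s" using s(1) by simp
    finally have bar: "arc K (i' + (s - 1)) h = arc K m h" unfolding s(3) by (rule arc_cong)
    obtain c where c: "c = x + 1 \<or> c = x + L - 1" "c mod L = y"
      using G(4)
    proof
      assume "y = (x + 1) mod L" then show ?thesis using that[of "x + 1"] by simp
    next
      assume x: "x = (y + 1) mod L"
      have "(x + L - 1) mod L = (x + (L - 1)) mod L" using KL by simp
      also have "\<dots> = (y + 1 + (L - 1)) mod L" unfolding x by (rule mod_add_left_eq)
      also have "y + 1 + (L - 1) = y + L" using KL by simp
      finally have "(x + L - 1) mod L = y" using G(3) by simp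
      then show ?thesis using that[of "x + L - 1"] by simp
    qed
    have eq: "\<sigma> = two_spin r t
        (rectangle K L 1 (K - 1) i' x \<union> rectangle K L 1 h (i' + (s - 1)) c)"
      unfolding G(8) rectangle_eq_arcs col bar using G(2) c(2) by simp
    have "s - 1 + h \<le> K - 1" "1 \<le> h" "h \<le> K - 1 - 1" using s(1,2) h by auto
    then have "\<sigma> \<in> B_bar K L 1 (K - 1) h r t"
      unfolding eq using i' G(2) c(1) by (intro B_barI)
    then show ?thesis using h by blast
  qed
qed

definition corridor_saddles :: "nat \<Rightarrow> nat \<Rightarrow> config set" where
  "corridor_saddles r t = {\<sigma> \<in> corridor r t. per \<sigma> = 2 * K + 2}"

lemma saddles_commute: "corridor_saddles r t = corridor_saddles t r"
  unfolding corridor_saddles_def using corridor_commute by blast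

lemma gapped_saddles: "r \<noteq> t \<Longrightarrow> gapped r t \<subseteq> corridor_saddles r t"
  using gapped_perimeter unfolding corridor_saddles_def corridor_def gapped_def by blast

lemma bar_saddles:
  assumes "1 \<le> j" "j \<le> L - 2" "1 \<le> h" "h < K" "r \<noteq> t" "r \<in> spins q" "t \<in> spins q"
  shows "B_bar K L j K h r t \<subseteq> corridor_saddles r t"
  using B_bar_strip(1,2)[OF _ assms] unfolding corridor_saddles_def corridor_def by blast

lemma H_Q_P_saddles:
  assumes rt: "r \<noteq> t" "r \<in> spins q" "t \<in> spins q"
  shows "H_bar K L r t \<union> Q_bar K L r t \<union> P_bar K L r t \<subseteq> corridor_saddles r t"
proof -
  have one: "B_bar K L 1 K h r t \<subseteq> corridor_saddles r t" if "1 \<le> h" "h < K" for h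
    by (rule bar_saddles[OF _ _ that rt]) (use K4 KL in auto)
  have g: "B_bar K L 1 (K - 1) h r t \<subseteq> corridor_saddles r t" if "2 \<le> h" for h
    using B_bar_gapped[OF _ that rt(2,3)] gapped_saddles[OF rt(1)] by blast
  have "R_bar K L 2 (K - 1) r t \<subseteq> corridor_saddles r t"
    using R_bar_gapped[OF _ rt(2,3)] gapped_saddles[OF rt(1)] by blast
  moreover have "H_bar K L r t \<subseteq> corridor_saddles r t"
    unfolding H_bar_def Hi_bar_def
  proof (intro UN_least Un_least)
    fix i assume i: "i \<in> {1..K - 3}"
    then show "B_bar K L 1 K i r t \<subseteq> corridor_saddles r t" using K4 by (intro one) auto
    fix h assume "h \<in> {i + 1..K - 2}"
    then show "B_bar K L 1 (K - 1) h r t \<subseteq> corridor_saddles r t" using i by (intro g) auto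
  qed
  moreover have "B_bar K L 1 K (K - 2) r t \<subseteq> corridor_saddles r t" "B_bar K L 1 K (K - 1) r t \<subseteq> corridor_saddles r t"
    by (rule one; use K4 in linarith)+
  ultimately show ?thesis unfolding Q_bar_def P_bar_def by blast
qed

lemma first_bar_in_H_Q_P:
  assumes "\<sigma> \<in> B_bar K L 1 K h r t" "1 \<le> h" "h < K"
  shows "\<sigma> \<in> H_bar K L r t \<union> Q_bar K L r t \<union> P_bar K L r t"
proof -
  consider "h \<in> {1..K - 3}" | "h = K - 2" | "h = K - 1" using assms(2,3) by force
  then show ?thesis
    by cases (use assms(1) in \<open>auto simp: H_bar_def Hi_bar_def Q_bar_def P_bar_def\<close>)
qed

lemma gapped_in_H_Q_P:
  assumes "\<sigma> \<in> gapped r t" "r \<in> spins q" "t \<in> spins q"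
  shows "\<sigma> \<in> H_bar K L r t \<union> Q_bar K L r t \<union> P_bar K L r t"
  using gapped_bar_or_rectangle[OF assms]
proof
  assume "\<exists>h\<in>{2..K - 2}. \<sigma> \<in> B_bar K L 1 (K - 1) h r t"
  then have "\<sigma> \<in> Hi_bar K L 1 r t" unfolding Hi_bar_def by (auto simp: numeral_2_eq_2)
  moreover have "1 \<in> {1..K - 3}" using K4 by simp
  ultimately show ?thesis unfolding H_bar_def by blast
qed (auto simp: Q_bar_def)

lemma tilde_eq:
  "H_tilde K L r t = H_bar K L t r" "Q_tilde K L r t = Q_bar K L t r" "P_tilde K L r t = P_bar K L t r"
  by (simp_all add: H_tilde_def H_bar_def Hi_tilde_def Hi_bar_def Q_tilde_def Q_bar_def P_tilde_def
      P_bar_def B_tilde_def R_tilde_def)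

text \<open>Strips with a bar have \<open>1\<close> to \<open>L - 2\<close> full columns. The extreme values give the sets with a
  bar and with a tilde, the latter because a strip of \<open>L - 2\<close> columns with a bar is the complement
  of one column with a bar; the gapped configurations are the remaining ones.\<close>

lemma F_union_eq_saddles:
  assumes rt: "r \<noteq> t" "r \<in> spins q" "t \<in> spins q"
  shows "F_union K L r t = corridor_saddles r t"
proof (rule subset_antisym)
  have "(\<Union>j\<in>{2..L - 3}. W_union K L j r t) \<subseteq> corridor_saddles r t"
    unfolding W_union_def W_bar_def
  proof (intro UN_least)
    fix j h assume "j \<in> {2..L - 3}" "h \<in> {1..K - 1}"
    then show "B_bar K L j K h r t \<subseteq> corridor_saddles r t"
      using K4 by (intro bar_saddles[OF _ _ _ _ rt]) auto
  qed
  then show "F_union K L r t \<subseteq> corridor_saddles r t"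
    using H_Q_P_saddles[OF rt] H_Q_P_saddles[OF rt(1)[symmetric] rt(3,2)] saddles_commute
    unfolding F_union_def tilde_eq by blast
  show "corridor_saddles r t \<subseteq> F_union K L r t"
  proof
    fix \<sigma> assume \<sigma>: "\<sigma> \<in> corridor_saddles r t"
    then have per: "per \<sigma> = 2 * K + 2" by (simp add: corridor_saddles_def)
    consider "\<sigma> \<in> strips r t" | "\<sigma> \<in> gapped r t" | "\<sigma> \<in> gapped t r"
      using \<sigma> unfolding corridor_saddles_def corridor_def by blast
    then show "\<sigma> \<in> F_union K L r t"
    proof cases
      case 1
      obtain j h where B: "1 \<le> j" "j \<le> L - 2" "1 \<le> h" "h < K" "\<sigma> \<in> B_bar K L j K h r t"
        using strip_saddle_B_bar[OF 1 per rt] .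
      consider "j = 1" | "j \<in> {2..L - 3}" | "j = L - 2" using B(1,2) by force
      then show ?thesis
      proof cases
        case 1
        then show ?thesis using first_bar_in_H_Q_P[of \<sigma> h r t] B unfolding F_union_def by blast
      next
        case 2
        then have "\<sigma> \<in> W_union K L j r t" using B unfolding W_union_def W_bar_def by auto
        then show ?thesis using 2 unfolding F_union_def by blast
      next
        case 3
        have "\<sigma> \<in> strips t r" using 1 strips_commute by blast
        then obtain j' h' where B': "1 \<le> j'" "j' \<le> L - 2" "1 \<le> h'" "h' < K" "\<sigma> \<in> B_bar K L j' K h' t r"
          using strip_saddle_B_bar[OF _ per rt(1)[symmetric] rt(3,2)] by metis
        have "spin_count \<sigma> r + spin_count \<sigma> t = K * L"
          by (rule cnt_two_spins[OF _ rt(1)]) (use 1 in \<open>auto simp: strips_def\<close>)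
        then have "j' * K + h' + (j * K + h) = K * L"
          using B_bar_strip(3)[OF B(5) B(1-4) rt]
            B_bar_strip(3)[OF B'(5) B'(1-4) rt(1)[symmetric] rt(3,2)] by simp
        moreover have "L = j + 2" using 3 KL K4 by simp
        then have "K * L = (j + 2) * K" by (metis mult.commute)
        ultimately have "j' * K + h' + h = 2 * K" by (simp add: algebra_simps)
        then have "j' * K < 2 * K" using B(3) by linarith
        then have "j' = 1" using B'(1) by simp
        then show ?thesis
          using first_bar_in_H_Q_P[of \<sigma> h' t r] B' unfolding F_union_def tilde_eq by blast
      qed
    next
      case 2
      then show ?thesis using gapped_in_H_Q_P[OF 2 rt(2,3)] unfolding F_union_def by blast
    next
      case 3
      then show ?thesis using gapped_in_H_Q_P[OF 3 rt(3,2)] unfolding F_union_def tilde_eq by blast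
    qed
  qed
qed

section \<open>Paths\<close>

definition reach :: "config set \<Rightarrow> config \<Rightarrow> config \<Rightarrow> bool" where
  "reach U \<sigma> \<eta> \<longleftrightarrow> (\<exists>\<omega>\<in>paths q K L \<sigma> \<eta>. set \<omega> \<subseteq> U)"

lemma connectivity_iff:
  assumes "\<sigma> \<in> X" "\<sigma>' \<in> X"
  shows "0 < connectivity q K L \<sigma> \<sigma>' \<longleftrightarrow> (\<exists>v\<in>V. \<exists>c\<in>spins q. \<sigma>' = \<sigma>(v := c))"
  by (rule connectivity_pos_iff) (use assms q2 K4 KL in auto)

lemma connectivity_sym: "connectivity q K L \<sigma> \<sigma>' = connectivity q K L \<sigma>' \<sigma>"
proof -
  have "{v \<in> V. \<sigma> v \<noteq> \<sigma>' v} = {v \<in> V. \<sigma>' v \<noteq> \<sigma> v}" by auto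
  then show ?thesis unfolding connectivity_def by simp
qed

lemma path_invariant:
  assumes \<omega>: "\<omega> \<in> paths q K L \<sigma> \<eta>" and start: "P \<sigma>"
    and step: "\<And>\<xi> \<zeta> v c. \<xi> \<in> set \<omega> \<Longrightarrow> \<zeta> \<in> set \<omega> \<Longrightarrow> \<xi> \<in> X \<Longrightarrow> \<zeta> \<in> X \<Longrightarrow> v \<in> V \<Longrightarrow>
      \<zeta> = \<xi>(v := c) \<Longrightarrow> P \<xi> \<Longrightarrow> P \<zeta>"
  shows "P \<eta>"
proof -
  have ne: "\<omega> \<noteq> []" and sub: "set \<omega> \<subseteq> X" and hd: "hd \<omega> = \<sigma>" and last: "last \<omega> = \<eta>"
    and conn: "\<And>i. Suc i < length \<omega> \<Longrightarrow> 0 < connectivity q K L (\<omega> ! i) (\<omega> ! Suc i)"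
    using \<omega> unfolding paths_def by auto
  have "P (\<omega> ! i)" if "i < length \<omega>" for i
    using that
  proof (induction i)
    case 0
    then show ?case using start hd ne by (simp add: hd_conv_nth)
  next
    case (Suc i)
    have mem: "\<omega> ! i \<in> set \<omega>" "\<omega> ! Suc i \<in> set \<omega>" using Suc.prems by simp_all
    have X: "\<omega> ! i \<in> X" "\<omega> ! Suc i \<in> X" using mem sub by blast+
    then obtain v c where "v \<in> V" "\<omega> ! Suc i = (\<omega> ! i)(v := c)"
      using conn[OF Suc.prems] connectivity_iff by blast
    moreover have "P (\<omega> ! i)" using Suc by simp
    ultimately show ?case using step[OF mem X] by blast
  qed
  then show ?thesis using last ne by (metis last_conv_nth diff_less length_greater_0_conv zero_less_one)
qed

lemma reach_refl: "\<sigma> \<in> X \<Longrightarrow> \<sigma> \<in> U \<Longrightarrow> reach U \<sigma> \<sigma>"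
  unfolding reach_def paths_def by (rule bexI[of _ "[\<sigma>]"]) auto

lemma reach_mono: "reach U \<sigma> \<eta> \<Longrightarrow> U \<subseteq> U' \<Longrightarrow> reach U' \<sigma> \<eta>"
  unfolding reach_def by blast

lemma reach_step:
  assumes "reach U \<sigma> \<eta>" "\<zeta> \<in> X" "\<zeta> \<in> U" "v \<in> V" "\<zeta> = \<eta>(v := c)"
  shows "reach U \<sigma> \<zeta>"
proof -
  obtain \<omega> where \<omega>: "\<omega> \<in> paths q K L \<sigma> \<eta>" "set \<omega> \<subseteq> U" using assms(1) unfolding reach_def by blast
  have ne: "\<omega> \<noteq> []" and sub: "set \<omega> \<subseteq> X" and hd: "hd \<omega> = \<sigma>" and last: "last \<omega> = \<eta>"
    and conn: "\<And>i. Suc i < length \<omega> \<Longrightarrow> 0 < connectivity q K L (\<omega> ! i) (\<omega> ! Suc i)"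
    using \<omega> unfolding paths_def by auto
  have "\<eta> \<in> X" using last ne sub by (metis last_in_set subsetD)
  moreover have "c \<in> spins q"
    using PiE_mem[OF assms(2)[unfolded configs_def] assms(4)] assms(5) by simp
  ultimately have c: "0 < connectivity q K L \<eta> \<zeta>"
    using connectivity_iff assms(2,4,5) by blast
  have "0 < connectivity q K L ((\<omega> @ [\<zeta>]) ! i) ((\<omega> @ [\<zeta>]) ! Suc i)"
    if i: "Suc i < length (\<omega> @ [\<zeta>])" for i
  proof (cases "Suc i < length \<omega>")
    case True
    then show ?thesis using conn by (simp add: nth_append)
  next
    case False
    then have "Suc i = length \<omega>" using i by simp
    then have "i = length \<omega> - 1" by simp
    then show ?thesis using c last ne \<open>Suc i = length \<omega>\<close> by (simp add: nth_append last_conv_nth)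
  qed
  then have "\<omega> @ [\<zeta>] \<in> paths q K L \<sigma> \<zeta>"
    using ne sub hd assms(2) unfolding paths_def by simp
  moreover have "set (\<omega> @ [\<zeta>]) \<subseteq> U" using \<omega>(2) assms(3) by simp
  ultimately show ?thesis unfolding reach_def by blast
qed

lemma reach_trans:
  assumes "reach U \<sigma> \<eta>" "reach U \<eta> \<zeta>"
  shows "reach U \<sigma> \<zeta>"
proof -
  obtain \<omega> where \<omega>: "\<omega> \<in> paths q K L \<eta> \<zeta>" "set \<omega> \<subseteq> U" using assms(2) unfolding reach_def by blast
  show ?thesis
    by (rule path_invariant[OF \<omega>(1), where P = "reach U \<sigma>"])
      (use assms(1) \<omega>(2) reach_step in blast)+
qed

lemma reach_sym:
  assumes "reach U \<sigma> \<eta>"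
  shows "reach U \<eta> \<sigma>"
proof -
  obtain \<omega> where \<omega>: "\<omega> \<in> paths q K L \<sigma> \<eta>" "set \<omega> \<subseteq> U" using assms unfolding reach_def by blast
  have ne: "\<omega> \<noteq> []" and sub: "set \<omega> \<subseteq> X" and hd: "hd \<omega> = \<sigma>" and last: "last \<omega> = \<eta>"
    and conn: "\<And>i. Suc i < length \<omega> \<Longrightarrow> 0 < connectivity q K L (\<omega> ! i) (\<omega> ! Suc i)"
    using \<omega> unfolding paths_def by auto
  have "0 < connectivity q K L (rev \<omega> ! i) (rev \<omega> ! Suc i)" if i: "Suc i < length (rev \<omega>)" for i
  proof -
    define m where "m = length \<omega> - Suc (Suc i)"
    have "rev \<omega> ! i = \<omega> ! Suc m" "rev \<omega> ! Suc i = \<omega> ! m" "Suc m < length \<omega>"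
      using i by (simp_all add: rev_nth m_def Suc_diff_Suc)
    then show ?thesis using conn[of m] connectivity_sym by simp
  qed
  then have "rev \<omega> \<in> paths q K L \<eta> \<sigma>"
    using ne sub hd last unfolding paths_def by (simp add: hd_rev last_rev)
  then show ?thesis unfolding reach_def using \<omega>(2) by (intro bexI[of _ "rev \<omega>"]) simp_all
qed

lemma chain_reach:
  assumes D: "chain D" and k: "k \<le> K * L" and rt: "r \<in> spins q" "t \<in> spins q"
  shows "reach ((\<lambda>k'. two_spin r t (D k')) ` {..k}) (constant_config K L r)
    (two_spin r t (D k))"
  using k
proof (induction k)
  case 0
  have "two_spin r t (D 0) = constant_config K L r"
    using D by (simp add: chain_def two_spin_config_def constant_config_def)
  then show ?case using reach_refl two_spin_in_X[OF rt, of "D 0"] by simp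
next
  case (Suc k)
  obtain v where v: "v \<in> V" "D (Suc k) = insert v (D k)"
    using D Suc.prems unfolding chain_def by (meson Suc_le_lessD)
  have "two_spin r t (D (Suc k)) = (two_spin r t (D k))(v := t)"
    using v unfolding two_spin_config_def by (auto simp: fun_eq_iff)
  moreover have "reach ((\<lambda>k'. two_spin r t (D k')) ` {..Suc k}) (constant_config K L r)
    (two_spin r t (D k))"
    by (rule reach_mono[OF Suc.IH]) (use Suc.prems in auto)
  ultimately show ?case
    using reach_step[OF _ two_spin_in_X[OF rt] _ v(1)] by (metis atMost_iff imageI order_refl)
qed

lemma two_spin_full: "two_spin r t V = constant_config K L t"
  by (simp add: two_spin_config_def constant_config_def fun_eq_iff)

definition low :: "config set" where
  "low = {\<sigma> \<in> X. per \<sigma> < 2 * K + 2}"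

lemma entrance_reach:
  assumes "\<sigma> \<in> entrance r t" "r \<noteq> t" "r \<in> spins q" "t \<in> spins q"
  shows "reach (insert \<sigma> low) (constant_config K L r) \<sigma>"
proof -
  obtain D k where D: "chain D" "k \<le> K * L" "\<sigma> = two_spin r t (D k)"
    "\<And>k'. k' < k \<Longrightarrow> per (two_spin r t (D k')) < 2 * K + 2"
    using entrance_chain[OF assms] by metis
  have "(\<lambda>k'. two_spin r t (D k')) ` {..k} \<subseteq> insert \<sigma> low"
  proof (intro image_subsetI)
    fix k' assume "k' \<in> {..k}"
    then show "two_spin r t (D k') \<in> insert \<sigma> low"
      using D(3) D(4)[of k'] two_spin_in_X[OF assms(3,4)] unfolding low_def
      by (cases "k' = k") auto
  qed
  from reach_mono[OF chain_reach[OF D(1,2) assms(3,4)] this] show ?thesis using D(3) by simp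
qed

section \<open>Optimal paths and essential saddles\<close>

abbreviation (input) "ground \<equiv> constant_config K L"

definition corridors :: "nat \<Rightarrow> config set" where
  "corridors r = (\<Union>t\<in>spins q - {r}. corridor r t)"

lemma two_spin_update_back: "\<eta> = \<xi>(v := c) \<Longrightarrow> \<xi> = \<eta>(v := \<xi> v)"
  by (simp add: fun_eq_iff)

text \<open>Outside of the corridors a path starting in \<open>r\<close> stays near \<open>r\<close>, and it enters a corridor through
  the entrance at this end.\<close>

lemma step_outside:
  assumes r: "r \<in> spins q" and \<xi>: "\<xi> \<in> X" "per \<xi> \<le> 2 * K + 2" and \<eta>: "\<eta> \<in> X" "per \<eta> \<le> 2 * K + 2"
    and v: "v \<in> V" "\<eta> = \<xi>(v := c)" and out: "\<xi> \<notin> corridors r" "mostly r \<xi>"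
  shows "mostly r \<eta>" "\<eta> \<in> corridors r \<Longrightarrow> \<exists>t\<in>spins q - {r}. \<eta> \<in> entrance r t"
proof -
  show m: "mostly r \<eta>"
  proof (rule ccontr)
    assume "\<not> mostly r \<eta>"
    then obtain t where "t \<in> spins q" "t \<noteq> r" "\<xi> \<in> strips r t"
      using leaving_mostly[OF \<xi> out(2) \<eta> _ v] by metis
    then show False using out(1) unfolding corridors_def corridor_def by blast
  qed
  assume "\<eta> \<in> corridors r"
  then obtain t where t: "t \<in> spins q" "t \<noteq> r" "\<eta> \<in> corridor r t" unfolding corridors_def by blast
  have "\<xi> \<notin> corridor r t" using out(1) t unfolding corridors_def by blast
  then have "\<eta> \<in> entrance r t \<or> \<eta> \<in> entrance t r"
    using corridor_neighbours[OF t(3) t(2)[symmetric] \<xi> v(1) two_spin_update_back[OF v(2)]] by blast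
  moreover have "\<eta> \<notin> entrance t r" using entrance_mostly(2)[of \<eta> t r] m t(2) by blast
  ultimately show "\<exists>t\<in>spins q - {r}. \<eta> \<in> entrance r t" using t by blast
qed

text \<open>A path leaves a corridor either back to the neighbourhood of \<open>r\<close> or at the far end.\<close>

lemma step_leaving:
  assumes r: "r \<in> spins q" and \<xi>: "\<xi> \<in> X" "per \<xi> \<le> 2 * K + 2" and \<eta>: "\<eta> \<in> X" "per \<eta> \<le> 2 * K + 2"
    and v: "v \<in> V" "\<eta> = \<xi>(v := c)" and inside: "\<xi> \<in> corridors r" "\<eta> \<notin> corridors r"
  shows "mostly r \<eta> \<or> (\<exists>t\<in>spins q - {r}. \<xi> \<in> entrance t r)"
proof -
  obtain t where t: "t \<in> spins q" "t \<noteq> r" "\<xi> \<in> corridor r t" using inside(1) unfolding corridors_def by blast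
  have "\<eta> \<notin> corridor r t" using inside(2) t unfolding corridors_def by blast
  then consider "\<xi> \<in> entrance r t" | "\<xi> \<in> entrance t r"
    using corridor_neighbours[OF t(3) t(2)[symmetric] \<eta> v] by blast
  then show ?thesis
  proof cases
    case 1
    then have m: "mostly r \<xi>" using entrance_mostly(1) t(2) by blast
    have "mostly r \<eta>"
    proof (rule ccontr)
      assume "\<not> mostly r \<eta>"
      then obtain t' where "t' \<in> spins q" "t' \<noteq> r" "\<eta> \<in> strips r t'"
        using leaving_mostly[OF \<xi> m \<eta> _ v] by metis
      then show False using inside(2) unfolding corridors_def corridor_def by blast
    qed
    then show ?thesis ..
  next
    case 2
    then show ?thesis using t by blast
  qed
qed

lemma stable_not_corridors: "ground s \<notin> corridors r"
proof
  assume "ground s \<in> corridors r"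
  then obtain t where "t \<noteq> r" "ground s \<in> corridor r t" unfolding corridors_def by blast
  then show False using constant_not_corridor[of r t s] by simp
qed

lemma energy_per: "energy K L \<sigma> = int (per \<sigma>) - int (card (edges K L))"
  by (rule energy_eq_perimeter) (use K4 KL in auto)

lemma finite_X: "finite X"
  unfolding configs_def by (rule finite_PiE[OF finite_V]) (simp add: spins_def)

lemma targets_eq: "stable_configs q K L - {ground r} = ground ` (spins q - {r})"
proof -
  have "inj (constant_config K L)"
    by (rule injI) (metis mostly_constant_iff)
  then show ?thesis unfolding stable_configs_def by (simp add: image_set_diff)
qed

lemma another_spin:
  assumes "r \<in> spins q"
  obtains t where "t \<in> spins q" "t \<noteq> r"
  by (rule that[of "if r = 1 then 2 else 1"]) (use q2 in \<open>auto simp: spins_def\<close>)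

text \<open>Below perimeter \<open>2 * K + 2\<close> there is no exit from the neighbourhood of \<open>r\<close>.\<close>

lemma path_reaches_level:
  assumes r: "r \<in> spins q" and s: "s \<noteq> r" and \<omega>: "\<omega> \<in> paths q K L (ground r) (ground s)"
  shows "\<exists>\<xi>\<in>set \<omega>. 2 * K + 2 \<le> per \<xi>"
proof (rule ccontr)
  assume "\<not> ?thesis"
  then have low: "per \<xi> < 2 * K + 2" if "\<xi> \<in> set \<omega>" for \<xi> using that not_le by blast
  have "mostly r (ground s)"
  proof (rule path_invariant[OF \<omega>])
    show "mostly r (ground r)" using mostly_constant_iff by blast
    fix \<xi> \<zeta> v c
    assume *: "\<xi> \<in> set \<omega>" "\<zeta> \<in> set \<omega>" "\<xi> \<in> X" "\<zeta> \<in> X" "v \<in> V" "\<zeta> = \<xi>(v := c)" "mostly r \<xi>"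
    show "mostly r \<zeta>"
    proof (rule ccontr)
      assume "\<not> mostly r \<zeta>"
      then have "per \<xi> = 2 * K + 2"
        using leaving_mostly[OF *(3) _ *(7) *(4) _ _ *(5,6)] low[OF *(1)] low[OF *(2)]
        by (metis less_imp_le)
      then show False using low[OF *(1)] by simp
    qed
  qed
  then show False using mostly_constant_iff s by blast
qed

definition level :: int where
  "level = int (2 * K + 2) - int (card (edges K L))"

lemma path_height_ge:
  assumes "r \<in> spins q" "s \<noteq> r" "\<omega> \<in> paths q K L (ground r) (ground s)"
  shows "level \<le> path_height K L \<omega>"
proof -
  obtain \<xi> where \<xi>: "\<xi> \<in> set \<omega>" "2 * K + 2 \<le> per \<xi>" using path_reaches_level[OF assms] by blast
  have "level \<le> energy K L \<xi>" using \<xi>(2) by (simp add: energy_per level_def)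
  also have "\<dots> \<le> path_height K L \<omega>" unfolding path_height_def by (rule Max_ge) (use \<xi>(1) in auto)
  finally show ?thesis .
qed

lemma path_height_le_iff:
  assumes "\<omega> \<noteq> []"
  shows "path_height K L \<omega> \<le> level \<longleftrightarrow> (\<forall>\<xi>\<in>set \<omega>. per \<xi> \<le> 2 * K + 2)"
proof -
  have le: "energy K L \<xi> \<le> level \<longleftrightarrow> per \<xi> \<le> 2 * K + 2" for \<xi>
    unfolding energy_per level_def by linarith
  have "path_height K L \<omega> \<le> level \<longleftrightarrow> (\<forall>a\<in>energy K L ` set \<omega>. a \<le> level)"
    unfolding path_height_def by (rule Max_le_iff) (use assms in auto)
  also have "\<dots> \<longleftrightarrow> (\<forall>\<xi>\<in>set \<omega>. per \<xi> \<le> 2 * K + 2)" using le by blast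
  finally show ?thesis .
qed

lemma comm_height_eq:
  assumes rt: "r \<in> spins q" "t \<in> spins q" "t \<noteq> r"
  shows "comm_height q K L (ground r) (ground t) = level"
proof -
  have f: "column_order (\<lambda>b. (0 + b) mod L)" by (rule column_order_up)
  define D where "D = fill 0 (\<lambda>b. (0 + b) mod L)"
  have D: "chain D" unfolding D_def by (rule fill_chain[OF f])
  have full: "two_spin r t (D (K * L)) = ground t"
    using D two_spin_full unfolding chain_def by simp
  obtain \<omega> where \<omega>: "\<omega> \<in> paths q K L (ground r) (ground t)"
      "set \<omega> \<subseteq> (\<lambda>k. two_spin r t (D k)) ` {..K * L}"
    using chain_reach[OF D order_refl rt(1,2)] unfolding full reach_def by blast
  have "per \<xi> \<le> 2 * K + 2" if "\<xi> \<in> set \<omega>" for \<xi>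
    using that \<omega>(2) fill_perimeter_le[OF f rt(3)[symmetric]] unfolding D_def by blast
  moreover have "\<omega> \<noteq> []" using \<omega>(1) by (simp add: paths_def)
  ultimately have le: "path_height K L \<omega> \<le> level" using path_height_le_iff by blast
  show ?thesis
    unfolding comm_height_def
  proof (rule Min_eqI)
    have "path_height K L ` paths q K L (ground r) (ground t) \<subseteq> energy K L ` X"
    proof (intro image_subsetI)
      fix \<omega> assume "\<omega> \<in> paths q K L (ground r) (ground t)"
      then have "\<omega> \<noteq> []" "set \<omega> \<subseteq> X" by (auto simp: paths_def)
      then have "path_height K L \<omega> \<in> energy K L ` set \<omega>"
        unfolding path_height_def by (intro Max_in) auto
      then show "path_height K L \<omega> \<in> energy K L ` X" using \<open>set \<omega> \<subseteq> X\<close> by blast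
    qed
    then show "finite (path_height K L ` paths q K L (ground r) (ground t))"
      by (rule finite_subset) (simp add: finite_X)
    show "level \<le> h" if "h \<in> path_height K L ` paths q K L (ground r) (ground t)" for h
      using that path_height_ge[OF rt(1,3)] by blast
    show "level \<in> path_height K L ` paths q K L (ground r) (ground t)"
      using le path_height_ge[OF rt(1,3) \<omega>(1)] \<omega>(1) by (intro image_eqI[of _ _ \<omega>]) auto
  qed
qed

lemma comm_height_set_eq:
  assumes r: "r \<in> spins q"
  shows "comm_height_set q K L (ground r) (stable_configs q K L - {ground r}) = level"
proof -
  obtain t where "t \<in> spins q" "t \<noteq> r" using another_spin[OF r] .
  then have "comm_height q K L (ground r) ` ground ` (spins q - {r}) = {level}"
    using comm_height_eq[OF r] by (auto simp: image_iff)
  then show ?thesis unfolding comm_height_set_def targets_eq by simp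
qed

definition optimal :: "nat \<Rightarrow> config list set" where
  "optimal r = optimal_paths q K L (ground r) (stable_configs q K L - {ground r})"

lemma optimal_iff:
  assumes r: "r \<in> spins q"
  shows "\<omega> \<in> optimal r \<longleftrightarrow> (\<exists>t\<in>spins q - {r}. \<omega> \<in> paths q K L (ground r) (ground t)) \<and>
    (\<forall>\<xi>\<in>set \<omega>. per \<xi> \<le> 2 * K + 2)"
proof -
  have "path_height K L \<omega> = level \<longleftrightarrow> (\<forall>\<xi>\<in>set \<omega>. per \<xi> \<le> 2 * K + 2)"
    if "t \<in> spins q - {r}" "\<omega> \<in> paths q K L (ground r) (ground t)" for t
  proof -
    have "\<omega> \<noteq> []" using that(2) by (simp add: paths_def)
    moreover have "level \<le> path_height K L \<omega>"
      by (rule path_height_ge[OF r _ that(2)]) (use that(1) in blast)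
    then have "path_height K L \<omega> = level \<longleftrightarrow> path_height K L \<omega> \<le> level" by linarith
    ultimately show ?thesis using path_height_le_iff by simp
  qed
  moreover have "\<omega> \<in> optimal r \<longleftrightarrow>
      (\<exists>t\<in>spins q - {r}. \<omega> \<in> paths q K L (ground r) (ground t)) \<and> path_height K L \<omega> = level"
    unfolding optimal_def optimal_paths_def comm_height_set_eq[OF r] unfolding targets_eq by blast
  ultimately show ?thesis by blast
qed

lemma optimal_subset_X: "r \<in> spins q \<Longrightarrow> \<omega> \<in> optimal r \<Longrightarrow> set \<omega> \<subseteq> X"
  using optimal_iff unfolding paths_def by blast

definition level_saddles :: "nat \<Rightarrow> config set" where
  "level_saddles r = minimal_saddles q K L (ground r) (stable_configs q K L - {ground r})"

lemma level_saddles_iff: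
  assumes r: "r \<in> spins q"
  shows "\<xi> \<in> level_saddles r \<longleftrightarrow> per \<xi> = 2 * K + 2 \<and> (\<exists>\<omega>\<in>optimal r. \<xi> \<in> set \<omega>)"
proof -
  have "energy K L \<xi> = Max (energy K L ` set \<omega>) \<longleftrightarrow> per \<xi> = 2 * K + 2" if "\<omega> \<in> optimal r" for \<omega>
  proof -
    have "Max (energy K L ` set \<omega>) = level"
      using that unfolding optimal_def optimal_paths_def comm_height_set_eq[OF r] path_height_def
      by blast
    then show ?thesis unfolding energy_per level_def by linarith
  qed
  then show ?thesis
    unfolding level_saddles_def minimal_saddles_def optimal_def[symmetric]
    using optimal_subset_X[OF r] by blast
qed

section \<open>Every gate element lies in a corridor\<close>

text \<open>The parts of a path outside of the corridors can be replaced by paths below the level of the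
  saddles. The invariant says that every corridor configuration of \<open>\<omega>\<close> can be reached from \<open>r\<close> in this
  way: it is preserved within a corridor, it holds at the near entrances, and if \<open>\<omega>\<close> leaves a corridor
  at the far end, the descent from there to another stable configuration is below the level.\<close>

lemma optimal_path_within_corridors:
  assumes r: "r \<in> spins q" and \<omega>: "\<omega> \<in> optimal r"
  shows "\<exists>\<omega>'\<in>optimal r. set \<omega>' \<subseteq> low \<union> (set \<omega> \<inter> corridors r)"
proof -
  define U where "U = low \<union> (set \<omega> \<inter> corridors r)"
  obtain s where s: "s \<in> spins q - {r}" "\<omega> \<in> paths q K L (ground r) (ground s)"
    and level: "\<And>\<xi>. \<xi> \<in> set \<omega> \<Longrightarrow> per \<xi> \<le> 2 * K + 2"
    using \<omega> optimal_iff[OF r] by blast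
  have "\<exists>t\<in>spins q - {r}. reach U (ground r) (ground t)"
  proof (rule ccontr)
    assume none: "\<not> ?thesis"
    let ?P = "\<lambda>\<xi>. (\<xi> \<notin> corridors r \<longrightarrow> mostly r \<xi>) \<and> (\<xi> \<in> corridors r \<longrightarrow> reach U (ground r) \<xi>)"
    have "?P (ground s)"
    proof (rule path_invariant[OF s(2), where P = ?P])
      show "?P (ground r)" using mostly_constant_iff stable_not_corridors by blast
      fix \<xi> \<zeta> v c
      assume *: "\<xi> \<in> set \<omega>" "\<zeta> \<in> set \<omega>" "\<xi> \<in> X" "\<zeta> \<in> X" "v \<in> V" "\<zeta> = \<xi>(v := c)" "?P \<xi>"
      have enter: "reach U (ground a) \<eta>"
        if "\<eta> \<in> entrance a b" "\<eta> \<in> set \<omega> \<inter> corridors r" "a \<noteq> b" "a \<in> spins q" "b \<in> spins q" for \<eta> a b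
        by (rule reach_mono[OF entrance_reach[OF that(1,3,4,5)]]) (use that(2) in \<open>auto simp: U_def\<close>)
      show "?P \<zeta>"
      proof (cases "\<xi> \<in> corridors r")
        case False
        then have m: "mostly r \<xi>" using *(7) by blast
        note out = step_outside[OF r *(3) level[OF *(1)] *(4) level[OF *(2)] *(5,6) False m]
        have "reach U (ground r) \<zeta>" if cor: "\<zeta> \<in> corridors r"
        proof -
          obtain t where "t \<in> spins q - {r}" "\<zeta> \<in> entrance r t" using out(2)[OF cor] by blast
          then show ?thesis using enter[of \<zeta> r t] *(2) cor r by blast
        qed
        then show ?thesis using out(1) by blast
      next
        case True
        then have reach: "reach U (ground r) \<xi>" using *(7) by blast
        have "mostly r \<zeta>" if cor: "\<zeta> \<notin> corridors r"
        proof (rule ccontr)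
          assume "\<not> mostly r \<zeta>"
          then obtain t where t: "t \<in> spins q - {r}" "\<xi> \<in> entrance t r"
            using step_leaving[OF r *(3) level[OF *(1)] *(4) level[OF *(2)] *(5,6) True cor] by blast
          have "reach U (ground t) \<xi>" by (rule enter[OF t(2)]) (use t(1) r True *(1) in auto)
          then have "reach U (ground r) (ground t)" by (rule reach_trans[OF reach reach_sym])
          then show False using none t(1) by blast
        qed
        moreover have "reach U (ground r) \<zeta>" if "\<zeta> \<in> corridors r"
          by (rule reach_step[OF reach *(4) _ *(5,6)]) (use that *(2) in \<open>auto simp: U_def\<close>)
        ultimately show ?thesis by blast
      qed
    qed
    then show False using stable_not_corridors mostly_constant_iff s(1) by blast
  qed
  then obtain t \<omega>' where t: "t \<in> spins q - {r}" "\<omega>' \<in> paths q K L (ground r) (ground t)" "set \<omega>' \<subseteq> U"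
    unfolding reach_def by blast
  have "per \<xi> \<le> 2 * K + 2" if "\<xi> \<in> set \<omega>'" for \<xi>
    using that t(3) level unfolding U_def low_def by fastforce
  then have "\<omega>' \<in> optimal r" using optimal_iff[OF r] t(1,2) by blast
  then show ?thesis using t(3) unfolding U_def by blast
qed

text \<open>For a point \<open>x\<close> of a minimal gate there is an optimal path that meets the gate in \<open>x\<close> only. The path
  obtained from it by avoiding saddles outside of the corridors still has to meet the gate, and
  hence in \<open>x\<close>.\<close>

lemma minimal_gate_subset:
  assumes r: "r \<in> spins q"
    and W: "minimal_gate q K L (ground r) (stable_configs q K L - {ground r}) W"
  shows "W \<subseteq> (\<Union>t\<in>spins q - {r}. corridor_saddles r t)"
proof
  fix x assume x: "x \<in> W"
  have sub: "W \<subseteq> level_saddles r" and hit: "\<And>\<omega>. \<omega> \<in> optimal r \<Longrightarrow> set \<omega> \<inter> W \<noteq> {}"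
    using W unfolding minimal_gate_def gate_def level_saddles_def optimal_def by blast+
  have "W - {x} \<subset> W" using x by blast
  then obtain \<omega> where \<omega>: "\<omega> \<in> optimal r" "set \<omega> \<inter> (W - {x}) = {}"
    using W unfolding minimal_gate_def optimal_def by blast
  obtain \<omega>' where \<omega>': "\<omega>' \<in> optimal r" "set \<omega>' \<subseteq> low \<union> (set \<omega> \<inter> corridors r)"
    using optimal_path_within_corridors[OF r \<omega>(1)] by blast
  obtain y where y: "y \<in> set \<omega>'" "y \<in> W" using hit[OF \<omega>'(1)] by blast
  have per: "per y = 2 * K + 2" using sub y(2) level_saddles_iff[OF r] by blast
  then have "y \<notin> low" unfolding low_def by simp
  then have y': "y \<in> set \<omega>" "y \<in> corridors r" using y(1) \<omega>'(2) by blast+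
  then have "y = x" using \<omega>(2) y(2) by blast
  then show "x \<in> (\<Union>t\<in>spins q - {r}. corridor_saddles r t)"
    using per y'(2) unfolding corridors_def corridor_saddles_def by blast
qed

section \<open>Every corridor saddle is essential\<close>

definition others :: "nat \<Rightarrow> config \<Rightarrow> nat" where
  "others r \<sigma> = card {v \<in> V. \<sigma> v \<noteq> r}"

lemma others_upd: "others r (\<sigma>(v := c)) \<le> Suc (others r \<sigma>)"
proof -
  have "{w \<in> V. (\<sigma>(v := c)) w \<noteq> r} \<subseteq> insert v {w \<in> V. \<sigma> w \<noteq> r}" by auto
  then have "others r (\<sigma>(v := c)) \<le> card (insert v {w \<in> V. \<sigma> w \<noteq> r})"
    unfolding others_def by (rule card_mono[rotated]) (simp add: finite_V)
  also have "\<dots> \<le> Suc (others r \<sigma>)" unfolding others_def by (rule card_insert_le_m1) simp_all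
  finally show ?thesis .
qed

lemma corridor_values:
  assumes "\<sigma> \<in> corridor r t" "v \<in> V"
  shows "\<sigma> v = r \<or> \<sigma> v = t"
proof -
  have "\<sigma> v = a \<or> \<sigma> v = b" if g: "\<sigma> \<in> gapped a b" for a b
  proof -
    obtain i x y m h where "gapped_at a b i x y m h \<sigma>" using g unfolding gapped_def by blast
    then show ?thesis using assms(2) by (cases v) (simp add: gapped_at_def vertices_def)
  qed
  moreover have "\<sigma> v = r \<or> \<sigma> v = t" if "\<sigma> \<in> strips r t" using that assms(2) unfolding strips_def by blast
  ultimately show ?thesis using assms(1) unfolding corridor_def by blast
qed

lemma corridor_others:
  assumes "\<sigma> \<in> corridor r t" "r \<noteq> t"
  shows "others r \<sigma> = spin_count \<sigma> t" "spin_count \<sigma> r + spin_count \<sigma> t = K * L"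
proof -
  have "{v \<in> V. \<sigma> v \<noteq> r} = {v \<in> V. \<sigma> v = t}"
    using corridor_values[OF assms(1)] assms(2) by auto
  then show "others r \<sigma> = spin_count \<sigma> t" by (simp add: others_def spin_count_def)
  show "spin_count \<sigma> r + spin_count \<sigma> t = K * L" by (rule cnt_two_spins[OF corridor_values[OF assms(1)] assms(2)])
qed

lemma others_chain:
  assumes "chain D" "k \<le> K * L" "r \<noteq> t"
  shows "others r (two_spin r t (D k)) = k"
proof -
  have sub: "D k \<subseteq> V" "card (D k) = k" using chain_card[OF assms(1,2)] by blast+
  then have "{v \<in> V. two_spin r t (D k) v \<noteq> r} = D k"
    using assms(3) by (auto simp: two_spin_config_def)
  then show ?thesis using sub(2) by (simp add: others_def)
qed

lemma strips_gapped_disjoint: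
  assumes "\<sigma> \<in> strips a b"
  shows "\<sigma> \<notin> gapped c d"
proof
  assume "\<sigma> \<in> gapped c d"
  then obtain i x y m h where "gapped_at c d i x y m h \<sigma>" unfolding gapped_def by blast
  note G = gapped_atD[OF this]
  have "rowc \<sigma> i = 0" by (rule row_changes_const) (rule G(10))
  then show False using assms G(1) unfolding strips_def by blast
qed

lemma low_corridor_strips:
  assumes "\<sigma> \<in> corridor r t" "per \<sigma> < 2 * K + 2" "r \<noteq> t"
  shows "\<sigma> \<in> strips r t"
  using assms gapped_saddles[of r t] gapped_saddles[of t r] unfolding corridor_def corridor_saddles_def by fastforce

lemma gapped_cnt_bounds:
  assumes "\<sigma> \<in> gapped r t" "r \<noteq> t"
  shows "K < spin_count \<sigma> t" "spin_count \<sigma> t \<le> 2 * K - 2"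
proof -
  obtain i x y m h where g: "gapped_at r t i x y m h \<sigma>" using assms(1) unfolding gapped_def by blast
  show "K < spin_count \<sigma> t" "spin_count \<sigma> t \<le> 2 * K - 2"
    using gapped_cnt[OF g assms(2)] gapped_atD(7,8)[OF g] by linarith+
qed

lemma KL_ge: "5 * K \<le> K * L"
proof -
  have "K * 5 \<le> K * L" using K4 KL by (intro mult_le_mono2) simp
  then show ?thesis by (simp add: mult.commute)
qed

text \<open>The number of flipped vertices of a saddle is not a multiple of \<open>K\<close>, whereas that of a strip without
  bar is one: the two cannot be confused by counting.\<close>

lemma saddle_cnt:
  assumes x: "x \<in> corridor_saddles r t" and rt: "r \<noteq> t" "r \<in> spins q" "t \<in> spins q"
  shows "K + 1 \<le> spin_count x t" "\<not> K dvd spin_count x t"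
proof -
  have cor: "x \<in> corridor r t" and per: "per x = 2 * K + 2" using x unfolding corridor_saddles_def by auto
  have "K + 1 \<le> spin_count x t \<and> \<not> K dvd spin_count x t"
  proof -
    have between: "\<not> K dvd m" if "K < m" "m \<le> 2 * K - 2" for m
    proof
      assume "K dvd m"
      then obtain j where j: "m = K * j" by (rule dvdE)
      have "\<not> j \<le> 1" using that(1) j by (cases j) auto
      then have "K * 2 \<le> K * j" by (intro mult_le_mono2) simp
      then show False using that(2) j K4 by linarith
    qed
    consider "x \<in> strips r t" | "x \<in> gapped r t" | "x \<in> gapped t r"
      using cor unfolding corridor_def by blast
    then show ?thesis
    proof cases
      case 1
      have dvd: "\<not> K dvd spin_count x t" by (rule strip_saddle_not_dvd[OF 1 rt per])
      obtain k where "K \<le> k" "spin_count x t = k" using strips_fill[OF 1 rt] by metis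
      moreover have "spin_count x t \<noteq> K" using dvd by auto
      ultimately show ?thesis using dvd by simp
    next
      case 2
      then show ?thesis using between gapped_cnt_bounds[OF 2 rt(1)] by simp
    next
      case 3
      note b = gapped_cnt_bounds[OF 3 rt(1)[symmetric]]
      note sum = corridor_others(2)[OF cor rt(1)]
      have "\<not> K dvd spin_count x t"
      proof
        assume "K dvd spin_count x t"
        moreover have "K dvd spin_count x r + spin_count x t" unfolding sum by simp
        ultimately have "K dvd spin_count x r" using dvd_add_left_iff by blast
        then show False using between b by blast
      qed
      moreover have "K + 1 \<le> spin_count x t" using sum b(2) KL_ge K4 by linarith
      ultimately show ?thesis by blast
    qed
  qed
  then show "K + 1 \<le> spin_count x t" "\<not> K dvd spin_count x t" by blast+
qed

text \<open>Suppose that an optimal path whose saddles all lie on the filling path through \<open>x\<close> avoids \<open>x\<close>. Inside the corridors,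
  the number of vertices without spin \<open>r\<close> changes by at most one in each step and never takes the value
  \<open>N\<close> that it has at \<open>x\<close>: a saddle with this number would be \<open>x\<close>, and a corridor configuration below the
  level has a multiple of \<open>K\<close>. As the number is below \<open>N\<close> at every near entrance that the path can use, it
  stays below \<open>N\<close>, and the far end is never reached.\<close>

lemma saddle_essential:
  assumes r: "r \<in> spins q" and t: "t \<in> spins q" "t \<noteq> r" and x: "x \<in> corridor_saddles r t"
  shows "\<exists>\<omega>\<^sub>0\<in>optimal r. \<forall>\<omega>\<in>optimal r.
    {\<xi> \<in> set \<omega>. per \<xi> = 2 * K + 2} \<subseteq> set \<omega>\<^sub>0 \<longrightarrow> x \<in> set \<omega>"
proof -
  have rt: "r \<noteq> t" "r \<in> spins q" "t \<in> spins q" using r t by auto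
  have cor: "x \<in> corridor r t" and per: "per x = 2 * K + 2" using x unfolding corridor_saddles_def by auto
  define N where "N = spin_count x t"
  obtain D where D: "chain D" "N \<le> K * L" "x = two_spin r t (D N)"
    "\<And>k. k \<le> K * L \<Longrightarrow> per (two_spin r t (D k)) \<le> 2 * K + 2"
    "\<And>k. k \<le> K * L \<Longrightarrow> per (two_spin r t (D k)) = 2 * K + 2 \<Longrightarrow>
       two_spin r t (D k) \<in> strips r t \<or>
       x \<in> gapped r t \<and> k \<le> N \<or> x \<in> gapped t r \<and> N \<le> k"
    using corridor_chain[OF cor per rt] unfolding N_def by blast
  let ?\<sigma> = "\<lambda>k. two_spin r t (D k)"
  have full: "?\<sigma> (K * L) = ground t" using D(1) two_spin_full unfolding chain_def by simp
  obtain \<omega>\<^sub>0 where \<omega>0: "\<omega>\<^sub>0 \<in> paths q K L (ground r) (ground t)" "set \<omega>\<^sub>0 \<subseteq> ?\<sigma> ` {..K * L}"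
    using chain_reach[OF D(1) order_refl rt(2,3)] unfolding full reach_def by blast
  have "per \<xi> \<le> 2 * K + 2" if "\<xi> \<in> set \<omega>\<^sub>0" for \<xi> using that \<omega>0(2) D(4) by blast
  then have opt0: "\<omega>\<^sub>0 \<in> optimal r" using optimal_iff[OF r] \<omega>0(1) t by blast
  have N_lower: "K + 1 \<le> N" "\<not> K dvd N" using saddle_cnt[OF x rt] by (simp_all add: N_def)
  have "x \<in> corridor_saddles t r" using x saddles_commute by blast
  then have "K + 1 \<le> spin_count x r" using saddle_cnt(1)[OF _ rt(1)[symmetric] rt(3,2)] by blast
  then have N_upper: "N + K + 1 \<le> K * L" using corridor_others(2)[OF cor rt(1)] by (simp add: N_def)
  have "x \<in> set \<omega>"
    if \<omega>: "\<omega> \<in> optimal r" and sub: "{\<xi> \<in> set \<omega>. per \<xi> = 2 * K + 2} \<subseteq> set \<omega>\<^sub>0" for \<omega>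
  proof (rule ccontr)
    assume not_in: "x \<notin> set \<omega>"
    obtain s where s: "s \<in> spins q - {r}" "\<omega> \<in> paths q K L (ground r) (ground s)"
      and level: "\<And>\<xi>. \<xi> \<in> set \<omega> \<Longrightarrow> per \<xi> \<le> 2 * K + 2"
      using \<omega> optimal_iff[OF r] by blast
    have top: "\<xi> = ?\<sigma> (others r \<xi>)" "others r \<xi> \<noteq> N" "others r \<xi> \<le> K * L"
      if \<xi>: "\<xi> \<in> set \<omega>" "per \<xi> = 2 * K + 2" for \<xi>
    proof -
      have "\<xi> \<in> set \<omega>\<^sub>0" using sub \<xi> by blast
      then obtain k where k: "k \<le> K * L" "\<xi> = ?\<sigma> k" using \<omega>0(2) by blast
      have "others r \<xi> = k" unfolding k(2) by (rule others_chain[OF D(1) k(1) rt(1)])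
      then show "\<xi> = ?\<sigma> (others r \<xi>)" "others r \<xi> \<noteq> N" "others r \<xi> \<le> K * L"
        using k D(3) not_in \<xi>(1) by auto
    qed
    \<comment> \<open>The value \<open>N\<close> is never taken inside the corridors: the saddles of \<open>\<omega>\<close> are determined by this
      number, and below the level it is a multiple of \<open>K\<close>.\<close>
    have not_N: "others r \<xi> \<noteq> N" if \<xi>: "\<xi> \<in> set \<omega>" "\<xi> \<in> corridors r" for \<xi>
    proof (cases "per \<xi> = 2 * K + 2")
      case True
      then show ?thesis using top(2) \<xi>(1) by blast
    next
      case False
      obtain t' where t': "t' \<in> spins q" "t' \<noteq> r" "\<xi> \<in> corridor r t'"
        using \<xi>(2) unfolding corridors_def by blast
      have low: "per \<xi> < 2 * K + 2" using False level[OF \<xi>(1)] by simp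
      have "\<xi> \<in> strips r t'" using low_corridor_strips[OF t'(3) low] t'(2) by blast
      then have "K dvd spin_count \<xi> t'" using strip_not_saddle_dvd[OF _ _ r t'(1) low] t'(2) by blast
      then show ?thesis using corridor_others(1)[OF t'(3)] t'(2) N_lower(2) by metis
    qed
    \<comment> \<open>On the filling path, gapped saddles occur at most between \<open>x\<close> and the end nearer to \<open>x\<close>.
      This bounds the number at the
      gapped entrances; at the other entrances it is clear, since \<open>N\<close> is at least \<open>K + 1\<close> away from
      \<open>0\<close> and \<open>K * L\<close>.\<close>
    have gapped_bound: "x \<in> gapped r t \<and> others r \<xi> \<le> N \<or> x \<in> gapped t r \<and> N \<le> others r \<xi>"
      if \<xi>: "\<xi> \<in> set \<omega>" "\<xi> \<in> gapped a b" "a \<noteq> b" for \<xi> a b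
    proof -
      have p: "per \<xi> = 2 * K + 2" using gapped_saddles[OF \<xi>(3)] \<xi>(2) unfolding corridor_saddles_def by blast
      have "?\<sigma> (others r \<xi>) \<notin> strips r t"
        using strips_gapped_disjoint \<xi>(2) top(1)[OF \<xi>(1) p] by metis
      moreover have "per (?\<sigma> (others r \<xi>)) = 2 * K + 2" using p top(1)[OF \<xi>(1) p] by simp
      ultimately show ?thesis using D(5)[OF top(3)[OF \<xi>(1) p]] by blast
    qed
    have x_thin: "N \<le> 2 * K - 2" if "x \<in> gapped r t"
      using gapped_cnt_bounds(2)[OF that rt(1)] by (simp add: N_def)
    have x_thick: "K * L \<le> N + (2 * K - 2)" if "x \<in> gapped t r"
      using gapped_cnt_bounds(2)[OF that rt(1)[symmetric]] corridor_others(2)[OF cor rt(1)]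
      by (simp add: N_def)
    let ?P = "\<lambda>\<xi>. (\<xi> \<notin> corridors r \<longrightarrow> mostly r \<xi>) \<and> (\<xi> \<in> corridors r \<longrightarrow> others r \<xi> < N)"
    have "?P (ground s)"
    proof (rule path_invariant[OF s(2), where P = ?P])
      show "?P (ground r)" using mostly_constant_iff stable_not_corridors by blast
      fix \<xi> \<zeta> v c
      assume *: "\<xi> \<in> set \<omega>" "\<zeta> \<in> set \<omega>" "\<xi> \<in> X" "\<zeta> \<in> X" "v \<in> V" "\<zeta> = \<xi>(v := c)" "?P \<xi>"
      show "?P \<zeta>"
      proof (cases "\<xi> \<in> corridors r")
        case False
        then have m: "mostly r \<xi>" using *(7) by blast
        note out = step_outside[OF r *(3) level[OF *(1)] *(4) level[OF *(2)] *(5,6) False m]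
        have "others r \<zeta> < N" if c: "\<zeta> \<in> corridors r"
        proof -
          obtain t' where t': "t' \<in> spins q" "t' \<noteq> r" "\<zeta> \<in> entrance r t'" using out(2)[OF c] by blast
          have spin_count: "others r \<zeta> = spin_count \<zeta> t'"
            using corridor_others(1)[of \<zeta> r t'] t' entrance_corridor by blast
          have "others r \<zeta> \<le> N"
          proof (cases "\<zeta> \<in> strips r t' \<and> spin_count \<zeta> t' \<le> K + 1")
            case True
            then show ?thesis using spin_count N_lower(1) by simp
          next
            case False
            then have g: "\<zeta> \<in> gapped r t'" "spin_count \<zeta> t' \<le> 2 * K - 3"
              using t'(3) unfolding entrance_def by blast+
            show ?thesis
              using gapped_bound[OF *(2) g(1) t'(2)[symmetric]]
            proof (elim disjE conjE)
              assume "x \<in> gapped t r"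
              then show ?thesis using x_thick g(2) spin_count KL_ge K4 by linarith
            qed
          qed
          then show ?thesis using not_N[OF *(2) c] by simp
        qed
        then show ?thesis using out(1) by blast
      next
        case True
        then have less: "others r \<xi> < N" using *(7) by blast
        have "mostly r \<zeta>" if c: "\<zeta> \<notin> corridors r"
        proof (rule ccontr)
          assume "\<not> mostly r \<zeta>"
          then obtain t' where t': "t' \<in> spins q" "t' \<noteq> r" "\<xi> \<in> entrance t' r"
            using step_leaving[OF r *(3) level[OF *(1)] *(4) level[OF *(2)] *(5,6) True c] by blast
          have cor': "\<xi> \<in> corridor r t'" using entrance_corridor t'(3) corridor_commute by blast
          have sum: "spin_count \<xi> r + others r \<xi> = K * L"
            using corridor_others[OF cor'] t'(2) by simp
          show False
          proof (cases "\<xi> \<in> strips t' r \<and> spin_count \<xi> r \<le> K + 1")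
            case True
            then show False using sum N_upper less by linarith
          next
            case False
            then have g: "\<xi> \<in> gapped t' r" "spin_count \<xi> r \<le> 2 * K - 3"
              using t'(3) unfolding entrance_def by blast+
            show False
              using gapped_bound[OF *(1) g(1) t'(2)] less
            proof (elim disjE conjE)
              assume "x \<in> gapped r t"
              then show False using x_thin g(2) sum less KL_ge K4 by linarith
            qed simp
          qed
        qed
        moreover have "others r \<zeta> < N" if c: "\<zeta> \<in> corridors r"
          using others_upd[of r \<xi> v c] *(6) less not_N[OF *(2) c] by simp
        ultimately show ?thesis by blast
      qed
    qed
    then show False using stable_not_corridors mostly_constant_iff s(1) by blast
  qed
  then show ?thesis using opt0 by blast
qed

text \<open>The saddles off the path \<open>\<omega>\<^sub>0\<close> together with \<open>x\<close> form a gate, which \<open>\<omega>\<^sub>0\<close> meets in \<open>x\<close> only. Hence every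
  minimal gate contained in it contains \<open>x\<close>.\<close>

lemma saddle_in_minimal_gate:
  assumes r: "r \<in> spins q" and t: "t \<in> spins q" "t \<noteq> r" and x: "x \<in> corridor_saddles r t"
  shows "\<exists>W. minimal_gate q K L (ground r) (stable_configs q K L - {ground r}) W \<and> x \<in> W"
proof -
  let ?A = "stable_configs q K L - {ground r}"
  obtain \<omega>\<^sub>0 where \<omega>0: "\<omega>\<^sub>0 \<in> optimal r" and essential: "\<forall>\<omega>\<in>optimal r.
      {\<xi> \<in> set \<omega>. per \<xi> = 2 * K + 2} \<subseteq> set \<omega>\<^sub>0 \<longrightarrow> x \<in> set \<omega>"
    using saddle_essential[OF assms] by blast
  \<comment> \<open>Every optimal path with a saddle off \<open>\<omega>\<^sub>0\<close> meets the first part; the others contain \<open>x\<close>.\<close>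
  define W0 where "W0 = (level_saddles r - set \<omega>\<^sub>0) \<union> {x}"
  have "x \<in> set \<omega>\<^sub>0" using essential \<omega>0 by blast
  moreover have "per x = 2 * K + 2" using x by (simp add: corridor_saddles_def)
  ultimately have "x \<in> level_saddles r" using level_saddles_iff[OF r] \<omega>0 by blast
  then have W0_sub: "W0 \<subseteq> level_saddles r" unfolding W0_def by blast
  have W0_hit: "set \<omega> \<inter> W0 \<noteq> {}" if \<omega>: "\<omega> \<in> optimal r" for \<omega>
  proof (cases "\<exists>\<xi>\<in>set \<omega>. per \<xi> = 2 * K + 2 \<and> \<xi> \<notin> set \<omega>\<^sub>0")
    case True
    then show ?thesis using level_saddles_iff[OF r] \<omega> unfolding W0_def by blast
  next
    case False
    then have "x \<in> set \<omega>" using essential \<omega> by blast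
    then show ?thesis unfolding W0_def by blast
  qed
  have gate_iff: "gate q K L (ground r) ?A W \<longleftrightarrow>
      W \<subseteq> level_saddles r \<and> (\<forall>\<omega>\<in>optimal r. set \<omega> \<inter> W \<noteq> {})" for W
    unfolding gate_def level_saddles_def optimal_def ..
  have "level_saddles r \<subseteq> X" unfolding level_saddles_def minimal_saddles_def by blast
  then have "finite W0" using W0_sub finite_X by (meson finite_subset)
  then have fin: "finite {W. W \<subseteq> W0 \<and> gate q K L (ground r) ?A W}" by simp
  have "W0 \<in> {W. W \<subseteq> W0 \<and> gate q K L (ground r) ?A W}"
    using W0_sub W0_hit gate_iff by blast
  then obtain W where W: "W \<subseteq> W0" "gate q K L (ground r) ?A W"
    and min: "\<And>W'. W' \<subseteq> W0 \<Longrightarrow> gate q K L (ground r) ?A W' \<Longrightarrow> W' \<subseteq> W \<Longrightarrow> W' = W"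
    using finite_has_minimal[OF fin] by (metis (no_types, lifting) empty_iff mem_Collect_eq)
  have "\<exists>\<omega>\<in>optimal r. set \<omega> \<inter> W' = {}" if W': "W' \<subset> W" for W'
  proof (rule ccontr)
    assume "\<not> ?thesis"
    moreover have "W' \<subseteq> level_saddles r" using W' W(2) gate_iff by blast
    ultimately have "gate q K L (ground r) ?A W'" using gate_iff by blast
    then show False using min[of W'] W' W(1) by blast
  qed
  then have "minimal_gate q K L (ground r) ?A W"
    using W(2) unfolding minimal_gate_def optimal_def by blast
  moreover have "x \<in> W"
  proof -
    have "set \<omega>\<^sub>0 \<inter> W \<noteq> {}" using W(2) gate_iff \<omega>0 by blast
    then show ?thesis using W(1) unfolding W0_def by blast
  qed
  ultimately show ?thesis by blast
qed

end

theorem theorem3p4: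
  fixes q K L r :: nat
  assumes "q > 2" and "K \<ge> 4" and "K < L" and "L \<ge> 3"
    and "r \<in> spins q"
  shows "union_minimal_gates q K L (constant_config K L r)
           (stable_configs q K L - {constant_config K L r}) =
         (\<Union>t\<in>spins q - {r}. F_union K L r t)"
proof -
  interpret torus q K L by unfold_locales (use assms in auto)
  have F: "(\<Union>t\<in>spins q - {r}. F_union K L r t) = (\<Union>t\<in>spins q - {r}. corridor_saddles r t)"
    by (rule SUP_cong) (use F_union_eq_saddles assms(5) in auto)
  show ?thesis
    unfolding F union_minimal_gates_def
    using minimal_gate_subset[OF assms(5)] saddle_in_minimal_gate[OF assms(5)] by blast
qed

end
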